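(* Let $c>0$ and $k\in(0,c/4)$, let $u_0=u_0(\cdot;k,c)$ be the smooth solitary wave profile of the Degasperis–Procesi equation with speed $c$ and asymptotic end state $k$, and let $\mathcal A[u_0]$ be the associated linearized operator. The point spectrum (set of eigenvalues) of $\mathcal A[u_0]$ acting on $L^2(\mathbb R)$ contains only the origin, that is, $$\sigma_p\left(\mathcal A[u_0];L^2(\mathbb R)\right)=\{0\}.$$
   Context: The Degasperis–Procesi (DP) equation is $u_t-u_{txx}=3u_xu_{xx}-4uu_x+uu_{xxx}$. For each $c>0$ and $k\in(0,c/4)$ it is known that there is a smooth traveling wave $u(x,t)=u_0(x-ct)$, with non-constant even profile $u_0=u_0(\cdot;k,c)\in C^\infty(\mathbb R)$ satisfying $(c-u_0)^3(u_0-u_0'')=k(c-k)^3$, $u_0'(0)=0$, $u_0(\xi)\to k$ as $|\xi|\to\infty$, $0<u_0<c$ and $u_0-u_0''>0$ on $\mathbb R$. Linearizing DP about $u_0$ in the moving frame $\xi=x-ct$ gives $v_t=\mathcal A[u_0]v$ with $$\mathcal A[u_0]v=(1-\partial_\xi^2)^{-1}\left[c\,\partial_\xi(1-\partial_\xi^2)v-\partial_\xi(4-\partial_\xi^2)(u_0v)\right],$$ acting on $L^2(\mathbb R)$ (complex-valued) with domain $H^1(\mathbb R)$. *)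

theory Defs
  imports "HOL-Analysis.Analysis"
begin

section \<open>Smooth solitary waves of the Degasperis--Procesi equation\<close>

definition smooth :: "(real \<Rightarrow> real) \<Rightarrow> bool" where
  "smooth f \<longleftrightarrow> (\<forall>n. (deriv ^^ n) f differentiable_on UNIV)"

text \<open>The arguments of \<open>u\<close> are space and time, in this order.\<close>

definition solves_DP :: "(real \<Rightarrow> real \<Rightarrow> real) \<Rightarrow> bool" where
  "solves_DP u \<longleftrightarrow> (\<forall>x t.
     let u_x = (\<lambda>n. (deriv ^^ n) (\<lambda>y. u y t) x);
         u_t = (\<lambda>y. deriv (u y) t)
     in u_t x - (deriv ^^ 2) u_t x
          = 3 * u_x 1 * u_x 2 - 4 * u x t * u_x 1 + u x t * u_x 3)"

definition solitary_wave_profile :: "real \<Rightarrow> real \<Rightarrow> (real \<Rightarrow> real) \<Rightarrow> bool" where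
  "solitary_wave_profile c k u0 \<longleftrightarrow>
     smooth u0 \<and>
     solves_DP (\<lambda>x t. u0 (x - c * t)) \<and>
     \<not> u0 constant_on UNIV \<and>
     (\<forall>\<xi>. u0 (- \<xi>) = u0 \<xi>) \<and>
     (\<forall>\<xi>. (c - u0 \<xi>) ^ 3 * (u0 \<xi> - (deriv ^^ 2) u0 \<xi>) = k * (c - k) ^ 3) \<and>
     deriv u0 0 = 0 \<and>
     (u0 \<longlongrightarrow> k) at_infinity \<and>
     (\<forall>\<xi>. 0 < u0 \<xi> \<and> u0 \<xi> < c) \<and>
     (\<forall>\<xi>. 0 < u0 \<xi> - (deriv ^^ 2) u0 \<xi>)"


section \<open>Distributions and Sobolev spaces on the line\<close>

text \<open>
  A complex-valued distribution is determined by its values on real-valued test functions,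
  so only these are used. Distributions are represented as functions on all of
  \<^typ>\<open>real \<Rightarrow> real\<close>, of which only the values on test functions are meaningful; they are
  therefore compared by \<open>dist_eq\<close> and not by equality.
\<close>

type_synonym distribution = "(real \<Rightarrow> real) \<Rightarrow> complex"

definition test_functions :: "(real \<Rightarrow> real) set" where
  "test_functions = {\<phi>. smooth \<phi> \<and> compact (closure {x. \<phi> x \<noteq> 0})}"

definition dist_eq :: "distribution \<Rightarrow> distribution \<Rightarrow> bool" where
  "dist_eq S T \<longleftrightarrow> (\<forall>\<phi>\<in>test_functions. S \<phi> = T \<phi>)"

definition dist_of :: "(real \<Rightarrow> complex) \<Rightarrow> distribution" where
  "dist_of f = (\<lambda>\<phi>. LINT x|lborel. \<phi> x *\<^sub>R f x)"

definition dist_deriv :: "distribution \<Rightarrow> distribution" where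
  "dist_deriv T = (\<lambda>\<phi>. - T (deriv \<phi>))"

text \<open>The differential operator \<open>a - \<partial>\<^sup>2\<close>.\<close>

definition const_minus_deriv2 :: "real \<Rightarrow> distribution \<Rightarrow> distribution" where
  "const_minus_deriv2 a T = (\<lambda>\<phi>. of_real a * T \<phi> - dist_deriv (dist_deriv T) \<phi>)"

text \<open>
  Elements of \<open>L\<^sup>2\<close> and \<open>H\<^sup>1\<close> are represented by Borel functions, without passing to the
  quotient by almost-everywhere equality.
\<close>

definition L2 :: "(real \<Rightarrow> complex) set" where
  "L2 = {f \<in> borel_measurable lborel. integrable lborel (\<lambda>x. (cmod (f x))\<^sup>2)}"

definition H1 :: "(real \<Rightarrow> complex) set" where
  "H1 = {f \<in> L2. \<exists>g\<in>L2. dist_eq (dist_deriv (dist_of f)) (dist_of g)}"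


section \<open>The linearized operator and its point spectrum\<close>

text \<open>
  Operators into \<open>L\<^sup>2\<close> are given by their graphs, as their values are functions determined
  only up to null sets. The following is the graph of \<open>(1 - \<partial>\<^sup>2)\<^sup>-\<^sup>1\<close>, the inverse of the
  (injective) operator \<open>1 - \<partial>\<^sup>2\<close> from \<open>L\<^sup>2\<close> to \<open>H\<^sup>-\<^sup>2\<close>.
\<close>

definition inv_one_minus_deriv2 :: "(distribution \<times> (real \<Rightarrow> complex)) set" where
  "inv_one_minus_deriv2 =
     {(T, w). w \<in> L2 \<and> dist_eq (const_minus_deriv2 1 (dist_of w)) T}"

definition linearized_DP ::
  "real \<Rightarrow> (real \<Rightarrow> real) \<Rightarrow> ((real \<Rightarrow> complex) \<times> (real \<Rightarrow> complex)) set" where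
  "linearized_DP c u0 = {(v, w). v \<in> H1 \<and>
     (\<lambda>\<phi>. of_real c * dist_deriv (const_minus_deriv2 1 (dist_of v)) \<phi>
          - dist_deriv (const_minus_deriv2 4 (dist_of (\<lambda>\<xi>. of_real (u0 \<xi>) * v \<xi>))) \<phi>, w)
       \<in> inv_one_minus_deriv2}"

definition point_spectrum_L2 ::
  "((real \<Rightarrow> complex) \<times> (real \<Rightarrow> complex)) set \<Rightarrow> complex set" where
  "point_spectrum_L2 A =
     {z. \<exists>v\<in>L2. \<not> (AE \<xi> in lborel. v \<xi> = 0) \<and> (v, \<lambda>\<xi>. z * v \<xi>) \<in> A}"

end

theory Submission
  imports Defs "HOL-Computational_Algebra.Fundamental_Theorem_Algebra"
begin

text \<open>
  An eigenfunction \<open>v\<close> for \<open>l\<close> is a weak solution, i.e. it annihilates the range of the third-order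
  operator \<open>dual_op l\<close> on test functions. By integrability of the equation, \<open>dual_op l \<eta> = 0\<close> has explicit
  solutions (squared eigenfunctions of the Lax pair): with \<open>\<theta>' = 1 / w\<close>, \<open>w = c - u\<^sub>0\<close> and
  \<open>r = w w' / (w - W)\<close>, \<open>W = c - k\<close>, they are \<open>\<eta> = exp (s \<theta>) Q\<close> where \<open>Q\<close> is a polynomial in \<open>w\<close> and \<open>r\<close>
  and \<open>s\<close> is a root of a cubic. Each of them is bounded near one of \<open>\<plusminus>\<infinity>\<close>, so it may be multiplied by
  functions that are constant near the other end and used as a test function. Variation of constants
  with two solutions then gives a first-order equation for \<open>v\<close>, which is solved by
  \<open>v = C \<Omega> exp (l \<theta>) / w\<close> for the Wronskian \<open>\<Omega>\<close>, away from the zeros of \<open>\<Omega>\<close>. Since the three roots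
  sum to \<open>- l\<close>, this behaves like \<open>exp (- s\<^sub>2 \<theta>)\<close> with the remaining root \<open>s\<^sub>2\<close>, so if \<open>l \<noteq> 0\<close> the two
  solutions can be chosen such that it does not decay at one end. Hence \<open>C = 0\<close>, \<open>v\<close> vanishes near that
  end, and therefore everywhere. For \<open>l = 0\<close> the translation mode \<open>u\<^sub>0'\<close> is an eigenfunction.
\<close>

section \<open>Smooth functions and test functions\<close>

text \<open>A weak solution lies a priori in the three-dimensional solution space of a third-order
  equation. Each explicit dual solution \<eta> removes one dimension: paired with \<eta>, the
  equation can be integrated once, and square-integrability of \<open>v\<close> at the end where
  \<eta> is bounded forces the constant of integration to be 0. Two of them leave a line, and the
  sign of \<open>Re s2\<close> decides at which end its elements fail to decay. Pure oscillation,
  \<open>Re s2 = 0\<close>, is also incompatible with square-integrability, so imaginary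
  \<open>l\<close> is no special case.

  Two degeneracies shape the rest. The polynomial factor of \<eta> may tend to 0 at infinity, which
  would spoil the asymptotics of the Wronskian; this happens for two exceptional real values of
  \<open>l\<close>, and there the pair of roots has to be selected by hand. Moreover nothing is
  known about zeros of the Wronskian at finite points, so the formula for \<open>v\<close> is
  exploited near one end only, and a separate unique continuation argument covers the rest of the
  line. As \<open>v\<close> is merely square-integrable and no regularity is proved for it, every
  step is a test against smooth functions.\<close>

primrec times_differentiable :: "nat \<Rightarrow> (real \<Rightarrow> complex) \<Rightarrow> bool" where
  "times_differentiable 0 f \<longleftrightarrow> True"
| "times_differentiable (Suc n) f \<longleftrightarrow>
     (\<exists>f'. (\<forall>x. (f has_vector_derivative f' x) (at x)) \<and> times_differentiable n f')"

text \<open>The recursion only asks for some derivative at each level, so closure properties follow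
  by plain induction on the order with no formula for higher derivatives. A notion separate from
  \<open>smooth\<close> is used because \<open>deriv\<close> does not apply to functions from the
  reals to the complex numbers.\<close>

definition csmooth :: "(real \<Rightarrow> complex) \<Rightarrow> bool" where
  "csmooth f \<longleftrightarrow> (\<forall>n. times_differentiable n f)"

definition vderiv :: "(real \<Rightarrow> complex) \<Rightarrow> real \<Rightarrow> complex" where
  "vderiv f = (\<lambda>x. vector_derivative f (at x))"

lemma vderiv_eqI: "(\<And>x. (f has_vector_derivative f' x) (at x)) \<Longrightarrow> vderiv f = f'"
  unfolding vderiv_def by (intro ext vector_derivative_at)

lemma times_differentiable_SucI:
  "times_differentiable n f' \<Longrightarrow> (\<And>x. (f has_vector_derivative f' x) (at x)) \<Longrightarrow>
    times_differentiable (Suc n) f"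
  by auto

lemma times_differentiable_SucD: "times_differentiable (Suc n) f \<Longrightarrow> times_differentiable n f"
proof (induction n arbitrary: f)
  case (Suc n)
  then obtain f' where "\<forall>x. (f has_vector_derivative f' x) (at x)" "times_differentiable (Suc n) f'"
    by (subst (asm) times_differentiable.simps) blast
  with Suc.IH[of f'] show ?case by auto
qed simp

lemma csmoothI:
  assumes "\<And>x. (f has_vector_derivative f' x) (at x)" "csmooth f'"
  shows "csmooth f"
  unfolding csmooth_def
proof
  fix n
  show "times_differentiable n f"
    using assms by (cases n) (auto simp: csmooth_def)
qed

lemma csmooth_deriv:
  assumes "csmooth f"
  shows "(f has_vector_derivative vderiv f x) (at x)" "csmooth (vderiv f)"
proof -
  have d: "(f has_vector_derivative vderiv f x) (at x)"
    and s: "times_differentiable n (vderiv f)" for x n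
  proof -
    have "times_differentiable (Suc n) f" using assms by (simp add: csmooth_def del: times_differentiable.simps)
    then obtain f' where f': "\<And>x. (f has_vector_derivative f' x) (at x)" "times_differentiable n f'"
      by auto
    have "vderiv f = f'" by (rule vderiv_eqI) (rule f')
    with f' show "(f has_vector_derivative vderiv f x) (at x)" "times_differentiable n (vderiv f)"
      by auto
  qed
  show "(f has_vector_derivative vderiv f x) (at x)" by (rule d)
  show "csmooth (vderiv f)" using s by (simp add: csmooth_def)
qed

lemma csmooth_continuous_on: "csmooth f \<Longrightarrow> continuous_on A f"
  by (meson continuous_at_imp_continuous_on csmooth_deriv(1) has_vector_derivative_continuous)

lemma csmooth_measurable [measurable_dest]: "csmooth f \<Longrightarrow> f \<in> borel_measurable borel"
  by (intro borel_measurable_continuous_onI csmooth_continuous_on)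

section \<open>Closure properties of smooth complex-valued functions\<close>

named_theorems csmooth_intros

lemma csmooth_const [csmooth_intros]: "csmooth (\<lambda>_. a)"
proof -
  have "times_differentiable n (\<lambda>_. a)" for n a
  proof (induction n arbitrary: a)
    case (Suc n)
    have "((\<lambda>_. a) has_vector_derivative 0) (at x)" for x :: real by simp
    with Suc.IH[of 0] show ?case by (rule times_differentiable_SucI)
  qed simp
  then show ?thesis by (simp add: csmooth_def)
qed

lemma csmooth_of_real_id [csmooth_intros]: "csmooth of_real"
  by (rule csmoothI[of _ "\<lambda>_. 1"])
     (use has_vector_derivative_of_real[where 'a=complex, OF DERIV_ident[unfolded has_real_derivative_iff_has_vector_derivative]] csmooth_const in auto)

lemma times_differentiable_add:
  "times_differentiable n f \<Longrightarrow> times_differentiable n g \<Longrightarrow> times_differentiable n (\<lambda>x. f x + g x)"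
proof (induction n arbitrary: f g)
  case (Suc n)
  then obtain f' g' where d: "\<And>x. (f has_vector_derivative f' x) (at x)" "times_differentiable n f'"
     "\<And>x. (g has_vector_derivative g' x) (at x)" "times_differentiable n g'"
    by auto
  have "((\<lambda>x. f x + g x) has_vector_derivative f' x + g' x) (at x)" for x
    by (intro has_vector_derivative_add d)
  with Suc.IH[OF d(2,4)] show ?case by (rule times_differentiable_SucI)
qed simp

lemma times_differentiable_mult:
  "times_differentiable n f \<Longrightarrow> times_differentiable n g \<Longrightarrow> times_differentiable n (\<lambda>x. f x * g x)"
proof (induction n arbitrary: f g)
  case (Suc n)
  obtain f' g' where d: "\<And>x. (f has_vector_derivative f' x) (at x)" "times_differentiable n f'"
     "\<And>x. (g has_vector_derivative g' x) (at x)" "times_differentiable n g'"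
    using Suc.prems by auto
  have "times_differentiable n (\<lambda>x. f x * g' x + f' x * g x)"
    using d Suc.prems[THEN times_differentiable_SucD] by (intro times_differentiable_add Suc.IH)
  moreover have "((\<lambda>x. f x * g x) has_vector_derivative f x * g' x + f' x * g x) (at x)" for x
    by (intro has_vector_derivative_mult d)
  ultimately show ?case by (rule times_differentiable_SucI)
qed simp

lemma csmooth_add [csmooth_intros]: "csmooth f \<Longrightarrow> csmooth g \<Longrightarrow> csmooth (\<lambda>x. f x + g x)"
  and csmooth_mult [csmooth_intros]: "csmooth f \<Longrightarrow> csmooth g \<Longrightarrow> csmooth (\<lambda>x. f x * g x)"
  by (simp_all add: csmooth_def times_differentiable_add times_differentiable_mult)

lemma csmooth_uminus [csmooth_intros]: "csmooth f \<Longrightarrow> csmooth (\<lambda>x. - f x)"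
  using csmooth_mult[OF csmooth_const[of "-1"], of f] by simp

lemma csmooth_diff [csmooth_intros]: "csmooth f \<Longrightarrow> csmooth g \<Longrightarrow> csmooth (\<lambda>x. f x - g x)"
  using csmooth_add[of f "\<lambda>x. - g x"] csmooth_uminus[of g] by simp

lemma csmooth_power [csmooth_intros]: "csmooth f \<Longrightarrow> csmooth (\<lambda>x. f x ^ n)"
  by (induction n) (auto intro: csmooth_intros)

lemma csmooth_inverse [csmooth_intros]:
  assumes f: "csmooth f" and nz: "\<And>x. f x \<noteq> 0"
  shows "csmooth (\<lambda>x. inverse (f x))"
proof -
  have "times_differentiable n (\<lambda>x. inverse (f x))" for n
  proof (induction n)
    case (Suc n)
    have "times_differentiable n (\<lambda>x. - (vderiv f x * (inverse (f x) * inverse (f x))))"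
      using csmooth_deriv(2)[OF csmooth_uminus[OF f]] csmooth_deriv(2)[OF f]
        times_differentiable_mult[OF csmooth_const[of "-1", unfolded csmooth_def, rule_format]
          times_differentiable_mult[OF _ times_differentiable_mult[OF Suc Suc]], of "vderiv f"]
      by (simp add: csmooth_def)
    moreover have "((\<lambda>x. inverse (f x)) has_vector_derivative
        - (vderiv f x * (inverse (f x) * inverse (f x)))) (at x)" for x
    proof -
      have "(inverse has_field_derivative - (inverse (f x) ^ 2)) (at (f x))"
        using DERIV_inverse[OF nz] by (simp add: numeral_2_eq_2)
      from field_vector_diff_chain_at[OF csmooth_deriv(1)[OF f] this]
      show ?thesis by (simp add: o_def power2_eq_square)
    qed
    ultimately show ?case by (rule times_differentiable_SucI)
  qed simp
  then show ?thesis by (simp add: csmooth_def)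
qed

lemma csmooth_divide [csmooth_intros]:
  "csmooth f \<Longrightarrow> csmooth g \<Longrightarrow> (\<And>x. g x \<noteq> 0) \<Longrightarrow> csmooth (\<lambda>x. f x / g x)"
  unfolding divide_inverse by (intro csmooth_intros)

lemma csmooth_exp [csmooth_intros]:
  assumes f: "csmooth f"
  shows "csmooth (\<lambda>x. exp (f x))"
proof -
  have "times_differentiable n (\<lambda>x. exp (f x))" for n
  proof (induction n)
    case (Suc n)
    have "times_differentiable n (\<lambda>x. vderiv f x * exp (f x))"
      using csmooth_deriv(2)[OF f] times_differentiable_mult[OF _ Suc] by (simp add: csmooth_def)
    moreover have "((\<lambda>x. exp (f x)) has_vector_derivative vderiv f x * exp (f x)) (at x)" for x
      using field_vector_diff_chain_at[OF csmooth_deriv(1)[OF f] DERIV_exp]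
      by (simp add: o_def)
    ultimately show ?case by (rule times_differentiable_SucI)
  qed simp
  then show ?thesis by (simp add: csmooth_def)
qed

lemma csmooth_affine:
  assumes "csmooth f"
  shows "csmooth (\<lambda>x. f (a * x + b))"
proof -
  have "times_differentiable n (\<lambda>x. f (a * x + b))" if "csmooth f" for n f
    using that
  proof (induction n arbitrary: f)
    case (Suc n)
    have 1: "((\<lambda>x. f (a * x + b)) has_vector_derivative of_real a * vderiv f (a * x + b)) (at x)" for x
    proof -
      have "((\<lambda>x. a * x + b) has_vector_derivative a) (at x)"
        by (auto intro!: derivative_eq_intros)
      from vector_diff_chain_at[OF this csmooth_deriv(1)[OF Suc.prems]]
      show ?thesis by (simp add: o_def scaleR_conv_of_real)
    qed
    have 2: "times_differentiable n (\<lambda>x. of_real a * vderiv f (a * x + b))"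
      using Suc.IH[OF csmooth_deriv(2)[OF Suc.prems]] csmooth_const
      by (intro times_differentiable_mult) (auto simp: csmooth_def)
    show ?case by (rule times_differentiable_SucI[OF 2 1])
  qed simp
  with assms show ?thesis by (simp add: csmooth_def)
qed

lemma csmooth_bounded_linear:
  assumes "csmooth f" "bounded_linear h"
  shows "csmooth (\<lambda>x. h (f x))"
proof -
  have "times_differentiable n (\<lambda>x. h (f x))" if "csmooth f" for n f
    using that
  proof (induction n arbitrary: f)
    case (Suc n)
    have "((\<lambda>x. h (f x)) has_vector_derivative h (vderiv f x)) (at x)" for x
      by (rule bounded_linear.has_vector_derivative[OF assms(2) csmooth_deriv(1)[OF Suc.prems]])
    with Suc.IH[OF csmooth_deriv(2)[OF Suc.prems]] show ?case by (rule times_differentiable_SucI)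
  qed simp
  with assms(1) show ?thesis by (simp add: csmooth_def)
qed

lemma csmooth_cnj [csmooth_intros]: "csmooth f \<Longrightarrow> csmooth (\<lambda>x. cnj (f x))"
  by (rule csmooth_bounded_linear) (auto intro: bounded_linear_cnj)

lemma csmooth_of_Re: "csmooth f \<Longrightarrow> csmooth (\<lambda>x. of_real (Re (f x)))"
  and csmooth_of_Im: "csmooth f \<Longrightarrow> csmooth (\<lambda>x. of_real (Im (f x)))"
  using csmooth_bounded_linear[of f, OF _ bounded_linear_compose[OF bounded_linear_of_real bounded_linear_Re]]
    csmooth_bounded_linear[of f, OF _ bounded_linear_compose[OF bounded_linear_of_real bounded_linear_Im]]
  by auto

section \<open>Smooth real functions as complex-valued ones\<close>

lemma has_real_derivative_of_real_iff:
  "((\<lambda>x. complex_of_real (f x)) has_vector_derivative of_real d) (at x) \<longleftrightarrow> (f has_real_derivative d) (at x)"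
proof
  assume "((\<lambda>x. complex_of_real (f x)) has_vector_derivative of_real d) (at x)"
  from bounded_linear.has_vector_derivative[OF bounded_linear_Re this]
  show "(f has_real_derivative d) (at x)" by (simp add: has_real_derivative_iff_has_vector_derivative)
qed (rule has_vector_derivative_of_real, simp add: has_real_derivative_iff_has_vector_derivative)

lemma has_vector_derivative_of_realD:
  assumes "((\<lambda>x. complex_of_real (f x)) has_vector_derivative d) (at x)"
  shows "d = of_real (Re d)" "(f has_real_derivative Re d) (at x)"
proof -
  show f: "(f has_real_derivative Re d) (at x)"
    using bounded_linear.has_vector_derivative[OF bounded_linear_Re assms]
    by (simp add: has_real_derivative_iff_has_vector_derivative)
  then show "d = of_real (Re d)"
    using assms has_real_derivative_of_real_iff vector_derivative_unique_at by blast
qed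

lemma csmooth_of_real_deriv:
  assumes "csmooth (\<lambda>x. of_real (f x))"
  shows "(f has_real_derivative deriv f x) (at x)"
    "vderiv (\<lambda>x. of_real (f x)) = (\<lambda>x. of_real (deriv f x))"
    "csmooth (\<lambda>x. of_real (deriv f x))"
proof -
  have *: "(f has_real_derivative Re (vderiv (\<lambda>x. of_real (f x)) x)) (at x)"
     "vderiv (\<lambda>x. of_real (f x)) x = of_real (Re (vderiv (\<lambda>x. of_real (f x)) x))" for x
    using has_vector_derivative_of_realD[OF csmooth_deriv(1)[OF assms]] by auto
  then have d: "deriv f x = Re (vderiv (\<lambda>x. of_real (f x)) x)" for x
    by (intro DERIV_imp_deriv)
  show "(f has_real_derivative deriv f x) (at x)" using * d by simp
  show v: "vderiv (\<lambda>x. of_real (f x)) = (\<lambda>x. of_real (deriv f x))"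
    using *(2) d by auto
  show "csmooth (\<lambda>x. of_real (deriv f x))"
    using csmooth_deriv(2)[OF assms] unfolding v .
qed

lemma csmooth_of_real_iff: "csmooth (\<lambda>x. of_real (f x)) \<longleftrightarrow> smooth f"
proof
  assume f: "csmooth (\<lambda>x. of_real (f x))"
  have "csmooth (\<lambda>x. of_real ((deriv ^^ n) f x))" for n
    by (induction n) (use f csmooth_of_real_deriv(3) in auto)
  from csmooth_of_real_deriv(1)[OF this] show "smooth f"
    unfolding smooth_def by (meson differentiable_at_imp_differentiable_on real_differentiable_def)
next
  assume "smooth f"
  then have "times_differentiable n (\<lambda>x. of_real (f x))" for n
  proof (induction n arbitrary: f)
    case (Suc n)
    have "f differentiable (at x)" for x
      using Suc.prems[unfolded smooth_def, rule_format, of 0] by (simp add: differentiable_on_def)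
    then have "(f has_real_derivative deriv f x) (at x)" for x
      using DERIV_deriv_iff_real_differentiable by blast
    moreover have "smooth (deriv f)"
      using Suc.prems unfolding smooth_def by (metis funpow_Suc_right comp_apply)
    ultimately show ?case using Suc.IH has_real_derivative_of_real_iff
      by (intro times_differentiable_SucI[where f' = "\<lambda>x. of_real (deriv f x)"]) auto
  qed simp
  then show "csmooth (\<lambda>x. of_real (f x))" by (simp add: csmooth_def)
qed

section \<open>The smooth step function\<close>

definition flat_exp :: "nat \<Rightarrow> real \<Rightarrow> real" where
  "flat_exp n x = (if x > 0 then inverse x ^ n * exp (- inverse x) else 0)"

lemma flat_exp_tendsto_0: "(flat_exp n \<longlongrightarrow> 0) (at 0)"
proof -
  have "((\<lambda>x. inverse x ^ n / exp (inverse x)) \<longlongrightarrow> 0) (at_right (0::real))"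
    by (rule filterlim_compose[OF tendsto_power_div_exp_0 filterlim_inverse_at_top_right])
  then have "(flat_exp n \<longlongrightarrow> 0) (at_right 0)"
    by (rule Lim_transform_eventually)
       (auto simp: eventually_at_right_field flat_exp_def exp_minus field_simps intro!: exI[of _ 1])
  moreover have "(flat_exp n \<longlongrightarrow> 0) (at_left 0)"
    by (rule Lim_transform_eventually[OF tendsto_const])
       (auto simp: eventually_at_left_field flat_exp_def intro!: exI[of _ "-1"])
  ultimately show ?thesis by (simp add: filterlim_split_at)
qed

text \<open>The powers of \<open>inverse x\<close> are carried along in \<open>flat_exp\<close>
  because they make the family closed under differentiation up to linear combinations. Smoothness of
  all members then follows by one induction.\<close>

lemma flat_exp_deriv:
  "(flat_exp n has_real_derivative - real n * flat_exp (n + 1) x + flat_exp (n + 2) x) (at x)"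
proof -
  consider "x > 0" | "x < 0" | "x = 0" by linarith
  then show ?thesis
  proof cases
    case 1
    have "((\<lambda>x. inverse x ^ n * exp (- inverse x)) has_real_derivative
       - real n * flat_exp (n + 1) x + flat_exp (n + 2) x) (at x)"
    proof (cases n)
      case 0
      with 1 show ?thesis
        by (auto intro!: derivative_eq_intros simp: flat_exp_def power2_eq_square)
    next
      case (Suc m)
      \<comment> \<open>Differentiating the power produces a truncated exponent; at
        \<open>m = 0\<close> the factor \<open>real m\<close> makes both sides 0.\<close>
      have "inverse x ^ (m - Suc 0) * (inverse x * inverse x) * real m = inverse x ^ m * inverse x * real m"
        by (cases m) auto
      with 1 Suc show ?thesis
        by (auto intro!: derivative_eq_intros simp: flat_exp_def power2_eq_square algebra_simps)
    qed
    then show ?thesis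
      by (rule has_field_derivative_transform_within_open[where S = "{0<..}"])
         (use 1 in \<open>auto simp: flat_exp_def\<close>)
  next
    case 2
    have "((\<lambda>_. 0) has_real_derivative 0) (at x)" by simp
    then have "(flat_exp n has_real_derivative 0) (at x)"
      by (rule has_field_derivative_transform_within_open[where S = "{..<0}"])
         (use 2 in \<open>auto simp: flat_exp_def\<close>)
    with 2 show ?thesis by (simp add: flat_exp_def)
  next
    case 3
    \<comment> \<open>At 0 the difference quotient of \<open>flat_exp n\<close> is
      \<open>flat_exp (n + 1)\<close> itself.\<close>
    have "((\<lambda>h. (flat_exp n (0 + h) - flat_exp n 0) / h) \<longlongrightarrow> 0) (at 0)"
      using flat_exp_tendsto_0[of "n + 1"]
      by (rule Lim_transform_eventually)
         (auto simp: flat_exp_def eventually_at_filter field_simps)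
    with 3 show ?thesis by (simp add: DERIV_def flat_exp_def)
  qed
qed

lemma csmooth_flat_exp: "csmooth (\<lambda>x. of_real (flat_exp n x))"
proof -
  have "times_differentiable m (\<lambda>x. of_real (flat_exp n x))" for m
  proof (induction m arbitrary: n)
    case (Suc m)
    have "times_differentiable m (\<lambda>x. of_real (- real n) * of_real (flat_exp (n + 1) x) + of_real (flat_exp (n + 2) x))"
      using csmooth_const
      by (intro times_differentiable_add times_differentiable_mult Suc) (simp add: csmooth_def)
    moreover have "((\<lambda>x. complex_of_real (flat_exp n x)) has_vector_derivative
       of_real (- real n) * of_real (flat_exp (n + 1) x) + of_real (flat_exp (n + 2) x)) (at x)" for x
      using flat_exp_deriv[of n x] has_real_derivative_of_real_iff[of "flat_exp n" "- real n * flat_exp (n + 1) x + flat_exp (n + 2) x"]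
      by simp
    ultimately show ?case by (rule times_differentiable_SucI)
  qed simp
  then show ?thesis by (simp add: csmooth_def)
qed

definition smooth_step :: "real \<Rightarrow> real" where
  "smooth_step x = flat_exp 0 x / (flat_exp 0 x + flat_exp 0 (1 - x))"

lemma flat_exp_0_pos: "x > 0 \<Longrightarrow> flat_exp 0 x > 0"
  and flat_exp_0_nonneg: "flat_exp 0 x \<ge> 0"
  and flat_exp_eq_0: "x \<le> 0 \<Longrightarrow> flat_exp n x = 0"
  by (auto simp: flat_exp_def)

lemma flat_exp_sum_pos: "flat_exp 0 x + flat_exp 0 (1 - x) > 0"
proof (cases "x > 0")
  case True
  then show ?thesis using flat_exp_0_pos[of x] flat_exp_0_nonneg[of "1 - x"] by linarith
next
  case False
  then show ?thesis using flat_exp_0_pos[of "1 - x"] flat_exp_0_nonneg[of "x"] by linarith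
qed

lemma smooth_step_eq_0: "x \<le> 0 \<Longrightarrow> smooth_step x = 0"
  and smooth_step_pos: "x > 0 \<Longrightarrow> smooth_step x > 0"
  and smooth_step_nonneg: "smooth_step x \<ge> 0"
  and smooth_step_le_1: "smooth_step x \<le> 1"
  using flat_exp_sum_pos[of x] flat_exp_0_nonneg[of x] flat_exp_0_nonneg[of "1 - x"]
    flat_exp_0_pos[of x]
  by (simp_all add: smooth_step_def flat_exp_eq_0 flat_exp_0_pos divide_simps)

lemma smooth_step_eq_1: "1 \<le> x \<Longrightarrow> smooth_step x = 1"
  using flat_exp_0_pos[of x] by (simp add: smooth_step_def flat_exp_eq_0)

lemma csmooth_smooth_step: "csmooth (\<lambda>x. of_real (smooth_step (a * x + b)))"
proof -
  have "csmooth (\<lambda>x. of_real (flat_exp 0 (1 - x)))"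
    using csmooth_affine[OF csmooth_flat_exp[of 0], of "-1" 1] by simp
  then have "csmooth (\<lambda>x. of_real (flat_exp 0 x) /
      (of_real (flat_exp 0 x) + of_real (flat_exp 0 (1 - x))))"
    using flat_exp_sum_pos csmooth_flat_exp
    by (intro csmooth_intros) (auto simp flip: of_real_add simp: less_imp_neq[symmetric])
  then have "csmooth (\<lambda>x. of_real (smooth_step x))"
    by (simp add: smooth_step_def)
  from csmooth_affine[OF this] show ?thesis .
qed

lemma csmooth_smooth_step_affine [csmooth_intros]:
  "csmooth (\<lambda>x. of_real (smooth_step (x - a)))" "csmooth (\<lambda>x. of_real (smooth_step (a - x)))"
  using csmooth_smooth_step[of 1 "-a"] csmooth_smooth_step[of "-1" a] by simp_all

text \<open>Complex-valued, unlike \<open>test_functions\<close>, because these functions get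
  multiplied by the explicit dual solutions, which are complex. The two notions are linked by
  \<open>ctest_of_real\<close> and \<open>ctest_split\<close>.\<close>

definition ctest :: "(real \<Rightarrow> complex) \<Rightarrow> bool" where
  "ctest \<phi> \<longleftrightarrow> csmooth \<phi> \<and> (\<exists>R. \<forall>x. \<bar>x\<bar> > R \<longrightarrow> \<phi> x = 0)"

lemma vderiv_eq_0_of_eq_const:
  assumes "open S" "x \<in> S" "\<And>y. y \<in> S \<Longrightarrow> f y = c"
  shows "vderiv f x = 0"
proof -
  have "((\<lambda>_. c) has_vector_derivative 0) (at x)" by simp
  then have "(f has_vector_derivative 0) (at x)"
    by (rule has_vector_derivative_transform_within_open[OF _ assms(1,2)]) (simp add: assms(3))
  then show ?thesis unfolding vderiv_def by (rule vector_derivative_at)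
qed

lemma ctest_vderiv:
  assumes "ctest \<phi>"
  shows "ctest (vderiv \<phi>)"
proof -
  obtain R where R: "\<And>x. \<bar>x\<bar> > R \<Longrightarrow> \<phi> x = 0" and "csmooth \<phi>"
    using assms by (auto simp: ctest_def)
  have "vderiv \<phi> x = 0" if "\<bar>x\<bar> > R" for x
  proof (rule vderiv_eq_0_of_eq_const[where S = "{x. \<bar>x\<bar> > R}"])
    show "open {x. \<bar>x\<bar> > R}" by (intro open_Collect_less continuous_intros)
  qed (use that R in auto)
  with \<open>csmooth \<phi>\<close> show ?thesis by (auto simp: ctest_def csmooth_deriv)
qed

lemma ctest_mult: "ctest \<phi> \<Longrightarrow> csmooth f \<Longrightarrow> ctest (\<lambda>x. \<phi> x * f x)"
  and ctest_mult': "ctest \<phi> \<Longrightarrow> csmooth f \<Longrightarrow> ctest (\<lambda>x. f x * \<phi> x)"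
  unfolding ctest_def by (fastforce intro: csmooth_intros)+

lemma ctest_diff: 
  assumes "ctest \<phi>" "ctest \<psi>"
  shows "ctest (\<lambda>x. \<phi> x - \<psi> x)"
proof -
  obtain R1 R2 where "\<And>x. \<bar>x\<bar> > R1 \<Longrightarrow> \<phi> x = 0" "\<And>x. \<bar>x\<bar> > R2 \<Longrightarrow> \<psi> x = 0"
    using assms by (auto simp: ctest_def)
  then have "\<exists>R. \<forall>x. \<bar>x\<bar> > R \<longrightarrow> \<phi> x - \<psi> x = 0"
    by (intro exI[of _ "max R1 R2"]) auto
  with assms show ?thesis unfolding ctest_def by (auto intro: csmooth_intros)
qed

section \<open>Square-integrable functions\<close>

lemma L2_measurable [measurable_dest]: "f \<in> L2 \<Longrightarrow> f \<in> borel_measurable borel"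
  by (simp add: L2_def)

lemma L2I_bounded:
  assumes [measurable]: "f \<in> borel_measurable borel" and "\<And>x. cmod (f x) \<le> B" "\<And>x. \<bar>x\<bar> > R \<Longrightarrow> f x = 0"
  shows "f \<in> L2"
proof -
  have "integrable lborel (\<lambda>x. (cmod (f x))\<^sup>2)"
  proof (rule Bochner_Integration.integrable_bound)
    show "integrable lborel (\<lambda>x. B\<^sup>2 * indicator {-R..R} x)"
      by (intro integrable_mult_right integrable_real_indicator) (auto simp: emeasure_lborel_Icc_eq)
    have "norm ((cmod (f x))\<^sup>2) \<le> norm (B\<^sup>2 * indicator {-R..R} x)" for x
      using assms(2)[of x] assms(3)[of x] by (auto simp: indicator_def intro!: power_mono)
    then show "AE x in lborel. norm ((cmod (f x))\<^sup>2) \<le> norm (B\<^sup>2 * indicator {-R..R} x)" by simp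
  qed auto
  then show ?thesis by (simp add: L2_def)
qed

lemma L2I_continuous:
  fixes f :: "real \<Rightarrow> complex"
  assumes "continuous_on UNIV f" "\<And>x. \<bar>x\<bar> > R \<Longrightarrow> f x = 0"
  shows "f \<in> L2"
proof -
  have "compact (f ` {-R..R})"
    by (intro compact_continuous_image continuous_on_subset[OF assms(1)]) auto
  then obtain B where B: "\<And>x. x \<in> {-R..R} \<Longrightarrow> cmod (f x) \<le> B"
    using compact_imp_bounded bounded_iff by (metis imageI)
  show ?thesis
  proof (rule L2I_bounded)
    show "f \<in> borel_measurable borel" by (rule borel_measurable_continuous_onI) fact
    show "cmod (f x) \<le> max B 0" for x
      using B[of x] assms(2)[of x] by (cases "\<bar>x\<bar> > R") (auto simp: le_max_iff_disj not_less abs_le_iff)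
  qed (rule assms)
qed

lemma ctest_L2: "ctest \<phi> \<Longrightarrow> \<phi> \<in> L2"
  by (auto simp: ctest_def intro: L2I_continuous csmooth_continuous_on)

lemma L2_mult_integrable:
  assumes "f \<in> L2" "g \<in> L2"
  shows "integrable lborel (\<lambda>x. f x * g x)"
proof (rule Bochner_Integration.integrable_bound)
  show "integrable lborel (\<lambda>x. (cmod (f x))\<^sup>2 + (cmod (g x))\<^sup>2)"
    using assms by (simp add: L2_def)
  show "(\<lambda>x. f x * g x) \<in> borel_measurable lborel" using assms[THEN L2_measurable] by simp
  have "norm (f x * g x) \<le> norm ((cmod (f x))\<^sup>2 + (cmod (g x))\<^sup>2)" for x
  proof -
    have "2 * (cmod (f x) * cmod (g x)) \<le> (cmod (f x))\<^sup>2 + (cmod (g x))\<^sup>2"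
      using sum_squares_bound[of "cmod (f x)" "cmod (g x)"] by simp
    moreover have "0 \<le> cmod (f x) * cmod (g x)" by simp
    ultimately have "cmod (f x) * cmod (g x) \<le> (cmod (f x))\<^sup>2 + (cmod (g x))\<^sup>2" by linarith
    then show ?thesis by (simp add: norm_mult)
  qed
  then show "AE x in lborel. norm (f x * g x) \<le> norm ((cmod (f x))\<^sup>2 + (cmod (g x))\<^sup>2)" by simp
qed

section \<open>The fundamental lemma of the calculus of variations\<close>

definition loc_integrable :: "(real \<Rightarrow> complex) \<Rightarrow> bool" where
  "loc_integrable f \<longleftrightarrow> f \<in> borel_measurable borel \<and> (\<forall>R. set_integrable lborel {-R..R} f)"

lemma loc_integrable_mult_test:
  assumes "loc_integrable f" "continuous_on UNIV \<phi>" "\<And>x. \<bar>x\<bar> > R \<Longrightarrow> \<phi> x = 0"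
  shows "integrable lborel (\<lambda>x. f x * \<phi> x)"
proof -
  have [measurable]: "f \<in> borel_measurable borel" using assms by (simp add: loc_integrable_def)
  have [measurable]: "\<phi> \<in> borel_measurable borel"
    by (rule borel_measurable_continuous_onI) fact
  have "compact (\<phi> ` {-R..R})"
    by (intro compact_continuous_image continuous_on_subset[OF assms(2)]) auto
  then obtain B where B: "\<And>x. x \<in> {-R..R} \<Longrightarrow> cmod (\<phi> x) \<le> B"
    using compact_imp_bounded bounded_iff by (metis imageI)
  show ?thesis
  proof (rule Bochner_Integration.integrable_bound)
    show "integrable lborel (\<lambda>x. B *\<^sub>R (indicator {-R..R} x *\<^sub>R f x))"
      using assms(1) by (intro integrable_scaleR_right) (simp add: loc_integrable_def set_integrable_def)
    have "norm (f x * \<phi> x) \<le> norm (B *\<^sub>R (indicator {-R..R} x *\<^sub>R f x))" for x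
    proof (cases "x \<in> {-R..R}")
      case True
      then have "cmod (\<phi> x) \<le> \<bar>B\<bar>" using B[of x] by linarith
      with True show ?thesis by (simp add: norm_mult mult.commute mult_right_mono)
    next
      case False
      then have "\<phi> x = 0" by (intro assms(3)) auto
      then show ?thesis by simp
    qed
    then show "AE x in lborel. norm (f x * \<phi> x) \<le> norm (B *\<^sub>R (indicator {-R..R} x *\<^sub>R f x))" by simp
  qed auto
qed

lemma L2_loc_integrable:
  assumes "f \<in> L2" "continuous_on UNIV g"
  shows "loc_integrable (\<lambda>x. f x * g x)"
  unfolding loc_integrable_def
proof (intro conjI allI)
  have [measurable]: "g \<in> borel_measurable borel"
    by (rule borel_measurable_continuous_onI) fact
  show "(\<lambda>x. f x * g x) \<in> borel_measurable borel" using assms(1) by measurable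
  fix R :: real
  have "compact (g ` {-R..R})"
    by (intro compact_continuous_image continuous_on_subset[OF assms(2)]) auto
  then obtain B where B: "\<And>x. x \<in> {-R..R} \<Longrightarrow> cmod (g x) \<le> B"
    using compact_imp_bounded bounded_iff by (metis imageI)
  have "(\<lambda>x. indicator {-R..R} x *\<^sub>R g x) \<in> L2"
    by (rule L2I_bounded[of _ "max B 0" R]) (use B in \<open>fastforce simp: indicator_def\<close>)+
  from L2_mult_integrable[OF assms(1) this]
  show "set_integrable lborel {-R..R} (\<lambda>x. f x * g x)"
    by (simp add: set_integrable_def)
qed

text \<open>Dynkin's argument: open intervals are stable under intersection and generate the Borel
  sets, and the sets over which \<open>f\<close> integrates to 0 are closed under complements and
  countable disjoint unions.\<close>

lemma AE_eq_0_if_interval_integrals_0: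
  fixes f :: "real \<Rightarrow> complex"
  assumes f: "integrable lborel f" and i: "\<And>p q. p < q \<Longrightarrow> (LINT x:{p<..<q}|lborel. f x) = 0"
  shows "AE x in lborel. f x = 0"
proof (rule sigma_finite_measure.density_zero[OF lborel.sigma_finite_measure_axioms f])
  \<comment> \<open>The complement case needs the integral over the whole line, which is not among
    the given intervals; it is reached by exhaustion and dominated convergence.\<close>
  have tot: "(LINT x:UNIV|lborel. f x) = 0"
  proof (rule LIMSEQ_unique)
    show "(\<lambda>n. LINT x|lborel. indicator {- real n<..<real n} x *\<^sub>R f x) \<longlonglongrightarrow> (LINT x:UNIV|lborel. f x)"
      unfolding set_lebesgue_integral_def
    proof (rule integral_dominated_convergence[where w = "\<lambda>x. norm (f x)"])
      show "AE x in lborel. (\<lambda>n. indicator {- real n<..<real n} x *\<^sub>R f x) \<longlonglongrightarrow> indicator UNIV x *\<^sub>R f x"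
      proof (intro AE_I2 tendsto_eventually)
        fix x :: real
        show "\<forall>\<^sub>F n in sequentially. indicator {- real n<..<real n} x *\<^sub>R f x = indicator UNIV x *\<^sub>R f x"
          using eventually_gt_at_top[of "nat \<lceil>\<bar>x\<bar>\<rceil>"] by eventually_elim (auto simp: indicator_def; linarith)
      qed
    qed (use f in \<open>auto simp: indicator_def\<close>)
    have "(LINT x|lborel. indicator {- real n<..<real n} x *\<^sub>R f x) = 0" for n
      using i[of "- real n" "real n"] by (cases "n = 0") (auto simp: set_lebesgue_integral_def)
    then show "(\<lambda>n. LINT x|lborel. indicator {- real n<..<real n} x *\<^sub>R f x) \<longlonglongrightarrow> 0" by simp
  qed
  have int: "set_integrable lborel A f" if "A \<in> sets borel" for A
    unfolding set_integrable_def using f that by (intro integrable_mult_indicator) auto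
  let ?G = "range (\<lambda>(a, b). {a<..<b::real})"
  have G: "sets borel = sigma_sets UNIV ?G"
  proof -
    have "(box :: real \<Rightarrow> _) = greaterThanLessThan" by (simp add: fun_eq_iff box_real)
    then show ?thesis by (subst borel_eq_box[where 'a = real]) simp
  qed
  fix A :: "real set" assume "A \<in> sets lborel"
  then have A: "A \<in> sigma_sets UNIV ?G" using G by simp
  have "Int_stable ?G"
  proof (rule Int_stableI)
    fix A B assume "A \<in> ?G" "B \<in> ?G"
    then obtain a b c d where "A = {a<..<b}" "B = {c<..<d}" by auto
    then have "A \<inter> B = (\<lambda>(a, b). {a<..<b}) (max a c, min b d)" by auto
    then show "A \<inter> B \<in> ?G" by (metis rangeI)
  qed
  moreover have "?G \<subseteq> Pow UNIV" by simp
  ultimately show "(LINT x:A|lborel. f x) = 0"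
    using A
  proof (induction rule: sigma_sets_induct_disjoint)
    case (basic A)
    then obtain a b where "A = {a<..<b}" by auto
    then show ?case using i[of a b] by (cases "a < b") (auto simp: set_lebesgue_integral_def)
  next
    case (compl A)
    then have A: "A \<in> sets borel" using G by simp
    have "(LINT x:(A \<union> (UNIV - A))|lborel. f x) = (LINT x:A|lborel. f x) + (LINT x:(UNIV - A)|lborel. f x)"
      using A by (intro set_integral_Un int) auto
    then show ?case using compl tot by simp
  next
    case (union A)
    then have A: "A i \<in> sets borel" for i using G by auto
    have "(LINT x:(\<Union>i. A i)|lborel. f x) = (\<Sum>i. LINT x:(A i)|lborel. f x)"
      using A union(1) by (intro lebesgue_integral_countable_add int) (auto simp: disjoint_family_on_def)
    then show ?case using union by simp
  qed (auto simp: set_lebesgue_integral_def)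
qed

text \<open>The products of steps \<open>smooth_step (n (x - p)) smooth_step (n (q - x))\<close> converge to the
  indicator of the open interval \<open>(p, q)\<close>.\<close>

lemma fundamental_lemma_calculus_of_variations:
  assumes f: "loc_integrable f"
    and int: "\<And>\<phi>. ctest \<phi> \<Longrightarrow> (\<And>x. x \<le> a \<Longrightarrow> \<phi> x = 0) \<Longrightarrow> (LINT x|lborel. f x * \<phi> x) = 0"
  shows "AE x in lborel. a < x \<longrightarrow> f x = 0"
proof -
  have [measurable]: "f \<in> borel_measurable borel" using f by (simp add: loc_integrable_def)
  have fi: "set_integrable lborel {p<..<q} f" for p q
    by (rule set_integrable_subset[of _ "{- max \<bar>p\<bar> \<bar>q\<bar>..max \<bar>p\<bar> \<bar>q\<bar>}"])
       (use f in \<open>auto simp: loc_integrable_def\<close>)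
  have van: "(LINT x:{p<..<q}|lborel. f x) = 0" if "a \<le> p" for p q
  proof (rule LIMSEQ_unique)
    define \<psi> where "\<psi> n x = smooth_step (real n * x + - real n * p) * smooth_step (- real n * x + real n * q)" for n x
    have \<psi>01: "0 \<le> \<psi> n x" "\<psi> n x \<le> 1" for n x
      unfolding \<psi>_def using smooth_step_nonneg smooth_step_le_1 by (auto intro: mult_le_one)
    have out: "\<psi> n x = 0" if "x \<le> p \<or> q \<le> x" for n x
      using that
    proof
      assume "x \<le> p"
      then have "real n * x + - real n * p \<le> 0" by (simp add: mult_left_mono)
      then show ?thesis unfolding \<psi>_def using smooth_step_eq_0 by simp
    next
      assume "q \<le> x"
      then have "- real n * x + real n * q \<le> 0" by (simp add: mult_left_mono)
      then show ?thesis unfolding \<psi>_def using smooth_step_eq_0 by simp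
    qed
    have cs: "csmooth (\<lambda>x. of_real (\<psi> n x))" for n
      unfolding \<psi>_def of_real_mult by (intro csmooth_mult csmooth_smooth_step)
    have m[measurable]: "\<psi> n \<in> borel_measurable borel" for n
    proof -
      have "(\<lambda>x. Re (of_real (\<psi> n x))) \<in> borel_measurable borel"
        using csmooth_measurable[OF cs] by measurable
      then show ?thesis by simp
    qed
    show "(\<lambda>n. LINT x|lborel. f x * of_real (\<psi> n x)) \<longlonglongrightarrow> (LINT x:{p<..<q}|lborel. f x)"
      unfolding set_lebesgue_integral_def
    proof (rule integral_dominated_convergence[where w = "\<lambda>x. norm (indicator {p<..<q} x *\<^sub>R f x)"])
      show "integrable lborel (\<lambda>x. norm (indicator {p<..<q} x *\<^sub>R f x))"
        using fi[of p q] by (intro integrable_norm) (simp add: set_integrable_def)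
      show "AE x in lborel. (\<lambda>n. f x * of_real (\<psi> n x)) \<longlonglongrightarrow> indicator {p<..<q} x *\<^sub>R f x"
      proof (rule AE_I2)
        fix x
        show "(\<lambda>n. f x * of_real (\<psi> n x)) \<longlonglongrightarrow> indicator {p<..<q} x *\<^sub>R f x"
        proof (cases "x \<in> {p<..<q}")
          case True
          have "\<forall>\<^sub>F n in sequentially. f x * of_real (\<psi> n x) = f x"
            using eventually_ge_at_top[of "nat \<lceil>max (1 / (x - p)) (1 / (q - x))\<rceil>"]
          proof eventually_elim
            case (elim n)
            then have "1 / (x - p) \<le> real n" "1 / (q - x) \<le> real n" by linarith+
            then have "1 \<le> real n * x + - real n * p" "1 \<le> - real n * x + real n * q"
              using True by (auto simp: field_simps)
            then show ?case by (simp add: \<psi>_def smooth_step_eq_1)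
          qed
          then show ?thesis using True by (auto intro: tendsto_eventually)
        next
          case False
          then show ?thesis using out by auto
        qed
      qed
      show "AE x in lborel. norm (f x * of_real (\<psi> n x)) \<le> norm (indicator {p<..<q} x *\<^sub>R f x)" for n
        using \<psi>01[of n] out[of _ n] by (auto simp: norm_mult indicator_def intro!: mult_left_le)
    qed auto
    have "(LINT x|lborel. f x * of_real (\<psi> n x)) = 0" for n
    proof (rule int)
      show "ctest (\<lambda>x. complex_of_real (\<psi> n x))"
        unfolding ctest_def using cs out
        by (intro conjI exI[of _ "max \<bar>p\<bar> \<bar>q\<bar>"] allI impI) (auto intro!: out)
    qed (use out \<open>a \<le> p\<close> in auto)
    then show "(\<lambda>n. LINT x|lborel. f x * of_real (\<psi> n x)) \<longlonglongrightarrow> 0" by simp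
  qed
  \<comment> \<open>The criterion above requires global integrability, whereas \<open>f\<close> is
    only locally integrable; hence the restriction to bounded intervals.\<close>
  have "AE x in lborel. indicator {a<..<a + real n} x *\<^sub>R f x = 0" for n
  proof (rule AE_eq_0_if_interval_integrals_0)
    show "integrable lborel (\<lambda>x. indicator {a<..<a + real n} x *\<^sub>R f x)"
      using fi by (simp add: set_integrable_def)
    fix p q :: real
    have "(LINT x:{p<..<q}|lborel. indicator {a<..<a + real n} x *\<^sub>R f x)
        = (LINT x:{max a p<..<min q (a + real n)}|lborel. f x)"
      unfolding set_lebesgue_integral_def
      by (rule Bochner_Integration.integral_cong) (auto simp: indicator_def)
    then show "(LINT x:{p<..<q}|lborel. indicator {a<..<a + real n} x *\<^sub>R f x) = 0"
      using van by simp
  qed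
  then have "AE x in lborel. \<forall>n. indicator {a<..<a + real n} x *\<^sub>R f x = 0"
    unfolding AE_all_countable by blast
  then show ?thesis
  proof eventually_elim
    case (elim x)
    show ?case
    proof
      assume "a < x"
      moreover obtain n where "x - a < real n" using reals_Archimedean2 by blast
      ultimately show "f x = 0" using elim[rule_format, of n] by (auto simp: indicator_def)
    qed
  qed
qed

section \<open>The profile\<close>

text \<open>Gronwall's argument: \<open>exp (- 2 * L * x) * (h x)\<^sup>2\<close> is nonincreasing
  and \<open>exp (2 * L * x) * (h x)\<^sup>2\<close> is nondecreasing, so the zero at
  \<open>a\<close> spreads to the right by the first and to the left by the second.\<close>

lemma fun_eq_0_if_deriv_le:
  fixes h :: "real \<Rightarrow> real"
  assumes d: "\<And>x. (h has_real_derivative h' x) (at x)" and le: "\<And>x. \<bar>h' x\<bar> \<le> L * \<bar>h x\<bar>"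
    and 0: "h a = 0"
  shows "h x = 0"
proof -
  have *: "2 * (h y * h' y) \<le> 2 * L * (h y)\<^sup>2" "- (2 * L * (h y)\<^sup>2) \<le> 2 * (h y * h' y)" for y
  proof -
    have "\<bar>h y * h' y\<bar> \<le> \<bar>h y\<bar> * (L * \<bar>h y\<bar>)"
      using mult_left_mono[OF le[of y], of "\<bar>h y\<bar>"] by (simp add: abs_mult)
    also have "\<dots> = L * (h y)\<^sup>2"
      by (metis (no_types, lifting) mult.left_commute power2_abs power2_eq_square)
    finally show "2 * (h y * h' y) \<le> 2 * L * (h y)\<^sup>2" "- (2 * L * (h y)\<^sup>2) \<le> 2 * (h y * h' y)"
      by (auto simp: abs_le_iff)
  qed
  have "(h x)\<^sup>2 = 0"
  proof (cases "a \<le> x")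
    case True
    have "exp (- 2 * L * x) * (h x)\<^sup>2 \<le> exp (- 2 * L * a) * (h a)\<^sup>2"
    proof (rule DERIV_nonpos_imp_nonincreasing[OF True])
      fix y
      have "((\<lambda>x. exp (- 2 * L * x) * (h x)\<^sup>2) has_real_derivative
          exp (- 2 * L * y) * (2 * (h y * h' y) - 2 * L * (h y)\<^sup>2)) (at y)"
        by (auto intro!: derivative_eq_intros d simp: algebra_simps)
      then show "\<exists>d. ((\<lambda>x. exp (- 2 * L * x) * (h x)\<^sup>2) has_real_derivative d) (at y) \<and> d \<le> 0"
        using *(1)[of y] by (auto simp: mult_le_0_iff intro!: exI)
    qed
    with 0 show ?thesis by (simp add: mult_le_0_iff)
  next
    case False
    have "exp (2 * L * x) * (h x)\<^sup>2 \<le> exp (2 * L * a) * (h a)\<^sup>2"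
    proof (rule DERIV_nonneg_imp_nondecreasing[where f = "\<lambda>x. exp (2 * L * x) * (h x)\<^sup>2"])
      fix y
      have "((\<lambda>x. exp (2 * L * x) * (h x)\<^sup>2) has_real_derivative
          exp (2 * L * y) * (2 * (h y * h' y) + 2 * L * (h y)\<^sup>2)) (at y)"
        by (auto intro!: derivative_eq_intros d simp: algebra_simps)
      moreover have "0 \<le> exp (2 * L * y) * (2 * (h y * h' y) + 2 * L * (h y)\<^sup>2)"
        using *(2)[of y] by (intro mult_nonneg_nonneg) auto
      ultimately show "\<exists>d. ((\<lambda>x. exp (2 * L * x) * (h x)\<^sup>2) has_real_derivative d) (at y) \<and> d \<ge> 0"
        by blast
    qed (use False in auto)
    with 0 show ?thesis by (simp add: mult_le_0_iff)
  qed
  then show ?thesis by simp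
qed

section \<open>The solitary wave, its first integral and its distance to the end state\<close>

locale solitary_wave =
  fixes c k :: real and u0 :: "real \<Rightarrow> real"
  assumes c_pos: "c > 0" and k_pos: "0 < k" and k_less: "k < c / 4"
    and profile: "solitary_wave_profile c k u0"
begin

abbreviation "W \<equiv> c - k"

definition w :: "real \<Rightarrow> real" where "w x = c - u0 x"

lemma W_pos: "W > 0" and W3k: "W > 3 * k" and k_less_W: "k < W"
  using c_pos k_pos k_less by auto

lemma w_pos: "w x > 0" and w_less: "w x < c"
  using profile by (auto simp: solitary_wave_profile_def w_def)

lemma csmooth_u0: "csmooth (\<lambda>x. of_real (u0 x))"
  using profile by (simp add: solitary_wave_profile_def csmooth_of_real_iff)

lemma csmooth_w [csmooth_intros]: "csmooth (\<lambda>x. of_real (w x))"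
  unfolding w_def of_real_diff by (intro csmooth_intros csmooth_u0)

lemma u0_deriv:
  "(u0 has_real_derivative deriv u0 x) (at x)"
  "(deriv u0 has_real_derivative deriv (deriv u0) x) (at x)"
  using csmooth_of_real_deriv[OF csmooth_u0] csmooth_of_real_deriv(1) by blast+

lemma u0_tendsto: "(u0 \<longlongrightarrow> k) at_top" "(u0 \<longlongrightarrow> k) at_bot"
  using profile tendsto_mono[OF at_top_le_at_infinity] tendsto_mono[OF at_bot_le_at_infinity]
  by (auto simp: solitary_wave_profile_def)

lemma w_tendsto: "(w \<longlongrightarrow> W) at_top" "(w \<longlongrightarrow> W) at_bot"
  unfolding w_def by (intro tendsto_intros u0_tendsto)+

lemma profile_ode: "deriv (deriv u0) x = u0 x - k * W ^ 3 / w x ^ 3"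
proof -
  have "w x ^ 3 * (u0 x - deriv (deriv u0) x) = k * W ^ 3"
    using profile by (simp add: solitary_wave_profile_def w_def numeral_2_eq_2)
  then show ?thesis using w_pos[of x] by (simp add: field_simps)
qed

lemma w_deriv: "(w has_real_derivative - deriv u0 x) (at x)"
  unfolding w_def by (auto intro!: derivative_eq_intros u0_deriv)

text \<open>Multiplying the profile equation by \<open>2 * deriv u0 x\<close> and integrating gives
  a conserved energy \<open>F\<close>, whose value is determined by the limit at infinity. With that
  value the resulting polynomial in \<open>w\<close> has a double zero at the end state
  \<open>W\<close>, which is the mark of a homoclinic orbit.\<close>

lemma u0_first_integral:
  "(w x)\<^sup>2 * (deriv u0 x)\<^sup>2 = (w x - W)\<^sup>2 * ((w x)\<^sup>2 - 2 * k * w x - k * W)"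
proof -
  define F where "F = (\<lambda>x. (u0 x)\<^sup>2 - (deriv u0 x)\<^sup>2 - k * W ^ 3 / (w x)\<^sup>2)"
  define g where "g = (\<lambda>x. k * W ^ 3 / (w x)\<^sup>2)"
  have "(F has_real_derivative 0) (at x)" for x
  proof -
    have g: "(g has_real_derivative 2 * k * W ^ 3 * deriv u0 x / w x ^ 3) (at x)"
    proof -
      have "((\<lambda>x. a / (w x)\<^sup>2) has_real_derivative 2 * a * deriv u0 x / w x ^ 3) (at x)" for a
        using w_pos[of x]
        by (auto intro!: derivative_eq_intros w_deriv simp: divide_simps)
           (simp add: eval_nat_numeral)
      from this[of "k * W ^ 3"] show ?thesis by (simp add: g_def mult.assoc)
    qed
    have "F = (\<lambda>x. (u0 x)\<^sup>2 - (deriv u0 x)\<^sup>2 - g x)" by (simp add: F_def g_def)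
    moreover have "((\<lambda>x. (u0 x)\<^sup>2) has_real_derivative 2 * u0 x * deriv u0 x) (at x)"
      "((\<lambda>x. (deriv u0 x)\<^sup>2) has_real_derivative 2 * deriv u0 x * deriv (deriv u0) x) (at x)"
      by (auto intro!: derivative_eq_intros u0_deriv)
    ultimately have "(F has_real_derivative
        2 * u0 x * deriv u0 x - 2 * deriv u0 x * deriv (deriv u0) x - 2 * k * W ^ 3 * deriv u0 x / w x ^ 3) (at x)"
      using g by (simp only:) (intro DERIV_diff)
    then show ?thesis by (simp add: profile_ode right_diff_distrib)
  qed
  then have F0: "F y = F 0" for y
    using DERIV_isconst_all by blast
  have sq: "(deriv u0 y)\<^sup>2 = (u0 y)\<^sup>2 - k * W ^ 3 / (w y)\<^sup>2 - F 0" for y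
  proof -
    have "F y = (u0 y)\<^sup>2 - (deriv u0 y)\<^sup>2 - k * W ^ 3 / (w y)\<^sup>2" by (simp add: F_def)
    with F0[of y] show ?thesis by linarith
  qed
  have "((\<lambda>y. (deriv u0 y)\<^sup>2) \<longlongrightarrow> k\<^sup>2 - k * W ^ 3 / W\<^sup>2 - F 0) at_top"
    unfolding sq using W_pos by (intro tendsto_intros u0_tendsto w_tendsto) auto
  then have lim: "((\<lambda>y. (deriv u0 y)\<^sup>2) \<longlongrightarrow> k\<^sup>2 - k * W - F 0) at_top"
    using W_pos by (simp add: power2_eq_square power3_eq_cube)
  \<comment> \<open>The assumptions give a limit for \<open>u0\<close> but none for its derivative.
    The mean value theorem on unit intervals supplies points tending to infinity at which the
    derivative tends to 0; as the limit of its square exists by the energy identity, that limit is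
    0.\<close>
  have "\<exists>y>real n. u0 (real n + 1) - u0 (real n) = deriv u0 y" for n
    using MVT2[of "real n" "real n + 1" u0 "deriv u0"] u0_deriv by auto
  then obtain y where y: "\<And>n. y n > real n" "\<And>n. u0 (real n + 1) - u0 (real n) = deriv u0 (y n)"
    by metis
  have y_top: "filterlim y at_top sequentially"
    by (rule filterlim_at_top_mono[OF filterlim_real_sequentially]) (simp add: y(1) less_imp_le)
  have n_top: "filterlim (\<lambda>n. real n + 1) at_top sequentially"
    by (rule filterlim_at_top_mono[OF filterlim_real_sequentially]) simp
  have "(\<lambda>n. (u0 (real n + 1) - u0 (real n))\<^sup>2) \<longlonglongrightarrow> (k - k)\<^sup>2"
    by (intro tendsto_intros filterlim_compose[OF u0_tendsto(1)] n_top filterlim_real_sequentially)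
  then have "(\<lambda>n. (deriv u0 (y n))\<^sup>2) \<longlonglongrightarrow> 0" by (simp add: y(2))
  moreover have "(\<lambda>n. (deriv u0 (y n))\<^sup>2) \<longlonglongrightarrow> k\<^sup>2 - k * W - F 0"
    by (rule filterlim_compose[OF lim y_top])
  ultimately have "k\<^sup>2 - k * W - F 0 = 0" using LIMSEQ_unique by blast
  then have "F 0 = k\<^sup>2 - k * W" by simp
  then have "(deriv u0 x)\<^sup>2 = (c - w x)\<^sup>2 - k * W ^ 3 / (w x)\<^sup>2 - (k\<^sup>2 - k * W)"
    using sq[of x] by (simp add: w_def)
  then have "(w x)\<^sup>2 * (deriv u0 x)\<^sup>2 = (w x)\<^sup>2 * (c - w x)\<^sup>2 - k * W ^ 3 - (w x)\<^sup>2 * (k\<^sup>2 - k * W)"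
    using w_pos[of x] by (simp add: right_diff_distrib)
  moreover have "z\<^sup>2 * (V + k - z)\<^sup>2 - k * V ^ 3 - z\<^sup>2 * (k\<^sup>2 - k * V)
      = (z - V)\<^sup>2 * (z\<^sup>2 - 2 * k * z - k * V)" for z V :: real
    by algebra
  from this[of "w x" W] have "(w x)\<^sup>2 * (c - w x)\<^sup>2 - k * W ^ 3 - (w x)\<^sup>2 * (k\<^sup>2 - k * W)
      = (w x - W)\<^sup>2 * ((w x)\<^sup>2 - 2 * k * w x - k * W)" by simp
  ultimately show ?thesis by simp
qed

lemma w_bounded_below: obtains m where "m > 0" "\<And>x. m \<le> w x"
proof -
  have ev: "eventually (\<lambda>x. W / 2 < w x) at_top" "eventually (\<lambda>x. W / 2 < w x) at_bot"
    using W_pos by (intro order_tendstoD(1)[OF w_tendsto(1)] order_tendstoD(1)[OF w_tendsto(2)]; simp)+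
  obtain A B where AB: "\<And>x. x \<ge> B \<Longrightarrow> W / 2 < w x" "\<And>x. x \<le> A \<Longrightarrow> W / 2 < w x"
    using ev by (auto simp: eventually_at_top_linorder eventually_at_bot_linorder)
  have "continuous_on {min A B..max A B} w"
    using w_deriv by (meson DERIV_isCont continuous_at_imp_continuous_on)
  moreover have "{min A B..max A B} \<noteq> {}" by simp
  ultimately obtain z where z: "\<And>x. x \<in> {min A B..max A B} \<Longrightarrow> w z \<le> w x"
    using continuous_attains_inf[of "{min A B..max A B}" w] compact_Icc by blast
  show ?thesis
  proof (rule that[of "min (W / 2) (w z)"])
    show "min (W / 2) (w z) \<le> w x" for x
    proof (cases "x \<in> {min A B..max A B}")
      case True
      then show ?thesis using z by (simp add: min_le_iff_disj)
    next
      case False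
      then have "x \<ge> B \<or> x \<le> A" by auto
      then show ?thesis using AB[of x] by (auto simp: min_le_iff_disj)
    qed
  qed (use W_pos w_pos in auto)
qed

text \<open>The first integral has a double zero at \<open>W\<close>, so the derivative of
  \<open>w\<close> is bounded by a multiple of \<open>w - W\<close>. By Gronwall a single contact
  with the end state would make the profile constant. This legitimates the division by
  \<open>w - W\<close> in the function \<open>r\<close> below.\<close>

lemma w_neq_W: "w x \<noteq> W"
proof
  assume x: "w x = W"
  obtain m where m: "m > 0" "\<And>x. m \<le> w x" by (rule w_bounded_below) auto
  define L where "L = c / m"
  have "w y - W = 0" for y
  proof (rule fun_eq_0_if_deriv_le[where h = "\<lambda>y. w y - W" and a = x and L = L and h' = "\<lambda>x. - deriv u0 x"])
    show "((\<lambda>x. w x - W) has_real_derivative - deriv u0 x) (at x)" for x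
      by (auto intro!: derivative_eq_intros w_deriv)
    show "\<bar>- deriv u0 x\<bar> \<le> L * \<bar>w x - W\<bar>" for x
    proof -
      have "(w x)\<^sup>2 - 2 * k * w x - k * W \<le> c\<^sup>2"
        using power_mono[of "w x" c 2] w_pos[of x] w_less[of x] k_pos W_pos
        by (smt (verit) mult_pos_pos)
      then have "(w x)\<^sup>2 * (deriv u0 x)\<^sup>2 \<le> (w x - W)\<^sup>2 * c\<^sup>2"
        unfolding u0_first_integral by (rule mult_left_mono) simp
      then have "(w x * \<bar>deriv u0 x\<bar>)\<^sup>2 \<le> (c * \<bar>w x - W\<bar>)\<^sup>2"
        by (simp add: power_mult_distrib mult.commute)
      then have "w x * \<bar>deriv u0 x\<bar> \<le> c * \<bar>w x - W\<bar>"
        using c_pos by (intro power2_le_imp_le[of "w x * \<bar>deriv u0 x\<bar>"]) auto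
      moreover have "m * \<bar>deriv u0 x\<bar> \<le> w x * \<bar>deriv u0 x\<bar>"
        by (intro mult_right_mono m) auto
      ultimately show ?thesis using m(1) by (simp add: L_def field_simps)
    qed
  qed (use x in simp)
  then have "u0 y = k" for y by (simp add: w_def)
  then show False using profile by (auto simp: solitary_wave_profile_def constant_on_def)
qed

text \<open>In terms of \<open>\<theta>\<close> with \<open>d\<theta> = dx / w\<close> the profile equation becomes the polynomial system
  \<open>dw/d\<theta> = (w - W) r\<close>, \<open>dr/d\<theta> = (w - k) (w - W)\<close> on the curve \<open>r\<^sup>2 = w\<^sup>2 - 2 k w - k W\<close>.\<close>

definition r :: "real \<Rightarrow> real" where "r x = - (w x * deriv u0 x / (w x - W))"

text \<open>At \<open>w = W\<close> the curve relation reads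
  \<open>r\<^sup>2 = W\<^sup>2 - 3 * k * W\<close>. The hypothesis \<open>k < c / 4\<close> is
  equivalent to \<open>W > 3 * k\<close> and makes this radicand positive.\<close>

definition r0 :: real where "r0 = sqrt (W\<^sup>2 - 3 * k * W)"

lemma r0_pos: "r0 > 0" and r0_sq: "r0\<^sup>2 = W\<^sup>2 - 3 * k * W" and r0_less: "r0 < W"
proof -
  have "W\<^sup>2 - 3 * k * W = W * (W - 3 * k)" by (simp add: algebra_simps power2_eq_square)
  then have p: "W\<^sup>2 - 3 * k * W > 0" using W_pos W3k by simp
  then show "r0 > 0" "r0\<^sup>2 = W\<^sup>2 - 3 * k * W" by (simp_all add: r0_def)
  then show "r0 < W" using k_pos W_pos
    by (intro power_less_imp_less_base[of r0 2 W]) auto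
qed

lemma r_sq: "(r x)\<^sup>2 = (w x)\<^sup>2 - 2 * k * w x - k * W"
  using u0_first_integral[of x] w_neq_W[of x] by (simp add: r_def power_divide power_mult_distrib)

lemma u0_deriv_eq: "deriv u0 x = - ((w x - W) * r x / w x)"
  using w_neq_W[of x] w_pos[of x] by (simp add: r_def)

lemma w_deriv_eq: "(w has_real_derivative (w x - W) * r x / w x) (at x)"
  using w_deriv[of x] by (simp add: u0_deriv_eq)

lemma r_deriv: "(r has_real_derivative (w x - k) * (w x - W) / w x) (at x)"
proof -
  let ?h = "w x - W" and ?d = "deriv u0 x"
  have h: "?h \<noteq> 0" "w x \<noteq> 0" using w_neq_W[of x] w_pos[of x] by auto
  have "(r has_real_derivative (?d\<^sup>2 * ?h - w x * deriv (deriv u0) x * ?h - w x * ?d\<^sup>2) / ?h\<^sup>2) (at x)"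
    unfolding r_def using h
    by (auto intro!: derivative_eq_intros u0_deriv w_deriv)
       (simp add: power2_eq_square divide_simps, simp add: algebra_simps)
  moreover have "?d\<^sup>2 * ?h - w x * deriv (deriv u0) x * ?h - w x * ?d\<^sup>2 = (w x - k) * ?h / w x * ?h\<^sup>2"
  proof -
    have A: "w x ^ 3 * deriv (deriv u0) x = w x ^ 3 * (c - w x) - k * W ^ 3"
    proof -
      have "u0 x = c - w x" by (simp add: w_def)
      then show ?thesis using h(2) by (simp add: profile_ode right_diff_distrib)
    qed
    \<comment> \<open>The factor \<open>(w x)\<^sup>2\<close> turns the first and second derivatives
      of \<open>u0\<close> into exactly the expressions for which the first integral and the profile
      equation can be substituted.\<close>
    have "(w x)\<^sup>2 * (?d\<^sup>2 * ?h - w x * deriv (deriv u0) x * ?h - w x * ?d\<^sup>2) =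
        (w x)\<^sup>2 * ?d\<^sup>2 * ?h - w x ^ 3 * deriv (deriv u0) x * ?h - w x * ((w x)\<^sup>2 * ?d\<^sup>2)"
      by (simp add: algebra_simps power2_eq_square power3_eq_cube)
    also have "\<dots> = w x * (w x - k) * ?h ^ 3"
      unfolding A u0_first_integral by (simp add: algebra_simps power2_eq_square power3_eq_cube)
    also have "\<dots> = (w x)\<^sup>2 * ((w x - k) * ?h / w x * ?h\<^sup>2)"
      using h(2) by (simp add: power2_eq_square power3_eq_cube)
    finally show ?thesis
      by (rule mult_left_cancel[THEN iffD1, rotated]) (use h(2) in simp)
  qed
  ultimately show ?thesis using h by simp
qed

lemma r_abs_le: "\<bar>r x\<bar> \<le> c"
proof -
  have "(r x)\<^sup>2 \<le> c\<^sup>2"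
    using power_mono[of "w x" c 2] w_pos[of x] w_less[of x] k_pos W_pos
    unfolding r_sq by (smt (verit) mult_pos_pos)
  then show ?thesis using c_pos by (simp add: abs_le_square_iff[symmetric])
qed

text \<open>Otherwise \<open>\<bar>w - W\<bar>\<close> would be increasing near \<open>\<infinity>\<close>.\<close>

lemma r_tendsto: "(r \<longlongrightarrow> - r0) at_top"
proof -
  have sq: "((\<lambda>x. (r x)\<^sup>2) \<longlongrightarrow> r0\<^sup>2) at_top"
  proof -
    have "((\<lambda>x. (r x)\<^sup>2) \<longlongrightarrow> W\<^sup>2 - 2 * k * W - k * W) at_top"
      unfolding r_sq by (intro tendsto_intros w_tendsto)
    then show ?thesis by (simp add: r0_sq mult.assoc)
  qed
  then have "eventually (\<lambda>x. (r x)\<^sup>2 > 0) at_top"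
    using r0_pos by (intro order_tendstoD(1)[OF sq]) simp
  then obtain X where X: "\<And>x. x \<ge> X \<Longrightarrow> r x \<noteq> 0"
    by (auto simp: eventually_at_top_linorder)
  have cont: "isCont r x" for x using r_deriv DERIV_isCont by blast
  have neg: "r x < 0" if "x \<ge> X" for x
  proof (rule ccontr)
    assume "\<not> r x < 0"
    then have x: "r x > 0" using X[OF that] by simp
    have pos: "r y > 0" if "y \<ge> x" for y
    proof (rule ccontr)
      assume "\<not> r y > 0"
      then have "\<exists>z\<ge>x. z \<le> y \<and> r z = 0"
        using x that cont by (intro IVT2) auto
      then show False using X \<open>x \<ge> X\<close> by force
    qed
    have mono: "(w x - W)\<^sup>2 \<le> (w y - W)\<^sup>2" if "y \<ge> x" for y
    proof (rule DERIV_nonneg_imp_nondecreasing[OF that])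
      fix z assume "x \<le> z"
      then have "2 * (w z - W)\<^sup>2 * r z / w z \<ge> 0"
        using pos[of z] w_pos[of z] by simp
      moreover have "((\<lambda>z. (w z - W)\<^sup>2) has_real_derivative 2 * (w z - W)\<^sup>2 * r z / w z) (at z)"
        by (auto intro!: derivative_eq_intros w_deriv_eq simp: power2_eq_square)
      ultimately show "\<exists>d. ((\<lambda>z. (w z - W)\<^sup>2) has_real_derivative d) (at z) \<and> d \<ge> 0" by blast
    qed
    have "((\<lambda>y. (w y - W)\<^sup>2) \<longlongrightarrow> (W - W)\<^sup>2) at_top"
      by (intro tendsto_intros w_tendsto)
    moreover have "eventually (\<lambda>y. (w x - W)\<^sup>2 \<le> (w y - W)\<^sup>2) at_top"
      using eventually_ge_at_top[of x] by eventually_elim (rule mono)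
    ultimately have "(w x - W)\<^sup>2 \<le> (W - W)\<^sup>2"
      by (intro tendsto_lowerbound[of _ _ at_top]) auto
    then show False using w_neq_W[of x] by simp
  qed
  have "((\<lambda>x. - sqrt ((r x)\<^sup>2)) \<longlongrightarrow> - sqrt (r0\<^sup>2)) at_top"
    by (intro tendsto_intros sq)
  then have "((\<lambda>x. - sqrt ((r x)\<^sup>2)) \<longlongrightarrow> - r0) at_top" using r0_pos by simp
  then show ?thesis
  proof (rule Lim_transform_eventually)
    show "\<forall>\<^sub>F x in at_top. - sqrt ((r x)\<^sup>2) = r x"
      using eventually_ge_at_top[of X] by eventually_elim (use neg in force)
  qed
qed

lemma csmooth_r [csmooth_intros]: "csmooth (\<lambda>x. of_real (r x))"
proof -
  have "csmooth (\<lambda>x. - (of_real (w x) * of_real (deriv u0 x) / (of_real (w x) - of_real W)))"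
    using w_neq_W
    by (intro csmooth_intros csmooth_of_real_deriv(3)[OF csmooth_u0])
       (metis eq_iff_diff_eq_0 of_real_eq_iff)
  then show ?thesis by (simp add: r_def)
qed

end

section \<open>Explicit solutions of the dual equation\<close>

text \<open>Polynomials in \<open>w\<close> and \<open>r\<close>, reduced by means of the relation for \<open>r\<^sup>2\<close>, are represented by their
  coefficients of \<open>1, w, w\<^sup>2, w\<^sup>3, r, w r, w\<^sup>2 r\<close>. The derivative below is the \<open>\<theta>\<close>-derivative of
  \<open>exp (s \<theta>)\<close> times such a polynomial, divided by \<open>exp (s \<theta>)\<close>.\<close>

definition wr_poly :: "complex \<times> complex \<times> complex \<times> complex \<times> complex \<times> complex \<times> complex \<Rightarrow> complex \<Rightarrow> complex \<Rightarrow> complex" where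
  "wr_poly = (\<lambda>(a0, a1, a2, a3, b0, b1, b2) z \<rho>.
     a0 + a1 * z + a2 * z * z + a3 * z * z * z + (b0 + b1 * z + b2 * z * z) * \<rho>)"

definition wr_poly_deriv :: "complex \<Rightarrow> complex \<Rightarrow> complex \<Rightarrow>
    complex \<times> complex \<times> complex \<times> complex \<times> complex \<times> complex \<times> complex \<Rightarrow> complex \<Rightarrow> complex \<Rightarrow> complex" where
  "wr_poly_deriv K V s = (\<lambda>(a0, a1, a2, a3, b0, b1, b2) z \<rho>.
     s * wr_poly (a0, a1, a2, a3, b0, b1, b2) z \<rho> + (a1 + 2 * a2 * z + 3 * a3 * z * z) * (z - V) * \<rho>
      + (b1 + 2 * b2 * z) * (z - V) * (z * z - 2 * K * z - K * V)
      + (b0 + b1 * z + b2 * z * z) * (z - K) * (z - V))"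

text \<open>The coefficients of \<open>\<eta>\<close>, \<open>\<eta>'\<close> and \<open>w \<eta>''\<close>; those of \<open>\<eta>\<close> result from solving \<open>dual_op l \<eta> = 0\<close> with
  undetermined coefficients. The condition \<open>char_poly K V l s = 0\<close> comes from the limit at infinity.\<close>

definition sol_coeffs0 where
  "sol_coeffs0 K V l s =
    (- 3 * K * V^3 * (l + 2 * s), 3 * V * s^2 * (l + s), s * (2 * V^2 + s^2), 0,
     3 * V^2 * s * (l + s), 3 * V * s^2, 0 :: complex)"

definition sol_coeffs1 where
  "sol_coeffs1 K V l s =
    (3 * s^4 * V + 3 * s^3 * l * V + 3 * s^2 * K * V^2 - 3 * s^2 * V^3 - 3 * s * l * K * V^2 - 3 * s * l * V^3,
     s^4 - 9 * s^2 * K * V - s^2 * V^2 + 3 * s * l * V^2, 6 * s^2 * V, 0,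
     4 * s^3 * V + 3 * s^2 * l * V - 4 * s * V^3, 2 * s^3 + 4 * s * V^2, 0 :: complex)"

definition sol_coeffs2 where
  "sol_coeffs2 K V l s =
    (3 * s^5 * V + 3 * s^4 * l * V + 9 * s^3 * K * V^2 - 3 * s^3 * V^3 - 3 * s^2 * l * V^3,
     s^5 - 9 * s^3 * K * V - 5 * s^3 * V^2 - 3 * s^2 * l * K * V + 12 * s * K * V^3 + 4 * s * V^4,
     -6 * s^3 * K + 6 * s^3 * V + 3 * s^2 * l * V - 12 * s * K * V^2 - 12 * s * V^3,
     4 * s^3 + 8 * s * V^2,
     3 * s^4 * V + 3 * s^3 * l * V + 9 * s^2 * K * V^2 - 3 * s^2 * V^3 - 3 * s * l * V^3,
     3 * s^4 - 9 * s^2 * K * V - 9 * s^2 * V^2 + 3 * s * l * V^2, 12 * s^2 * V :: complex)"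

definition char_poly :: "complex \<Rightarrow> complex \<Rightarrow> complex \<Rightarrow> complex \<Rightarrow> complex" where
  "char_poly K V l s = s^3 + l * s^2 - (V^2 - 3 * K * V) * s - l * V^2"

lemma sol_coeffs1_eq:
  "z * wr_poly (sol_coeffs1 K V l s) z \<rho> = wr_poly_deriv K V s (sol_coeffs0 K V l s) z \<rho>"
  unfolding wr_poly_def wr_poly_deriv_def sol_coeffs0_def sol_coeffs1_def prod.case
  by (simp add: algebra_simps eval_nat_numeral)

lemma sol_coeffs2_eq:
  "wr_poly (sol_coeffs2 K V l s) z \<rho> = wr_poly_deriv K V s (sol_coeffs1 K V l s) z \<rho>"
  unfolding wr_poly_def wr_poly_deriv_def sol_coeffs2_def sol_coeffs1_def prod.case
  by (simp add: algebra_simps eval_nat_numeral)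

text \<open>The left side is \<open>dual_op l\<close> applied to \<eta>, up to the factor
  \<open>exp (s \<theta>) / w\<^sup>2\<close> and with \<open>c = V + K\<close>. It belongs to the
  ideal generated by \<open>char_poly K V l s\<close> and the curve relation; with the cofactors
  written out, membership is a polynomial identity.\<close>

lemma sol_coeffs_identity:
  assumes "\<rho> * \<rho> = z * z - 2 * K * z - K * V" and "char_poly K V l s = 0"
  shows "l * (z\<^sup>2 * wr_poly (sol_coeffs0 K V l s) z \<rho> - z * wr_poly (sol_coeffs2 K V l s) z \<rho>)
    + (4 * z - 3 * (V + K)) * z\<^sup>2 * wr_poly (sol_coeffs1 K V l s) z \<rho>
    - (z * wr_poly_deriv K V s (sol_coeffs2 K V l s) z \<rho> - (z - V) * \<rho> * wr_poly (sol_coeffs2 K V l s) z \<rho>) = 0"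
proof -
  have "l * (z\<^sup>2 * wr_poly (sol_coeffs0 K V l s) z \<rho> - z * wr_poly (sol_coeffs2 K V l s) z \<rho>)
    + (4 * z - 3 * (V + K)) * z\<^sup>2 * wr_poly (sol_coeffs1 K V l s) z \<rho>
    - (z * wr_poly_deriv K V s (sol_coeffs2 K V l s) z \<rho> - (z - V) * \<rho> * wr_poly (sol_coeffs2 K V l s) z \<rho>)
    = char_poly K V l s * (3 * s * K * V^3 + (-3 * s^3 * V - 3 * s^2 * l * V) * z
        + (- 1 * s^3 - 3 * s * K * V - 5 * s * V^2 + 3 * l * K * V) * z^2 + (6 * s * K + 6 * s * V) * z^3 - 3 * s * z^4
        + (-3 * s^2 * V^2 - 3 * s * l * V * z - 3 * s^2 * z^2) * \<rho>)
      + (z - V) * (3 * s^4 * V + 3 * s^3 * l * V + 9 * s^2 * K * V^2 - 3 * s^2 * V^3 - 3 * s * l * V^3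
        + (3 * s^4 - 9 * s^2 * K * V - 9 * s^2 * V^2 + 3 * s * l * V^2) * z + 12 * s^2 * V * z^2)
        * (\<rho> * \<rho> - (z * z - 2 * K * z - K * V))"
    unfolding wr_poly_def wr_poly_deriv_def sol_coeffs2_def sol_coeffs1_def sol_coeffs0_def prod.case char_poly_def
    by (simp add: algebra_simps eval_nat_numeral)
  with assms show ?thesis by simp
qed

lemma antiderivative_exists:
  fixes f :: "real \<Rightarrow> 'a::euclidean_space"
  assumes "continuous_on UNIV f"
  obtains F where "\<And>x. (F has_vector_derivative f x) (at x)"
  using einterval_antiderivative[of "-\<infinity>" \<infinity> f] assms
  by (auto simp: continuous_on_eq_continuous_at)

text \<open>Here \<open>i\<close> stands for the derivative of \<theta>, that is for
  \<open>1 / w\<close>. Kept as an opaque factor it leaves a purely polynomial computation.\<close>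

lemma exp_wr_poly_deriv:
  fixes e z \<rho> :: "real \<Rightarrow> complex"
  assumes de: "(e has_vector_derivative s * i * e x) (at x)"
    and dz: "(z has_vector_derivative (z x - V) * \<rho> x * i) (at x)"
    and dr: "(\<rho> has_vector_derivative (z x - K) * (z x - V) * i) (at x)"
    and sq: "\<rho> x * \<rho> x = z x * z x - 2 * K * z x - K * V"
  shows "((\<lambda>x. e x * wr_poly p (z x) (\<rho> x)) has_vector_derivative
    e x * wr_poly_deriv K V s p (z x) (\<rho> x) * i) (at x)"
proof -
  obtain a0 a1 a2 a3 b0 b1 b2 where p: "p = (a0, a1, a2, a3, b0, b1, b2)"
    by (cases p) auto
  have d1: "((\<lambda>x. a0 + a1 * z x + a2 * z x * z x + a3 * z x * z x * z x) has_vector_derivative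
      (a1 + 2 * a2 * z x + 3 * a3 * z x * z x) * (z x - V) * \<rho> x * i) (at x)"
    by (rule has_vector_derivative_eq_rhs,
        (rule has_vector_derivative_mult has_vector_derivative_add dz has_vector_derivative_const)+)
       (simp add: algebra_simps)
  have d2: "((\<lambda>x. b0 + b1 * z x + b2 * z x * z x) has_vector_derivative
      (b1 + 2 * b2 * z x) * (z x - V) * \<rho> x * i) (at x)"
    by (rule has_vector_derivative_eq_rhs,
        (rule has_vector_derivative_mult has_vector_derivative_add dz has_vector_derivative_const)+)
       (simp add: algebra_simps)
  note d = has_vector_derivative_mult[OF de has_vector_derivative_add[OF d1 has_vector_derivative_mult[OF d2 dr]]]
  show ?thesis
    unfolding p wr_poly_def prod.case
  proof (rule has_vector_derivative_eq_rhs[OF d])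
    have "(b1 + 2 * b2 * z x) * (z x - V) * \<rho> x * i * \<rho> x
        = (b1 + 2 * b2 * z x) * (z x - V) * i * (\<rho> x * \<rho> x)" by (simp only: mult_ac)
    then have eq: "(b1 + 2 * b2 * z x) * (z x - V) * \<rho> x * i * \<rho> x
        = (b1 + 2 * b2 * z x) * (z x - V) * i * (z x * z x - 2 * K * z x - K * V)" unfolding sq .
    show "e x * ((a1 + 2 * a2 * z x + 3 * a3 * z x * z x) * (z x - V) * \<rho> x * i
        + ((b0 + b1 * z x + b2 * z x * z x) * ((z x - K) * (z x - V) * i)
          + (b1 + 2 * b2 * z x) * (z x - V) * \<rho> x * i * \<rho> x))
      + s * i * e x * (a0 + a1 * z x + a2 * z x * z x + a3 * z x * z x * z x
          + (b0 + b1 * z x + b2 * z x * z x) * \<rho> x)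
      = e x * wr_poly_deriv K V s (a0, a1, a2, a3, b0, b1, b2) (z x) (\<rho> x) * i"
      unfolding eq wr_poly_deriv_def wr_poly_def prod.case
      by (simp only: distrib_left distrib_right mult_ac add_ac)
  qed
qed

lemma quotient_derivative_identity:
  fixes z :: complex
  assumes "z \<noteq> 0"
  shows "e * P * - (d / z * (inverse z)\<^sup>2) + e * D / z * inverse z = e * (D / z\<^sup>2 - d * P / z ^ 3)"
  using assms by (simp add: divide_simps) (simp add: eval_nat_numeral algebra_simps)

lemma third_derivative_identity:
  fixes z :: complex
  assumes "z \<noteq> 0"
  shows "z\<^sup>2 * (l * (e * P0 - e * P2 / z) + (4 * z - 3 * c) * (e * P1)
       - z * (e * (D / z\<^sup>2 - d * P2 / z ^ 3)))
     = e * (l * (z\<^sup>2 * P0 - z * P2) + (4 * z - 3 * c) * z\<^sup>2 * P1 - (z * D - d * P2))"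
  using assms by (simp add: divide_simps) (simp add: eval_nat_numeral algebra_simps)

text \<open>This is the value of the polynomial factor at the end state \<open>(V, - R)\<close> of
  the curve. The factor \<open>V\<^sup>2 - s\<^sup>2\<close> permits the elimination of
  \<open>l\<close>, since the characteristic equation reads \<open>(l + s) * (V\<^sup>2 - s\<^sup>2)
  = (V\<^sup>2 - R\<^sup>2) * s\<close>. The factorization shows for which \<open>s\<close> the
  value can vanish; its last factor is the origin of the notion of a good root.\<close>

lemma wr_poly_sol_coeffs0_inf:
  assumes cp: "char_poly K V l s = 0" and R: "3 * K * V = V\<^sup>2 - R\<^sup>2"
  shows "(V\<^sup>2 - s\<^sup>2) * wr_poly (sol_coeffs0 K V l s) V (- R)
     = s * V\<^sup>2 * (s - R)\<^sup>2 * (3 * V\<^sup>2 - s\<^sup>2 + s * R - R\<^sup>2)"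
proof -
  have cp: "(l + s) * (V\<^sup>2 - s\<^sup>2) = (V\<^sup>2 - R\<^sup>2) * s"
    using cp unfolding R[symmetric] char_poly_def by (simp add: eval_nat_numeral algebra_simps)
  have "wr_poly (sol_coeffs0 K V l s) V (- R)
      = - (3 * K * V) * V\<^sup>2 * (l + 2 * s) + 3 * V\<^sup>2 * s\<^sup>2 * (l + s) + s * (2 * V\<^sup>2 + s\<^sup>2) * V\<^sup>2
       - (3 * V\<^sup>2 * s * (l + s) + 3 * V\<^sup>2 * s\<^sup>2) * R"
    by (simp add: wr_poly_def sol_coeffs0_def eval_nat_numeral algebra_simps)
  then have "(V\<^sup>2 - s\<^sup>2) * wr_poly (sol_coeffs0 K V l s) V (- R)
     = (V\<^sup>2 - s\<^sup>2) * (- (V\<^sup>2 - R\<^sup>2) * V\<^sup>2 * (l + 2 * s) + 3 * V\<^sup>2 * s\<^sup>2 * (l + s)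
       + s * (2 * V\<^sup>2 + s\<^sup>2) * V\<^sup>2 - (3 * V\<^sup>2 * s * (l + s) + 3 * V\<^sup>2 * s\<^sup>2) * R)"
    unfolding R by (simp only:)
  also have "\<dots> = V\<^sup>2 * (((l + s) * (V\<^sup>2 - s\<^sup>2)) * (- (V\<^sup>2 - R\<^sup>2) + 3 * s\<^sup>2 - 3 * s * R)
      + (V\<^sup>2 - s\<^sup>2) * (- (V\<^sup>2 - R\<^sup>2) * s + s * (2 * V\<^sup>2 + s\<^sup>2) - 3 * s\<^sup>2 * R))"
    by (simp add: eval_nat_numeral algebra_simps)
  also have "\<dots> = s * V\<^sup>2 * (s - R)\<^sup>2 * (3 * V\<^sup>2 - s\<^sup>2 + s * R - R\<^sup>2)"
    unfolding cp by (simp add: eval_nat_numeral algebra_simps)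
  finally show ?thesis .
qed

text \<open>The end state is an equilibrium of the polynomial system: every term of
  \<open>wr_poly_deriv\<close> with the factor \<open>z - V\<close> drops out at
  \<open>z = V\<close>, and only the derivative of the exponential remains.\<close>

lemma wr_poly_sol_coeffs1_inf:
  "V * wr_poly (sol_coeffs1 K V l s) V \<rho> = s * wr_poly (sol_coeffs0 K V l s) V \<rho>"
  unfolding sol_coeffs1_eq sol_coeffs0_def wr_poly_deriv_def prod.case by simp

section \<open>The explicit solutions along the wave: dual equation, limits and bounds\<close>

context solitary_wave
begin

abbreviation "K \<equiv> complex_of_real k"
definition V :: complex where "V = of_real W"
abbreviation "\<omega> \<equiv> \<lambda>x. complex_of_real (w x)"
abbreviation "\<rho> \<equiv> \<lambda>x. complex_of_real (r x)"

lemma V_nonzero: "V \<noteq> 0"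
  using W_pos unfolding V_def by (metis less_irrefl of_real_eq_0_iff)

lemma \<omega>_nonzero: "\<omega> x \<noteq> 0"
  using w_pos[of x] by simp

definition \<theta> :: "real \<Rightarrow> real" where
  "\<theta> = (SOME t. \<forall>x. (t has_real_derivative 1 / w x) (at x))"

lemma \<theta>_deriv: "(\<theta> has_real_derivative 1 / w x) (at x)"
proof -
  have "continuous_on UNIV (\<lambda>x. 1 / w x)"
    using w_deriv w_pos by (intro continuous_intros DERIV_continuous_on) (auto simp: less_imp_neq[symmetric] has_field_derivative_at_within)
  then obtain F where "\<And>x. (F has_vector_derivative 1 / w x) (at x)"
    using antiderivative_exists by blast
  then have "\<exists>t. \<forall>x. (t has_real_derivative 1 / w x) (at x)"
    by (auto simp: has_real_derivative_iff_has_vector_derivative)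
  from someI_ex[OF this] show ?thesis unfolding \<theta>_def by blast
qed

lemma \<theta>_mono: "x \<le> y \<Longrightarrow> \<theta> x \<le> \<theta> y"
  by (rule DERIV_nonneg_imp_nondecreasing[of x y \<theta>])
     (use \<theta>_deriv w_pos in \<open>auto intro!: exI less_imp_le\<close>)

lemma csmooth_\<theta> [csmooth_intros]: "csmooth (\<lambda>x. of_real (\<theta> x))"
proof (rule csmoothI)
  show "((\<lambda>x. complex_of_real (\<theta> x)) has_vector_derivative of_real (1 / w x)) (at x)" for x
    using \<theta>_deriv has_real_derivative_of_real_iff by blast
  have "csmooth (\<lambda>x. 1 / of_real (w x))"
    using w_pos by (intro csmooth_intros) (auto simp: less_imp_neq[symmetric])
  then show "csmooth (\<lambda>x. complex_of_real (1 / w x))" by simp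
qed

lemma \<rho>_sq: "\<rho> x * \<rho> x = \<omega> x * \<omega> x - 2 * K * \<omega> x - K * V"
proof -
  have "complex_of_real (r x * r x) = of_real (w x * w x - 2 * k * w x - k * W)"
    using r_sq[of x] by (simp add: power2_eq_square)
  then show ?thesis unfolding V_def by (simp add: of_real_diff)
qed

definition esol where
  "esol s p x = exp (s * of_real (\<theta> x)) * wr_poly p (\<omega> x) (\<rho> x)"

lemma csmooth_esol [csmooth_intros]: "csmooth (esol s p)"
  unfolding esol_def wr_poly_def by (cases p) (auto intro!: csmooth_intros)

lemma esol_deriv:
  "(esol s p has_vector_derivative exp (s * of_real (\<theta> x)) * wr_poly_deriv K V s p (\<omega> x) (\<rho> x) / \<omega> x) (at x)"
proof -
  define i where "i = inverse (\<omega> x)"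
  have dw: "(\<omega> has_vector_derivative (\<omega> x - V) * \<rho> x * i) (at x)"
    using has_vector_derivative_of_real[OF w_deriv_eq[of x], where 'a = complex]
    by (simp add: i_def divide_inverse V_def)
  have dr: "(\<rho> has_vector_derivative (\<omega> x - K) * (\<omega> x - V) * i) (at x)"
    using has_vector_derivative_of_real[OF r_deriv[of x], where 'a = complex]
    by (simp add: i_def divide_inverse V_def)
  have "((\<lambda>x. of_real (\<theta> x)) has_vector_derivative i) (at x)"
    using has_vector_derivative_of_real[OF \<theta>_deriv[of x], where 'a = complex]
    by (simp add: i_def divide_inverse)
  from field_vector_diff_chain_at[OF has_vector_derivative_mult_right[OF this, of s] DERIV_exp]
  have de: "((\<lambda>x. exp (s * of_real (\<theta> x))) has_vector_derivative s * i * exp (s * of_real (\<theta> x))) (at x)"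
    by (simp add: o_def)
  show ?thesis
    using exp_wr_poly_deriv[where z = \<omega> and \<rho> = \<rho>, OF de dw dr \<rho>_sq, of p]
    by (simp add: esol_def[abs_def] i_def divide_inverse)
qed

definition eta where "eta l s = esol s (sol_coeffs0 K V l s)"

lemma csmooth_eta: "csmooth (eta l s)"
  unfolding eta_def by (rule csmooth_esol)

lemma vderiv_eta: "vderiv (eta l s) = esol s (sol_coeffs1 K V l s)"
proof (rule vderiv_eqI)
  fix x
  have "\<omega> x \<noteq> 0" using w_pos[of x] by simp
  then show "(eta l s has_vector_derivative esol s (sol_coeffs1 K V l s) x) (at x)"
    using esol_deriv[of s "sol_coeffs0 K V l s" x]
    by (simp add: eta_def esol_def flip: sol_coeffs1_eq)
qed

lemma vderiv2_eta: "vderiv (vderiv (eta l s)) = (\<lambda>x. esol s (sol_coeffs2 K V l s) x / \<omega> x)"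
  unfolding vderiv_eta
  using esol_deriv[of s "sol_coeffs1 K V l s"]
  by (intro vderiv_eqI) (simp add: esol_def flip: sol_coeffs2_eq)

text \<open>The formal transpose of \<open>l (1 - \<partial>\<^sup>2) - c \<partial> (1 -
  \<partial>\<^sup>2) + \<partial> (4 - \<partial>\<^sup>2) u0\<close>, where the last factor is
  multiplication by \<open>u0 = c - w\<close>. The transpose is taken without complex
  conjugation.\<close>

definition dual_op :: "complex \<Rightarrow> (real \<Rightarrow> complex) \<Rightarrow> real \<Rightarrow> complex" where
  "dual_op l \<phi> x = l * (\<phi> x - vderiv (vderiv \<phi>) x) + (4 * \<omega> x - 3 * of_real c) * vderiv \<phi> x
     - \<omega> x * vderiv (vderiv (vderiv \<phi>)) x"

lemma dual_op_eta:
  assumes "char_poly K V l s = 0"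
  shows "dual_op l (eta l s) x = 0"
proof -
  let ?z = "\<omega> x" and ?r = "\<rho> x" and ?e = "exp (s * of_real (\<theta> x))"
  let ?P0 = "wr_poly (sol_coeffs0 K V l s) ?z ?r" and ?P1 = "wr_poly (sol_coeffs1 K V l s) ?z ?r"
    and ?P2 = "wr_poly (sol_coeffs2 K V l s) ?z ?r"
    and ?D = "wr_poly_deriv K V s (sol_coeffs2 K V l s) ?z ?r"
  have z: "?z \<noteq> 0" using w_pos[of x] by simp
  have dw: "(\<omega> has_vector_derivative (?z - V) * ?r / ?z) (at x)"
    using has_vector_derivative_of_real[OF w_deriv_eq[of x], where 'a = complex]
    by (simp add: V_def)
  have di: "((\<lambda>x. inverse (\<omega> x)) has_vector_derivative - ((?z - V) * ?r / ?z * (inverse ?z)\<^sup>2)) (at x)"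
    using field_vector_diff_chain_at[OF dw, of inverse "- (inverse ?z)\<^sup>2"] DERIV_inverse[OF z]
    by (simp add: o_def numeral_2_eq_2)
  have "vderiv (vderiv (vderiv (eta l s))) x = ?e * (?D / ?z\<^sup>2 - (?z - V) * ?r * ?P2 / ?z ^ 3)"
  proof -
    have "((\<lambda>x. esol s (sol_coeffs2 K V l s) x * inverse (\<omega> x)) has_vector_derivative
       ?e * ?P2 * - ((?z - V) * ?r / ?z * (inverse ?z)\<^sup>2) + ?e * ?D / ?z * inverse ?z) (at x)"
      using has_vector_derivative_mult[OF esol_deriv di] by (simp only: esol_def)
    then have "((\<lambda>x. esol s (sol_coeffs2 K V l s) x / \<omega> x) has_vector_derivative
       ?e * (?D / ?z\<^sup>2 - (?z - V) * ?r * ?P2 / ?z ^ 3)) (at x)"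
      using quotient_derivative_identity[OF z, of ?e ?P2 "(?z - V) * ?r" ?D]
      by (simp only: divide_inverse[symmetric])
    then show ?thesis by (subst vderiv2_eta) (simp add: vderiv_def vector_derivative_at)
  qed
  then have "dual_op l (eta l s) x = l * (?e * ?P0 - ?e * ?P2 / ?z) + (4 * ?z - 3 * of_real c) * (?e * ?P1)
     - ?z * (?e * (?D / ?z\<^sup>2 - (?z - V) * ?r * ?P2 / ?z ^ 3))"
    unfolding dual_op_def by (simp only: vderiv2_eta) (simp only: vderiv_eta, simp only: eta_def esol_def)
  then have "?z\<^sup>2 * dual_op l (eta l s) x = ?e * (l * (?z\<^sup>2 * ?P0 - ?z * ?P2)
     + (4 * ?z - 3 * of_real c) * ?z\<^sup>2 * ?P1 - (?z * ?D - (?z - V) * ?r * ?P2))"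
    using third_derivative_identity[OF z] by (simp only:)
  also have "complex_of_real c = V + K" by (simp add: V_def)
  also have "?e * (l * (?z\<^sup>2 * ?P0 - ?z * ?P2)
     + (4 * ?z - 3 * (V + K)) * ?z\<^sup>2 * ?P1 - (?z * ?D - (?z - V) * ?r * ?P2)) = 0"
    by (simp only: sol_coeffs_identity[OF \<rho>_sq assms] mult_zero_right)
  finally show ?thesis using z by simp
qed

text \<open>The limit at \<open>+\<infinity>\<close> of the polynomial factor of
  \<open>eta l s\<close>. Only when it is nonzero is \<open>exp (s \<theta>)\<close> the exact order
  of magnitude of \<open>eta l s\<close> there.\<close>

definition Qinf :: "complex \<Rightarrow> complex \<Rightarrow> complex" where
  "Qinf l s = wr_poly (sol_coeffs0 K V l s) V (- of_real r0)"

lemma wr_poly_tendsto: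
  "((\<lambda>x. wr_poly p (\<omega> x) (\<rho> x)) \<longlongrightarrow> wr_poly p V (- of_real r0)) at_top"
proof -
  have "(\<rho> \<longlongrightarrow> of_real (- r0)) at_top" by (intro tendsto_of_real r_tendsto)
  then have "(\<rho> \<longlongrightarrow> - of_real r0) at_top" by simp
  moreover have "(\<omega> \<longlongrightarrow> V) at_top" unfolding V_def by (intro tendsto_of_real w_tendsto)
  ultimately show ?thesis
    unfolding wr_poly_def prod.case case_prod_beta by (intro tendsto_intros)
qed

lemma Qinf_eq:
  assumes "char_poly K V l s = 0"
  defines "R \<equiv> complex_of_real r0"
  shows "(V\<^sup>2 - s\<^sup>2) * Qinf l s = s * V\<^sup>2 * (s - R)\<^sup>2 * (3 * V\<^sup>2 - s\<^sup>2 + s * R - R\<^sup>2)"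
proof -
  have "complex_of_real (3 * k * W) = of_real (W\<^sup>2 - r0\<^sup>2)" using r0_sq by simp
  then have "3 * K * V = V\<^sup>2 - R\<^sup>2"
    unfolding R_def V_def by (simp only: of_real_mult of_real_diff of_real_numeral of_real_power)
  from wr_poly_sol_coeffs0_inf[OF assms(1) this] show ?thesis unfolding Qinf_def R_def .
qed

lemma wr_poly_bounded: "\<exists>M. \<forall>x. cmod (wr_poly p (\<omega> x) (\<rho> x)) \<le> M"
proof -
  let ?f = "\<lambda>(y, z). wr_poly p (of_real y) (of_real z)"
  have "continuous_on ({0..c} \<times> {-c..c}) ?f"
    unfolding wr_poly_def by (cases p) (auto intro!: continuous_intros simp: case_prod_beta)
  then have "compact (?f ` ({0..c} \<times> {-c..c}))"
    by (intro compact_continuous_image compact_Times) auto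
  then obtain M where M: "\<And>y. y \<in> {0..c} \<times> {-c..c} \<Longrightarrow> cmod (?f y) \<le> M"
    using compact_imp_bounded bounded_iff by (metis imageI)
  have "cmod (wr_poly p (\<omega> x) (\<rho> x)) \<le> M" for x
    using M[of "(w x, r x)"] w_pos[of x] w_less[of x] r_abs_le[of x] by (auto simp: abs_le_iff)
  then show ?thesis by blast
qed

lemma esol_bounded: "\<exists>M. \<forall>x. cmod (esol s p x) \<le> M * exp (Re s * \<theta> x)"
  using wr_poly_bounded[of p] by (auto simp: esol_def norm_mult)

lemma eta_bounded:
  "\<exists>M. \<forall>x. cmod (eta l s x) \<le> M * exp (Re s * \<theta> x) \<and> cmod (vderiv (eta l s) x) \<le> M * exp (Re s * \<theta> x)
     \<and> cmod (vderiv (vderiv (eta l s)) x) \<le> M * exp (Re s * \<theta> x)"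
proof -
  obtain m where m: "m > 0" "\<And>x. m \<le> w x" by (rule w_bounded_below) auto
  obtain M0 M1 M2 where M: "\<And>x. cmod (esol s (sol_coeffs0 K V l s) x) \<le> M0 * exp (Re s * \<theta> x)"
     "\<And>x. cmod (esol s (sol_coeffs1 K V l s) x) \<le> M1 * exp (Re s * \<theta> x)"
     "\<And>x. cmod (esol s (sol_coeffs2 K V l s) x) \<le> M2 * exp (Re s * \<theta> x)"
    using esol_bounded by metis
  let ?M = "max M0 (max M1 (M2 / m))"
  have M2: "cmod (esol s (sol_coeffs2 K V l s) x / \<omega> x) \<le> M2 / m * exp (Re s * \<theta> x)" for x
  proof -
    have "cmod (esol s (sol_coeffs2 K V l s) x / \<omega> x) = cmod (esol s (sol_coeffs2 K V l s) x) / w x"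
      using w_pos[of x] by (simp add: norm_divide)
    also have "\<dots> \<le> M2 * exp (Re s * \<theta> x) / m"
      using M(3)[of x] m by (intro frac_le) (auto intro: order_trans[OF norm_ge_zero])
    finally show ?thesis by simp
  qed
  have "cmod (eta l s x) \<le> ?M * exp (Re s * \<theta> x) \<and> cmod (vderiv (eta l s) x) \<le> ?M * exp (Re s * \<theta> x)
     \<and> cmod (vderiv (vderiv (eta l s)) x) \<le> ?M * exp (Re s * \<theta> x)" for x
    unfolding vderiv2_eta unfolding vderiv_eta unfolding eta_def
    by (intro conjI order_trans[OF M(1)[of x] mult_right_mono] order_trans[OF M(2)[of x] mult_right_mono]
        order_trans[OF M2[of x] mult_right_mono]) auto
  then show ?thesis by blast
qed

end

section \<open>Reduction to a first-order equation\<close>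

lemma vderiv_mult:
  "csmooth f \<Longrightarrow> csmooth g \<Longrightarrow> vderiv (\<lambda>x. f x * g x) = (\<lambda>x. f x * vderiv g x + vderiv f x * g x)"
  by (intro vderiv_eqI has_vector_derivative_mult csmooth_deriv)

lemma vderiv_add:
  "csmooth f \<Longrightarrow> csmooth g \<Longrightarrow> vderiv (\<lambda>x. f x + g x) = (\<lambda>x. vderiv f x + vderiv g x)"
  by (intro vderiv_eqI has_vector_derivative_add csmooth_deriv)

lemma bounded_of_compact_deviation:
  fixes f :: "real \<Rightarrow> complex"
  assumes "continuous_on UNIV f" "\<And>x. x \<ge> R \<Longrightarrow> f x = a" "\<And>x. x \<le> - R \<Longrightarrow> f x = b"
  obtains M where "M \<ge> 0" "\<And>x. cmod (f x) \<le> M"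
proof -
  have "compact (f ` {-R..R})"
    by (intro compact_continuous_image continuous_on_subset[OF assms(1)]) auto
  then obtain B where B: "\<And>x. x \<in> {-R..R} \<Longrightarrow> cmod (f x) \<le> B"
    using compact_imp_bounded bounded_iff by (metis imageI)
  show ?thesis
  proof (rule that[of "max (max (cmod a) (cmod b)) B"])
    show "cmod (f x) \<le> max (max (cmod a) (cmod b)) B" for x
      using B[of x] assms(2,3)[of x] by (cases "x \<ge> R"; cases "x \<le> - R") (auto simp: le_max_iff_disj)
  qed (simp add: le_max_iff_disj)
qed

lemma ctest_bounded:
  assumes "ctest f"
  obtains M where "M \<ge> 0" "\<And>x. cmod (f x) \<le> M"
proof -
  obtain R where R: "\<And>x. \<bar>x\<bar> > R \<Longrightarrow> f x = 0" and "csmooth f"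
    using assms by (auto simp: ctest_def)
  show ?thesis
    by (rule bounded_of_compact_deviation[of f "\<bar>R\<bar> + 1" 0 0])
       (use R \<open>csmooth f\<close> that in \<open>auto intro: csmooth_continuous_on\<close>)
qed

text \<open>The constants at the two ends differ in general by the integral of \<open>g\<close>.
  Subtracting one of them gives an antiderivative that vanishes near the end of one's
  choice.\<close>

lemma ctest_antiderivative:
  assumes "ctest g"
  obtains F R where "csmooth F" "vderiv F = g" "\<And>x. x \<ge> R \<Longrightarrow> F x = F R" "\<And>x. x \<le> - R \<Longrightarrow> F x = F (- R)"
    "\<And>x. \<bar>x\<bar> \<ge> R \<Longrightarrow> g x = 0"
proof -
  obtain R where R: "\<And>x. \<bar>x\<bar> > R \<Longrightarrow> g x = 0" and g: "csmooth g"
    using assms by (auto simp: ctest_def)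
  obtain F where F: "\<And>x. (F has_vector_derivative g x) (at x)"
    using antiderivative_exists[OF csmooth_continuous_on[OF g]] by blast
  define R' where "R' = \<bar>R\<bar> + 1"
  have F0: "(F has_vector_derivative 0) (at x within S)" if "\<bar>x\<bar> \<ge> R'" for x S
    using F[of x] R[of x] that by (auto simp: R'_def intro: has_vector_derivative_at_within)
  show ?thesis
  proof (rule that[of F R'])
    show "csmooth F" using F g by (rule csmoothI)
    show "vderiv F = g" using F by (rule vderiv_eqI)
    show "F x = F R'" if "x \<ge> R'" for x
    proof -
      have "\<exists>c. \<forall>x\<in>{R'..}. F x = c"
        by (rule has_vector_derivative_zero_constant[where s = "{R'..}"])
           (auto intro!: F0 simp: R'_def)
      then show ?thesis using that by auto
    qed
    show "F x = F (- R')" if "x \<le> - R'" for x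
    proof -
      have "\<exists>c. \<forall>x\<in>{..-R'}. F x = c"
        by (rule has_vector_derivative_zero_constant[where s = "{..-R'}"])
           (auto intro!: F0 simp: R'_def)
      then show ?thesis using that by auto
    qed
  qed (use R in \<open>auto simp: R'_def\<close>)
qed

text \<open>Derivatives up to order two are what enters when a third-order operator is commuted with
  a cutoff.\<close>

definition jet_bounded_on :: "real set \<Rightarrow> (real \<Rightarrow> complex) \<Rightarrow> bool" where
  "jet_bounded_on A f \<longleftrightarrow> (\<exists>M. \<forall>x\<in>A. cmod (f x) \<le> M \<and> cmod (vderiv f x) \<le> M \<and> cmod (vderiv (vderiv f) x) \<le> M)"

section \<open>Weak solutions and commutators with multiplication operators\<close>

context solitary_wave
begin

definition weak_sol :: "complex \<Rightarrow> (real \<Rightarrow> complex) \<Rightarrow> bool" where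
  "weak_sol l v \<longleftrightarrow> v \<in> L2 \<and> (\<forall>\<phi>. ctest \<phi> \<longrightarrow> (LINT x|lborel. v x * dual_op l \<phi> x) = 0)"

lemma csmooth_dual_op: "csmooth \<phi> \<Longrightarrow> csmooth (dual_op l \<phi>)"
  unfolding dual_op_def[abs_def] by (intro csmooth_intros csmooth_deriv)

lemma dual_op_add:
  assumes "csmooth f" "csmooth g"
  shows "dual_op l (\<lambda>x. f x + g x) x = dual_op l f x + dual_op l g x"
  unfolding dual_op_def vderiv_add[OF assms] vderiv_add[OF assms[THEN csmooth_deriv(2)]]
    vderiv_add[OF assms[THEN csmooth_deriv(2), THEN csmooth_deriv(2)]]
  by (simp add: algebra_simps)

text \<open>\<open>commutator l (vderiv f) \<eta>\<close> is the commutator of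
  \<open>dual_op l\<close> with multiplication by \<open>f\<close>, applied to \<eta>. Constants
  commute with the operator, so it depends on \<open>f\<close> only through the derivative
  \<open>g\<close>, which may have compact support when \<open>f\<close> has not.\<close>

definition commutator where
  "commutator l g \<eta> x = - l * (vderiv g x * \<eta> x + 2 * g x * vderiv \<eta> x) + (4 * \<omega> x - 3 * of_real c) * g x * \<eta> x
    - \<omega> x * (vderiv (vderiv g) x * \<eta> x + 3 * vderiv g x * vderiv \<eta> x + 3 * g x * vderiv (vderiv \<eta>) x)"

lemma dual_op_mult:
  assumes "csmooth f" "csmooth g"
  shows "dual_op l (\<lambda>x. f x * g x) x = f x * dual_op l g x + commutator l (vderiv f) g x"
proof -
  have d: "(f has_vector_derivative vderiv f x) (at x)" "(g has_vector_derivative vderiv g x) (at x)"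
      "(vderiv f has_vector_derivative vderiv (vderiv f) x) (at x)" "(vderiv g has_vector_derivative vderiv (vderiv g) x) (at x)"
      "(vderiv (vderiv f) has_vector_derivative vderiv (vderiv (vderiv f)) x) (at x)"
      "(vderiv (vderiv g) has_vector_derivative vderiv (vderiv (vderiv g)) x) (at x)" for x
    using assms by (auto intro: csmooth_deriv)
  have "vderiv (vderiv (\<lambda>x. f x * g x)) = (\<lambda>x. f x * vderiv (vderiv g) x + 2 * vderiv f x * vderiv g x + vderiv (vderiv f) x * g x)"
    unfolding vderiv_mult[OF assms]
    by (rule vderiv_eqI, rule has_vector_derivative_eq_rhs,
        (rule has_vector_derivative_mult has_vector_derivative_add d has_vector_derivative_const)+)
       (simp add: algebra_simps)
  moreover have "vderiv (vderiv (vderiv (\<lambda>x. f x * g x))) = (\<lambda>x. f x * vderiv (vderiv (vderiv g)) x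
      + 3 * vderiv f x * vderiv (vderiv g) x + 3 * vderiv (vderiv f) x * vderiv g x + vderiv (vderiv (vderiv f)) x * g x)"
    unfolding calculation
    by (rule vderiv_eqI, rule has_vector_derivative_eq_rhs,
        (rule has_vector_derivative_mult has_vector_derivative_add d has_vector_derivative_const)+)
       (simp add: algebra_simps)
  ultimately show ?thesis
    unfolding dual_op_def commutator_def vderiv_mult[OF assms] by (simp only:) (simp add: algebra_simps)
qed

lemma commutator_bound:
  assumes "\<And>x. cmod (\<phi> x) \<le> M \<and> cmod (vderiv \<phi> x) \<le> M \<and> cmod (vderiv (vderiv \<phi>) x) \<le> M"
    and "cmod (g x) \<le> C" "cmod (vderiv g x) \<le> C" "cmod (vderiv (vderiv g) x) \<le> C"
  shows "cmod (commutator l g \<phi> x) \<le> (3 * cmod l + 14 * c) * C * M"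
proof -
  have M: "M \<ge> 0" "C \<ge> 0" using order_trans[OF norm_ge_zero] assms by blast+
  have m: "cmod (a * b) \<le> C * M" if "cmod a \<le> C" "cmod b \<le> M" for a b
    unfolding norm_mult using that M by (intro mult_mono) auto
  have w: "cmod (\<omega> x) \<le> c" using w_pos[of x] w_less[of x] by simp
  have "cmod (4 * \<omega> x - 3 * of_real c) \<le> 7 * c"
    using norm_triangle_ineq4[of "4 * \<omega> x" "3 * of_real c"] w c_pos by (simp add: norm_mult)
  then have 1: "cmod ((4 * \<omega> x - 3 * of_real c) * (g x * \<phi> x)) \<le> 7 * c * (C * M)"
    unfolding norm_mult[of "4 * \<omega> x - 3 * of_real c"] using c_pos M
    by (intro mult_mono m) (use assms in auto)
  have "cmod (vderiv g x * \<phi> x + 2 * (g x * vderiv \<phi> x)) \<le> C * M + 2 * (C * M)"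
    using norm_triangle_ineq[of "vderiv g x * \<phi> x" "2 * (g x * vderiv \<phi> x)"]
      m[of "vderiv g x" "\<phi> x"] m[of "g x" "vderiv \<phi> x"] assms by (simp add: norm_mult[of 2])
  then have 2: "cmod (- l * (vderiv g x * \<phi> x + 2 * (g x * vderiv \<phi> x))) \<le> cmod l * (3 * (C * M))"
    unfolding norm_mult[of "- l"] by (intro mult_mono) auto
  have "cmod (vderiv (vderiv g) x * \<phi> x + 3 * (vderiv g x * vderiv \<phi> x) + 3 * (g x * vderiv (vderiv \<phi>) x))
      \<le> C * M + 3 * (C * M) + 3 * (C * M)"
    using norm_triangle_ineq[of "vderiv (vderiv g) x * \<phi> x + 3 * (vderiv g x * vderiv \<phi> x)" "3 * (g x * vderiv (vderiv \<phi>) x)"]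
      norm_triangle_ineq[of "vderiv (vderiv g) x * \<phi> x" "3 * (vderiv g x * vderiv \<phi> x)"]
      m[of "vderiv (vderiv g) x" "\<phi> x"] m[of "vderiv g x" "vderiv \<phi> x"] m[of "g x" "vderiv (vderiv \<phi>) x"] assms
    by (simp add: norm_mult[of 3])
  then have 3: "cmod (\<omega> x * (vderiv (vderiv g) x * \<phi> x + 3 * (vderiv g x * vderiv \<phi> x) + 3 * (g x * vderiv (vderiv \<phi>) x))) \<le> c * (7 * (C * M))"
    unfolding norm_mult[of "\<omega> x"] using w c_pos by (intro mult_mono) auto
  have "commutator l g \<phi> x = - l * (vderiv g x * \<phi> x + 2 * (g x * vderiv \<phi> x)) + (4 * \<omega> x - 3 * of_real c) * (g x * \<phi> x)
     - \<omega> x * (vderiv (vderiv g) x * \<phi> x + 3 * (vderiv g x * vderiv \<phi> x) + 3 * (g x * vderiv (vderiv \<phi>) x))"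
    by (simp add: commutator_def mult.assoc)
  then have "cmod (commutator l g \<phi> x) \<le> cmod l * (3 * (C * M)) + 7 * c * (C * M) + c * (7 * (C * M))"
    using 1 2 3 by (simp only:) (intro order_trans[OF norm_triangle_ineq4] order_trans[OF norm_triangle_ineq] add_mono)
  then show ?thesis by (simp add: algebra_simps)
qed

end

section \<open>Cutoffs at a large scale\<close>

lemma vderiv_scale:
  assumes "csmooth f"
  shows "vderiv (\<lambda>x. f (a * x)) = (\<lambda>x. of_real a * vderiv f (a * x))"
proof (rule vderiv_eqI)
  fix x
  have "((\<lambda>x. a * x) has_vector_derivative a) (at x)"
    by (auto intro!: derivative_eq_intros)
  from vector_diff_chain_at[OF this csmooth_deriv(1)[OF assms]]
  show "((\<lambda>x. f (a * x)) has_vector_derivative of_real a * vderiv f (a * x)) (at x)"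
    by (simp add: o_def scaleR_conv_of_real)
qed

lemma csmooth_scale: "csmooth f \<Longrightarrow> csmooth (\<lambda>x. f (a * x))"
  using csmooth_affine[of f a 0] by simp

lemma vderiv_cmult: "csmooth f \<Longrightarrow> vderiv (\<lambda>x. a * f x) = (\<lambda>x. a * vderiv f x)"
  by (intro vderiv_eqI has_vector_derivative_mult_right csmooth_deriv)

lemma cutoff_exists:
  obtains \<zeta> where "ctest \<zeta>" "\<And>x. \<bar>x\<bar> \<le> 1 \<Longrightarrow> \<zeta> x = 1" "\<And>x. \<bar>x\<bar> \<ge> 2 \<Longrightarrow> \<zeta> x = (0 :: complex)"
proof (rule that)
  let ?\<zeta> = "\<lambda>x. complex_of_real (smooth_step (2 - x)) * complex_of_real (smooth_step (x - (- 2)))"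
  show z: "?\<zeta> x = 0" if "\<bar>x\<bar> \<ge> 2" for x
    using that by (cases "x \<ge> 2") (auto simp: smooth_step_eq_0)
  show "ctest ?\<zeta>"
    unfolding ctest_def using z by (intro conjI csmooth_intros exI[of _ 2]) auto
  show "?\<zeta> x = 1" if "\<bar>x\<bar> \<le> 1" for x
    using that by (simp add: smooth_step_eq_1)
qed

lemma ctest_scale:
  assumes "ctest \<phi>" "a > 0"
  shows "ctest (\<lambda>x. \<phi> (a * x))"
proof -
  obtain R where R: "\<And>x. \<bar>x\<bar> > R \<Longrightarrow> \<phi> x = 0" using assms by (auto simp: ctest_def)
  have "\<phi> (a * x) = 0" if "\<bar>x\<bar> > R / a" for x
    using that assms(2) by (intro R) (simp add: abs_mult field_simps)
  with assms(1) show ?thesis by (auto simp: ctest_def csmooth_scale)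
qed

text \<open>A function of height \<open>A / N\<^sup>2\<close> on an interval of length
  \<open>4 * N\<^sup>2\<close> has \<open>L\<^sup>2\<close> norm at most \<open>2 * A / N\<close>,
  hence the order \<open>1 / N\<close>. The proof uses a pointwise form of the Cauchy-Schwarz
  inequality.\<close>

lemma le_mult_if_bounded_on_interval:
  fixes f v :: "real \<Rightarrow> complex" and N :: nat
  assumes v: "v \<in> L2" and [measurable]: "f \<in> borel_measurable borel" and N: "N > 0"
    and b: "\<And>x. cmod (f x) \<le> A / (real N)\<^sup>2" and z: "\<And>x. \<bar>x\<bar> > 2 * (real N)\<^sup>2 \<Longrightarrow> f x = 0"
  shows "cmod (LINT x|lborel. v x * f x) \<le> A / 2 * ((LINT x|lborel. (cmod (v x))\<^sup>2) + 4) / N"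
proof -
  have [measurable]: "v \<in> borel_measurable borel" using v by (rule L2_measurable)
  have vi: "integrable lborel (\<lambda>x. (cmod (v x))\<^sup>2)" using v by (simp add: L2_def)
  let ?I = "{- (2 * real N ^ 2)..2 * real N ^ 2}"
  let ?g = "\<lambda>x. A / 2 * ((cmod (v x))\<^sup>2 / N + indicator ?I x / N ^ 3)"
  have gi: "integrable lborel ?g"
    by (intro integrable_mult_right Bochner_Integration.integrable_add integrable_divide vi integrable_real_indicator)
       (auto simp: emeasure_lborel_Icc_eq)
  have A: "A \<ge> 0" using order_trans[OF norm_ge_zero b[of 0]] N by (simp add: zero_le_divide_iff)
  have le: "cmod (v x * f x) \<le> ?g x" for x
  proof (cases "\<bar>x\<bar> > 2 * (real N)\<^sup>2")
    case True
    then show ?thesis using z[OF True] A by (auto intro!: mult_nonneg_nonneg add_nonneg_nonneg)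
  next
    case False
    then have I: "indicator ?I x = (1::real)" by (auto simp: indicator_def abs_le_iff)
    \<comment> \<open>Young's inequality for \<open>real N * cmod (v x)\<close> and
      \<open>1\<close>. After division by \<open>2 * N ^ 3\<close> both terms have integrals of
      order \<open>1 / N\<close> over the support.\<close>
    have "2 * real N * cmod (v x) \<le> (real N)\<^sup>2 * (cmod (v x))\<^sup>2 + 1"
      using sum_squares_bound[of "real N * cmod (v x)" 1] by (simp add: power_mult_distrib)
    then have "cmod (v x) / (real N)\<^sup>2 \<le> ((cmod (v x))\<^sup>2 / N + 1 / N ^ 3) / 2"
    proof -
      have "cmod (v x) / (real N)\<^sup>2 = 2 * real N * cmod (v x) / N ^ 3 / 2"
        using N by (simp add: eval_nat_numeral)
      also have "\<dots> \<le> ((real N)\<^sup>2 * (cmod (v x))\<^sup>2 + 1) / N ^ 3 / 2"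
        using \<open>2 * real N * cmod (v x) \<le> _\<close> by (intro divide_right_mono) auto
      also have "\<dots> = ((cmod (v x))\<^sup>2 / N + 1 / N ^ 3) / 2"
        using N by (simp add: add_divide_distrib eval_nat_numeral)
      finally show ?thesis .
    qed
    then have "A * (cmod (v x) / (real N)\<^sup>2) \<le> A * (((cmod (v x))\<^sup>2 / N + 1 / N ^ 3) / 2)"
      using A by (rule mult_left_mono)
    moreover have "cmod (v x * f x) \<le> cmod (v x) * (A / (real N)\<^sup>2)"
      unfolding norm_mult by (intro mult_left_mono b) auto
    ultimately show ?thesis using I by (simp add: mult.commute)
  qed
  have "cmod (LINT x|lborel. v x * f x) \<le> (LINT x|lborel. ?g x)"
    by (rule Bochner_Integration.integral_norm_bound_integral[OF _ gi])
       (use le in \<open>auto intro!: Bochner_Integration.integrable_bound[OF gi] AE_I2 order_trans[OF le]\<close>)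
  also have "\<dots> = A / 2 * ((LINT x|lborel. (cmod (v x))\<^sup>2) / N + 4 * N\<^sup>2 / N ^ 3)"
    using vi by (simp add: integral_add integrable_divide emeasure_lborel_Icc_eq measure_lborel_Icc)
  also have "\<dots> = A / 2 * ((LINT x|lborel. (cmod (v x))\<^sup>2) + 4) / N"
    using N by (simp add: field_simps eval_nat_numeral)
  finally show ?thesis .
qed

context solitary_wave
begin

text \<open>The weak equation extends to test functions that are merely bounded, provided
  \<open>dual_op l\<close> maps them to functions of compact support. A cutoff stretched over a
  distance of order \<open>N\<^sup>2\<close> leaves an error of height
  \<open>O(1 / N\<^sup>2)\<close>, and its pairing with the square-integrable \<open>v\<close> tends
  to 0.\<close>

lemma weak_sol_cutoff:
  assumes v: "weak_sol l v" and \<phi>: "csmooth \<phi>" and jb: "jet_bounded_on UNIV \<phi>"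
    and R: "\<And>x. \<bar>x\<bar> > R \<Longrightarrow> dual_op l \<phi> x = 0"
  shows "(LINT x|lborel. v x * dual_op l \<phi> x) = 0"
proof -
  obtain M where M: "\<And>x. cmod (\<phi> x) \<le> M \<and> cmod (vderiv \<phi> x) \<le> M \<and> cmod (vderiv (vderiv \<phi>) x) \<le> M"
    using jb by (auto simp: jet_bounded_on_def)
  obtain \<zeta> where \<zeta>: "ctest \<zeta>" "\<And>x. \<bar>x\<bar> \<le> 1 \<Longrightarrow> \<zeta> x = 1" "\<And>x. \<bar>x\<bar> \<ge> 2 \<Longrightarrow> \<zeta> x = 0"
    by (rule cutoff_exists) auto
  have s: "csmooth \<zeta>" using \<zeta>(1) by (simp add: ctest_def)
  obtain C1 C2 C3 where C: "C1 \<ge> 0" "C2 \<ge> 0" "C3 \<ge> 0" "\<And>x. cmod (vderiv \<zeta> x) \<le> C1" "\<And>x. cmod (vderiv (vderiv \<zeta>) x) \<le> C2"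
    "\<And>x. cmod (vderiv (vderiv (vderiv \<zeta>)) x) \<le> C3"
    using ctest_bounded[OF ctest_vderiv[OF \<zeta>(1)]] ctest_bounded[OF ctest_vderiv[OF ctest_vderiv[OF \<zeta>(1)]]]
      ctest_bounded[OF ctest_vderiv[OF ctest_vderiv[OF ctest_vderiv[OF \<zeta>(1)]]]] by metis
  define C where "C = C1 + C2 + C3"
  define A where "A = (3 * cmod l + 14 * c) * C * M"
  have vL2: "v \<in> L2" and weak: "\<And>\<psi>. ctest \<psi> \<Longrightarrow> (LINT x|lborel. v x * dual_op l \<psi> x) = 0"
    using v by (auto simp: weak_sol_def)
  have est: "cmod (LINT x|lborel. v x * dual_op l \<phi> x) \<le> A / 2 * ((LINT x|lborel. (cmod (v x))\<^sup>2) + 4) / N"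
    if N: "N > 0" "real N \<ge> R" for N :: nat
  proof -
    \<comment> \<open>A stretch by \<open>(real N)\<^sup>2\<close> instead of \<open>real N\<close>
      makes the commutator error have the height required by the preceding estimate
      directly.\<close>
    define a where "a = 1 / (real N)\<^sup>2"
    have N1: "real N \<ge> 1" using N by simp
    have a: "a > 0" "a \<le> 1" "R * a \<le> 1"
    proof -
      show "a > 0" using N by (simp add: a_def)
      have "1 \<le> real N * real N" using N1 mult_mono[of 1 "real N" 1 "real N"] by simp
      then show "a \<le> 1" by (simp add: a_def power2_eq_square)
      have "real N \<le> real N * real N" using mult_right_mono[OF N1, of "real N"] by simp
      with N(2) have "R \<le> real N * real N" by linarith
      then show "R * a \<le> 1" using N by (simp add: a_def power2_eq_square)
    qed
    define \<zeta>a where "\<zeta>a = (\<lambda>x. \<zeta> (a * x))"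
    have sa: "csmooth \<zeta>a" and ta: "ctest \<zeta>a"
      unfolding \<zeta>a_def using csmooth_scale[OF s] ctest_scale[OF \<zeta>(1) a(1)] by auto
    have d1: "vderiv \<zeta>a = (\<lambda>x. of_real a * vderiv \<zeta> (a * x))"
      unfolding \<zeta>a_def by (rule vderiv_scale[OF s])
    have d2: "vderiv (vderiv \<zeta>a) = (\<lambda>x. of_real a * (of_real a * vderiv (vderiv \<zeta>) (a * x)))"
      unfolding d1 by (simp add: vderiv_cmult csmooth_scale csmooth_deriv(2) s vderiv_scale)
    have d3: "vderiv (vderiv (vderiv \<zeta>a)) = (\<lambda>x. of_real a * (of_real a * (of_real a * vderiv (vderiv (vderiv \<zeta>)) (a * x))))"
      unfolding d2 using csmooth_scale[of "vderiv (vderiv \<zeta>)" a]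
      by (simp add: vderiv_cmult csmooth_mult csmooth_const csmooth_deriv(2) s vderiv_scale)
    \<comment> \<open>Since \<open>a \<le> 1\<close>, the derivatives of the stretched cutoff of all
      three orders are bounded by the first power of \<open>a\<close>.\<close>
    have scale: "a * y \<le> a * C" "a * (a * y) \<le> a * C" "a * (a * (a * y)) \<le> a * C" if "y \<le> C" "y \<ge> 0" for y
    proof -
      have le: "a * z \<le> z" if "z \<ge> 0" for z using that a by (intro mult_left_le_one_le) auto
      show 1: "a * y \<le> a * C" using that a by (intro mult_left_mono) auto
      have "0 \<le> a * y" "0 \<le> a * (a * y)" using that a by auto
      then show "a * (a * y) \<le> a * C" "a * (a * (a * y)) \<le> a * C"
        using 1 le[of "a * y"] le[of "a * (a * y)"] by linarith+
    qed
    let ?E = "commutator l (vderiv \<zeta>a) \<phi>"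
    have Eb: "cmod (?E x) \<le> A / (real N)\<^sup>2" for x
    proof -
      have "cmod (vderiv \<zeta>a x) \<le> a * C" "cmod (vderiv (vderiv \<zeta>a) x) \<le> a * C" "cmod (vderiv (vderiv (vderiv \<zeta>a)) x) \<le> a * C"
        unfolding d3 unfolding d2 unfolding d1
        using a C(1-3) C(4)[of "a * x"] C(5)[of "a * x"] C(6)[of "a * x"]
          scale(1)[of "cmod (vderiv \<zeta> (a * x))"] scale(2)[of "cmod (vderiv (vderiv \<zeta>) (a * x))"]
          scale(3)[of "cmod (vderiv (vderiv (vderiv \<zeta>)) (a * x))"]
        by (simp_all add: norm_mult C_def)
      from commutator_bound[OF M this] show ?thesis by (simp add: A_def a_def mult_ac)
    qed
    have Ez: "?E x = 0" if x: "\<bar>x\<bar> > 2 * (real N)\<^sup>2" for x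
    proof -
      have "\<zeta>a y = 0" if "y \<in> {y. \<bar>y\<bar> > 2 * (real N)\<^sup>2}" for y
        unfolding \<zeta>a_def using that N by (intro \<zeta>(3)) (simp add: a_def abs_mult field_simps)
      moreover have op: "open {y. \<bar>y\<bar> > 2 * (real N)\<^sup>2}" by (intro open_Collect_less continuous_intros)
      ultimately have z1: "vderiv \<zeta>a y = 0" if "y \<in> {y. \<bar>y\<bar> > 2 * (real N)\<^sup>2}" for y
        using that vderiv_eq_0_of_eq_const by blast
      then have z2: "vderiv (vderiv \<zeta>a) y = 0" if "y \<in> {y. \<bar>y\<bar> > 2 * (real N)\<^sup>2}" for y
        using that vderiv_eq_0_of_eq_const op by blast
      then have z3: "vderiv (vderiv (vderiv \<zeta>a)) y = 0" if "y \<in> {y. \<bar>y\<bar> > 2 * (real N)\<^sup>2}" for y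
        using that vderiv_eq_0_of_eq_const op by blast
      show ?thesis using z1[of x] z2[of x] z3[of x] x by (simp add: commutator_def)
    qed
    have Es: "csmooth ?E"
      unfolding commutator_def[abs_def] using sa \<phi> by (intro csmooth_intros csmooth_deriv(2))
    have "ctest (\<lambda>x. \<zeta>a x * \<phi> x)" using ta \<phi> by (rule ctest_mult)
    then have "0 = (LINT x|lborel. v x * dual_op l (\<lambda>x. \<zeta>a x * \<phi> x) x)" using weak by simp
    also have "\<dots> = (LINT x|lborel. v x * dual_op l \<phi> x + v x * ?E x)"
    proof (intro arg_cong[where f = "integral\<^sup>L lborel"] ext)
      fix x
      \<comment> \<open>The cutoff equals 1 where \<open>dual_op l \<phi>\<close> may be nonzero,
        because \<open>R * a \<le> 1\<close>; the commutator is therefore the only error.\<close>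
      have "\<zeta>a x * dual_op l \<phi> x = dual_op l \<phi> x"
      proof (cases "\<bar>x\<bar> > R")
        case True
        then show ?thesis using R by simp
      next
        case False
        then have "\<bar>a * x\<bar> \<le> a * R" using a by (simp add: abs_mult)
        then have "\<zeta>a x = 1" unfolding \<zeta>a_def using a(3) by (intro \<zeta>(2)) (simp add: mult.commute)
        then show ?thesis by simp
      qed
      then show "v x * dual_op l (\<lambda>x. \<zeta>a x * \<phi> x) x = v x * dual_op l \<phi> x + v x * ?E x"
        by (simp add: dual_op_mult[OF sa \<phi>] distrib_left)
    qed
    also have "\<dots> = (LINT x|lborel. v x * dual_op l \<phi> x) + (LINT x|lborel. v x * ?E x)"
    proof (rule Bochner_Integration.integral_add)
      show "integrable lborel (\<lambda>x. v x * dual_op l \<phi> x)"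
        by (rule L2_mult_integrable[OF vL2 L2I_continuous[of _ R]])
           (use R csmooth_continuous_on[OF csmooth_dual_op[OF \<phi>]] in auto)
      show "integrable lborel (\<lambda>x. v x * ?E x)"
        by (rule L2_mult_integrable[OF vL2 L2I_continuous[of _ "2 * (real N)\<^sup>2"]])
           (use Ez csmooth_continuous_on[OF Es] in auto)
    qed
    finally have "cmod (LINT x|lborel. v x * dual_op l \<phi> x) = cmod (LINT x|lborel. v x * ?E x)"
      by (metis add_eq_0_iff norm_minus_cancel)
    also have "\<dots> \<le> A / 2 * ((LINT x|lborel. (cmod (v x))\<^sup>2) + 4) / N"
      by (rule le_mult_if_bounded_on_interval[OF vL2 csmooth_measurable[OF Es] N(1) Eb Ez])
    finally show ?thesis .
  qed
  let ?D = "A / 2 * ((LINT x|lborel. (cmod (v x))\<^sup>2) + 4)"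
  have "cmod (LINT x|lborel. v x * dual_op l \<phi> x) \<le> 0"
  proof (rule tendsto_lowerbound[OF lim_const_over_n])
    show "\<forall>\<^sub>F n in sequentially. cmod (LINT x|lborel. v x * dual_op l \<phi> x) \<le> ?D / real n"
      using eventually_gt_at_top[of 0] eventually_ge_at_top[of "nat \<lceil>R\<rceil>"]
    proof eventually_elim
      case (elim n)
      then show ?case by (intro est) linarith+
    qed
  qed simp
  then show ?thesis by simp
qed

section \<open>Testing with dual solutions that are bounded on one side\<close>

lemma commutator_eq_0:
  assumes "ctest g"
  obtains R where "\<And>x e. \<bar>x\<bar> > R \<Longrightarrow> commutator l g e x = 0"
proof -
  obtain R1 where R1: "\<And>x. \<bar>x\<bar> > R1 \<Longrightarrow> g x = 0"
    using assms by (auto simp: ctest_def)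
  obtain R2 where R2: "\<And>x. \<bar>x\<bar> > R2 \<Longrightarrow> vderiv g x = 0"
    using ctest_vderiv[OF assms] by (auto simp: ctest_def)
  obtain R3 where R3: "\<And>x. \<bar>x\<bar> > R3 \<Longrightarrow> vderiv (vderiv g) x = 0"
    using ctest_vderiv[OF ctest_vderiv[OF assms]] by (auto simp: ctest_def)
  show ?thesis
    by (rule that[of "max R1 (max R2 R3)"]) (simp add: commutator_def R1 R2 R3)
qed

text \<open>Let \<open>G\<close> be the antiderivative of \<open>g\<close> that vanishes near the
  end where \<eta> may be unbounded. Then \<open>G * \<eta>\<close> is bounded, and
  \<open>dual_op l\<close> maps it to the compactly supported commutator, so it is admissible. Since
  \<open>G\<close> may be a nonzero constant near the other end, \<open>g\<close> need not have
  integral 0; this gain of one integration constant is what decay of \<open>v\<close>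
  contributes.\<close>

lemma weak_sol_commutator:
  assumes v: "weak_sol l v" and \<eta>: "csmooth \<eta>" "\<And>x. dual_op l \<eta> x = 0"
    and side: "(\<forall>a. jet_bounded_on {..a} \<eta>) \<or> (\<forall>a. jet_bounded_on {a..} \<eta>)" and g: "ctest g"
  shows "(LINT x|lborel. v x * commutator l g \<eta> x) = 0"
proof -
  obtain F R where F: "csmooth F" "vderiv F = g" "\<And>x. x \<ge> R \<Longrightarrow> F x = F R" "\<And>x. x \<le> - R \<Longrightarrow> F x = F (- R)"
    "\<And>x. \<bar>x\<bar> \<ge> R \<Longrightarrow> g x = 0"
    by (rule ctest_antiderivative[OF g]) blast
  obtain G A where G: "csmooth G" "vderiv G = g" "\<And>x. x \<notin> A \<Longrightarrow> G x = 0" "jet_bounded_on A \<eta>"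
     and Gb: "\<exists>B\<ge>0. \<forall>x. cmod (G x) \<le> B"
  proof -
    note obtained = that
    have *: thesis if A: "jet_bounded_on A \<eta>" "\<And>x. x \<notin> A \<Longrightarrow> F x = a" for A a
    proof (rule obtained[of "\<lambda>x. F x - a" A])
      show "csmooth (\<lambda>x. F x - a)" using F(1) by (intro csmooth_intros)
      show "vderiv (\<lambda>x. F x - a) = g"
        using has_vector_derivative_diff_const[of F a] csmooth_deriv(1)[OF F(1)] F(2)
        by (intro vderiv_eqI) simp
      obtain B where "B \<ge> 0" "\<And>x. cmod (F x - a) \<le> B"
      proof (rule bounded_of_compact_deviation[of "\<lambda>x. F x - a" R "F R - a" "F (- R) - a"])
        show "continuous_on UNIV (\<lambda>x. F x - a)"
          by (intro csmooth_continuous_on \<open>csmooth (\<lambda>x. F x - a)\<close>)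
        show "F x - a = F R - a" if "x \<ge> R" for x using F(3)[OF that] by (rule arg_cong)
        show "F x - a = F (- R) - a" if "x \<le> - R" for x using F(4)[OF that] by (rule arg_cong)
      qed blast
      then show "\<exists>B\<ge>0. \<forall>x. cmod (F x - a) \<le> B" by blast
    qed (use A in auto)
    from side show thesis
    proof
      assume "\<forall>a. jet_bounded_on {..a} \<eta>"
      then have "jet_bounded_on {..R} \<eta>" by blast
      then show thesis by (rule *) (rule F(3), simp)
    next
      assume "\<forall>a. jet_bounded_on {a..} \<eta>"
      then have "jet_bounded_on {- R..} \<eta>" by blast
      then show thesis by (rule *) (rule F(4), simp)
    qed
  qed
  obtain B where B: "B \<ge> 0" "\<And>x. cmod (G x) \<le> B" using Gb by blast
  obtain M where M: "\<And>x. x \<in> A \<Longrightarrow> cmod (\<eta> x) \<le> M" "\<And>x. x \<in> A \<Longrightarrow> cmod (vderiv \<eta> x) \<le> M"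
      "\<And>x. x \<in> A \<Longrightarrow> cmod (vderiv (vderiv \<eta>) x) \<le> M"
    using G(4) by (auto simp: jet_bounded_on_def)
  have gs: "csmooth g" using g by (simp add: ctest_def)
  have op: "dual_op l (\<lambda>x. G x * \<eta> x) x = commutator l g \<eta> x" for x
    by (simp add: dual_op_mult[OF G(1) \<eta>(1)] \<eta>(2) G(2))
  have Gm: "cmod (G x * f x) \<le> B * \<bar>M\<bar>" if "\<And>x. x \<in> A \<Longrightarrow> cmod (f x) \<le> M" for f x
  proof (cases "x \<in> A")
    case True
    then have "cmod (f x) \<le> \<bar>M\<bar>" using that[of x] by linarith
    then show ?thesis unfolding norm_mult using B by (intro mult_mono) auto
  qed (use G(3) B in auto)
  have Gm1: "cmod (G x * \<eta> x) \<le> B * \<bar>M\<bar>" and Gm2: "cmod (G x * vderiv \<eta> x) \<le> B * \<bar>M\<bar>"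
    and Gm3: "cmod (G x * vderiv (vderiv \<eta>) x) \<le> B * \<bar>M\<bar>" for x
    by (rule Gm, erule M)+
  have d1: "vderiv (\<lambda>x. G x * \<eta> x) = (\<lambda>x. G x * vderiv \<eta> x + g x * \<eta> x)"
    by (simp add: vderiv_mult G \<eta>)
  have d2: "vderiv (vderiv (\<lambda>x. G x * \<eta> x)) = (\<lambda>x. G x * vderiv (vderiv \<eta>) x + (g x * vderiv \<eta> x + (g x * vderiv \<eta> x + vderiv g x * \<eta> x)))"
    unfolding d1
  proof (rule vderiv_eqI)
    fix x
    have "(G has_vector_derivative g x) (at x)" using csmooth_deriv(1)[OF G(1)] G(2) by simp
    note d = has_vector_derivative_add[OF
        has_vector_derivative_mult[OF this csmooth_deriv(1)[OF csmooth_deriv(2)[OF \<eta>(1)]]]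
        has_vector_derivative_mult[OF csmooth_deriv(1)[OF gs] csmooth_deriv(1)[OF \<eta>(1)]]]
    show "((\<lambda>x. G x * vderiv \<eta> x + g x * \<eta> x) has_vector_derivative
        G x * vderiv (vderiv \<eta>) x + (g x * vderiv \<eta> x + (g x * vderiv \<eta> x + vderiv g x * \<eta> x))) (at x)"
      by (rule has_vector_derivative_eq_rhs[OF d]) (simp only: add.assoc)
  qed
  obtain B1 where B1: "\<And>x. cmod (g x * \<eta> x) \<le> B1"
    using ctest_bounded[OF ctest_mult[OF g \<eta>(1)]] by metis
  obtain B2 where B2: "\<And>x. cmod (g x * vderiv \<eta> x) \<le> B2"
    using ctest_bounded[OF ctest_mult[OF g csmooth_deriv(2)[OF \<eta>(1)]]] by metis
  obtain B3 where B3: "\<And>x. cmod (vderiv g x * \<eta> x) \<le> B3"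
    using ctest_bounded[OF ctest_mult[OF ctest_vderiv[OF g] \<eta>(1)]] by metis
  have nn: "B1 \<ge> 0" "B2 \<ge> 0" "B3 \<ge> 0"
    using order_trans[OF norm_ge_zero B1[of 0]] order_trans[OF norm_ge_zero B2[of 0]] order_trans[OF norm_ge_zero B3[of 0]] by auto
  have "jet_bounded_on UNIV (\<lambda>x. G x * \<eta> x)"
    unfolding jet_bounded_on_def d2 unfolding d1
  proof (intro exI[of _ "B * \<bar>M\<bar> + B1 + 2 * B2 + B3"] ballI conjI)
    fix x
    show "cmod (G x * \<eta> x) \<le> B * \<bar>M\<bar> + B1 + 2 * B2 + B3"
      using Gm1[of x] nn by linarith
    show "cmod (G x * vderiv \<eta> x + g x * \<eta> x) \<le> B * \<bar>M\<bar> + B1 + 2 * B2 + B3"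
      using Gm2[of x] B1[of x] nn norm_triangle_ineq[of "G x * vderiv \<eta> x" "g x * \<eta> x"] by linarith
    show "cmod (G x * vderiv (vderiv \<eta>) x + (g x * vderiv \<eta> x + (g x * vderiv \<eta> x + vderiv g x * \<eta> x))) \<le> B * \<bar>M\<bar> + B1 + 2 * B2 + B3"
      using Gm3[of x] B2[of x] B3[of x] nn
        norm_triangle_ineq[of "G x * vderiv (vderiv \<eta>) x" "g x * vderiv \<eta> x + (g x * vderiv \<eta> x + vderiv g x * \<eta> x)"]
        norm_triangle_ineq[of "g x * vderiv \<eta> x" "g x * vderiv \<eta> x + vderiv g x * \<eta> x"]
        norm_triangle_ineq[of "g x * vderiv \<eta> x" "vderiv g x * \<eta> x"] by linarith
  qed
  moreover obtain R' where "\<And>x. \<bar>x\<bar> > R' \<Longrightarrow> commutator l g \<eta> x = 0" using commutator_eq_0[OF g] by metis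
  then have "dual_op l (\<lambda>x. G x * \<eta> x) x = 0" if "\<bar>x\<bar> > R'" for x
    unfolding op using that by simp
  moreover have "csmooth (\<lambda>x. G x * \<eta> x)" using G \<eta> by (intro csmooth_intros)
  ultimately have "(LINT x|lborel. v x * dual_op l (\<lambda>x. G x * \<eta> x) x) = 0"
    by (intro weak_sol_cutoff[OF v]) auto
  then show ?thesis by (simp add: op)
qed

text \<open>The modulus of the jet is controlled by \<open>exp (Re s * \<theta> x)\<close> with
  monotone \<theta>, so the sign of \<open>Re s\<close> selects the side.\<close>

lemma eta_one_sided_bounded: "(\<forall>a. jet_bounded_on {..a} (eta l s)) \<or> (\<forall>a. jet_bounded_on {a..} (eta l s))"
proof -
  obtain M where M: "\<And>x. cmod (eta l s x) \<le> M * exp (Re s * \<theta> x) \<and> cmod (vderiv (eta l s) x) \<le> M * exp (Re s * \<theta> x)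
     \<and> cmod (vderiv (vderiv (eta l s)) x) \<le> M * exp (Re s * \<theta> x)"
    using eta_bounded[of l s] by blast
  have "M * exp (Re s * \<theta> 0) \<ge> 0" using M[of 0] order_trans[OF norm_ge_zero] by blast
  then have M0: "M \<ge> 0" by (simp add: zero_le_mult_iff)
  have *: "jet_bounded_on A (eta l s)" if "\<And>x. x \<in> A \<Longrightarrow> Re s * \<theta> x \<le> Re s * \<theta> a" for A a
  proof -
    have "M * exp (Re s * \<theta> x) \<le> M * exp (Re s * \<theta> a)" if "x \<in> A" for x
      using \<open>\<And>x. x \<in> A \<Longrightarrow> Re s * \<theta> x \<le> Re s * \<theta> a\<close>[OF that] M0 by (intro mult_left_mono) auto
    then show ?thesis unfolding jet_bounded_on_def
      using M by (intro exI[of _ "M * exp (Re s * \<theta> a)"]) (meson order_trans)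
  qed
  show ?thesis
  proof (cases "Re s \<ge> 0")
    case True
    then have "jet_bounded_on {..a} (eta l s)" for a
      by (intro *[of _ a] mult_left_mono \<theta>_mono) auto
    then show ?thesis by blast
  next
    case False
    then have "jet_bounded_on {a..} (eta l s)" for a
      by (intro *[of _ a] mult_left_mono_neg \<theta>_mono) auto
    then show ?thesis by blast
  qed
qed

text \<open>Variation of constants with two of the three solutions: the choice
  \<open>G\<^sub>1' = \<kappa> \<eta>\<^sub>3\<close>, \<open>G\<^sub>3' = - \<kappa> \<eta>\<^sub>1\<close> cancels \<open>\<kappa>''\<close> and leaves a first-order equation for \<open>v\<close>.\<close>

lemma weak_sol_first_order:
  assumes v: "weak_sol l v" and cp: "char_poly K V l s1 = 0" "char_poly K V l s3 = 0" and \<kappa>: "ctest \<kappa>"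
  defines "\<Omega> \<equiv> \<lambda>x. eta l s3 x * vderiv (eta l s1) x - eta l s1 x * vderiv (eta l s3) x"
  shows "(LINT x|lborel. v x * (l * \<kappa> x * \<Omega> x + \<omega> x * (vderiv \<kappa> x * \<Omega> x + 2 * \<kappa> x * vderiv \<Omega> x))) = 0"
proof -
  let ?e1 = "eta l s1" and ?e3 = "eta l s3"
  note [csmooth_intros] = csmooth_eta csmooth_deriv(2)
  have s: "csmooth ?e1" "csmooth ?e3" "csmooth \<kappa>"
    using \<kappa> by (auto simp: ctest_def intro: csmooth_intros)
  have d\<Omega>: "vderiv \<Omega> = (\<lambda>x. ?e3 x * vderiv (vderiv ?e1) x - ?e1 x * vderiv (vderiv ?e3) x)"
    unfolding \<Omega>_def
    by (rule vderiv_eqI, rule has_vector_derivative_eq_rhs,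
        (rule has_vector_derivative_mult has_vector_derivative_diff csmooth_deriv(1) csmooth_deriv(2) s)+) simp
  have g1: "ctest (\<lambda>x. \<kappa> x * ?e3 x)" and g3: "ctest (\<lambda>x. - 1 * (\<kappa> x * ?e1 x))"
    by (intro ctest_mult \<kappa> s ctest_mult' csmooth_intros)+
  have dd: "vderiv (\<lambda>x. \<kappa> x * vderiv e x + vderiv \<kappa> x * e x) = (\<lambda>x. \<kappa> x * vderiv (vderiv e) x + 2 * (vderiv \<kappa> x * vderiv e x) + vderiv (vderiv \<kappa>) x * e x)"
    if "csmooth e" for e :: "real \<Rightarrow> complex"
    by (rule vderiv_eqI, rule has_vector_derivative_eq_rhs,
        (rule has_vector_derivative_mult has_vector_derivative_add csmooth_deriv(1) csmooth_deriv(2) s that)+) simp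
  have int: "integrable lborel (\<lambda>x. v x * commutator l g e x)" if ge: "ctest g" "csmooth e" for g e
  proof -
    obtain R where R: "\<And>x. \<bar>x\<bar> > R \<Longrightarrow> commutator l g e x = 0" using commutator_eq_0[OF ge(1)] by metis
    have "csmooth (commutator l g e)"
      unfolding commutator_def[abs_def] using ge by (intro csmooth_intros) (auto simp: ctest_def)
    then have "commutator l g e \<in> L2"
      using R by (intro L2I_continuous csmooth_continuous_on)
    then show ?thesis using v by (intro L2_mult_integrable) (simp_all add: weak_sol_def)
  qed
  \<comment> \<open>By antisymmetry in the two solutions the term with
    \<open>4 * \<omega> x - 3 * of_real c\<close> cancels as well, and what remains is expressible
    by \<Omega> and its derivative.\<close>
  have "commutator l (\<lambda>x. \<kappa> x * ?e3 x) ?e1 x + commutator l (\<lambda>x. - 1 * (\<kappa> x * ?e1 x)) ?e3 x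
     = - (l * \<kappa> x * \<Omega> x + \<omega> x * (vderiv \<kappa> x * \<Omega> x + 2 * \<kappa> x * vderiv \<Omega> x))" for x
  proof -
    have "csmooth (\<lambda>x. \<kappa> x * ?e1 x)" using s by (intro csmooth_intros)
    then have "vderiv (\<lambda>x. - 1 * (\<kappa> x * ?e1 x)) = (\<lambda>x. - 1 * vderiv (\<lambda>x. \<kappa> x * ?e1 x) x)"
      "vderiv (\<lambda>x. - 1 * vderiv (\<lambda>x. \<kappa> x * ?e1 x) x) = (\<lambda>x. - 1 * vderiv (vderiv (\<lambda>x. \<kappa> x * ?e1 x)) x)"
      by (rule vderiv_cmult, rule vderiv_cmult[OF csmooth_deriv(2)])
    then show ?thesis
      unfolding commutator_def d\<Omega> by (simp only: vderiv_mult[OF s(3) s(1)] vderiv_mult[OF s(3) s(2)] dd[OF s(1)] dd[OF s(2)])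
        (simp add: \<Omega>_def algebra_simps)
  qed
  then have "(LINT x|lborel. v x * - (l * \<kappa> x * \<Omega> x + \<omega> x * (vderiv \<kappa> x * \<Omega> x + 2 * \<kappa> x * vderiv \<Omega> x)))
     = (LINT x|lborel. v x * commutator l (\<lambda>x. \<kappa> x * ?e3 x) ?e1 x + v x * commutator l (\<lambda>x. - 1 * (\<kappa> x * ?e1 x)) ?e3 x)"
    by (simp only: distrib_left[symmetric])
  also have "\<dots> = (LINT x|lborel. v x * commutator l (\<lambda>x. \<kappa> x * ?e3 x) ?e1 x) + (LINT x|lborel. v x * commutator l (\<lambda>x. - 1 * (\<kappa> x * ?e1 x)) ?e3 x)"
    by (intro Bochner_Integration.integral_add int g1 g3 s)
  also have "\<dots> = 0"
    using weak_sol_commutator[OF v s(1) dual_op_eta[OF cp(1)] eta_one_sided_bounded g1]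
      weak_sol_commutator[OF v s(2) dual_op_eta[OF cp(2)] eta_one_sided_bounded g3] by (simp only: add_0)
  finally show ?thesis
    by (simp only: mult_minus_right Bochner_Integration.integral_minus neg_equal_0_iff_equal)
qed

end

section \<open>Vanishing near infinity and unique continuation\<close>

lemma loc_integrable_diff: "loc_integrable f \<Longrightarrow> loc_integrable g \<Longrightarrow> loc_integrable (\<lambda>x. f x - g x)"
  unfolding loc_integrable_def by (auto intro: set_integral_diff)

lemma loc_integrable_const: "loc_integrable (\<lambda>_. a)"
  unfolding loc_integrable_def set_integrable_def
  by (auto intro!: integrable_scaleR_left integrable_real_indicator simp: emeasure_lborel_Icc_eq)

lemma antiderivative_zero_left:
  assumes g: "csmooth g" and z: "\<And>x. x \<le> a \<Longrightarrow> g x = 0"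
  obtains F where "csmooth F" "vderiv F = g" "\<And>x. x \<le> a \<Longrightarrow> F x = 0"
proof -
  obtain F where F: "\<And>x. (F has_vector_derivative g x) (at x)"
    using antiderivative_exists[OF csmooth_continuous_on[OF g]] by blast
  have d: "((\<lambda>x. F x - F a) has_vector_derivative g x) (at x)" for x
    using F by (simp add: has_vector_derivative_diff_const)
  show ?thesis
  proof (rule that[of "\<lambda>x. F x - F a"])
    show "csmooth (\<lambda>x. F x - F a)" using d g by (rule csmoothI)
    show "vderiv (\<lambda>x. F x - F a) = g" using d by (rule vderiv_eqI)
    show "F x - F a = 0" if "x \<le> a" for x
    proof -
      have "(F has_vector_derivative 0) (at x within {..a})" if "x \<in> {..a}" for x
        using F[of x] z[of x] that by (auto intro: has_vector_derivative_at_within)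
      then obtain c where "\<And>x. x \<in> {..a} \<Longrightarrow> F x = c"
        using has_vector_derivative_zero_constant[of "{..a}" F] by auto
      then show ?thesis using that by simp
    qed
  qed
qed

text \<open>Up to a multiple of a fixed bump \<open>b\<close>, every test function supported to the
  right of \<open>a\<close> is the derivative of another one, so the constant \<open>C\<close> has
  to be the average of \<open>y\<close> against \<open>b\<close>. The bump and the antiderivative
  both respect the support condition on the left.\<close>

lemma du_Bois_Reymond:
  assumes y: "loc_integrable y"
    and int: "\<And>\<phi>. ctest \<phi> \<Longrightarrow> (\<And>x. x \<le> a \<Longrightarrow> \<phi> x = 0) \<Longrightarrow> (LINT x|lborel. y x * vderiv \<phi> x) = 0"
  obtains C where "AE x in lborel. a < x \<longrightarrow> y x = C"
proof -
  \<comment> \<open>The bump lives on \<open>[a, a + 3]\<close> and equals 1 on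
    \<open>[a + 1, a + 2]\<close>, whence its integral \<open>I\<close> is at least 1 and may be
    divided by.\<close>
  define b where "b x = smooth_step (x - a) * smooth_step (a + 3 - x)" for x
  have b0: "b x = 0" if "x \<le> a \<or> a + 3 \<le> x" for x
    using that by (auto simp: b_def smooth_step_eq_0)
  have b1: "b x = 1" if "a + 1 \<le> x" "x \<le> a + 2" for x
    using that by (simp add: b_def smooth_step_eq_1)
  have bnn: "0 \<le> b x" for x unfolding b_def by (intro mult_nonneg_nonneg smooth_step_nonneg)
  have bs: "csmooth (\<lambda>x. of_real (b x))"
    unfolding b_def of_real_mult by (intro csmooth_intros)
  have bt: "ctest (\<lambda>x. of_real (b x))"
  proof -
    have "complex_of_real (b x) = 0" if "\<bar>x\<bar> > \<bar>a\<bar> + 3" for x using that by (auto intro!: b0)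
    with bs show ?thesis unfolding ctest_def by blast
  qed
  define I where "I = (LINT x|lborel. b x)"
  have Ic: "(LINT x|lborel. complex_of_real (b x)) = of_real I"
    unfolding I_def by (rule integral_complex_of_real)
  have bi: "integrable lborel (\<lambda>x. complex_of_real (b x))"
  proof -
    have "complex_of_real (b x) = 0" if "\<bar>x\<bar> > \<bar>a\<bar> + 3" for x using that by (auto intro!: b0)
    from loc_integrable_mult_test[OF loc_integrable_const[of 1] csmooth_continuous_on[OF bs] this]
    show ?thesis by simp
  qed
  have bir: "integrable lborel b" using bi by (simp add: complex_of_real_integrable_eq)
  have "(LINT x|lborel. indicat_real {a + 1..a + 2} x) \<le> I"
    unfolding I_def
  proof (rule integral_mono)
    show "integrable lborel (indicator {a + 1..a + 2} :: real \<Rightarrow> real)"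
      by (rule integrable_real_indicator) auto
  qed (use bir b1 bnn in \<open>auto simp: indicator_def\<close>)
  then have I: "I \<ge> 1" by simp
  define C where "C = (LINT x|lborel. y x * of_real (b x)) / of_real I"
  have yt: "integrable lborel (\<lambda>x. y x * \<phi> x)" if \<phi>: "ctest \<phi>" for \<phi>
  proof -
    obtain R where R: "\<And>x. \<bar>x\<bar> > R \<Longrightarrow> \<phi> x = 0" and s: "csmooth \<phi>" using \<phi> by (auto simp: ctest_def)
    show ?thesis by (rule loc_integrable_mult_test[OF y csmooth_continuous_on[OF s] R])
  qed
  have "AE x in lborel. a < x \<longrightarrow> y x - C = 0"
  proof (rule fundamental_lemma_calculus_of_variations[OF loc_integrable_diff[OF y loc_integrable_const[of C]]])
    fix \<psi> assume \<psi>: "ctest \<psi>" "\<And>x. x \<le> a \<Longrightarrow> \<psi> x = 0"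
    obtain R where R: "\<And>x. \<bar>x\<bar> > R \<Longrightarrow> \<psi> x = 0" and s: "csmooth \<psi>" using \<psi> by (auto simp: ctest_def)
    have \<psi>i: "integrable lborel \<psi>"
      using loc_integrable_mult_test[OF loc_integrable_const[of 1] csmooth_continuous_on[OF s] R] by simp
    define S where "S = (LINT x|lborel. \<psi> x) / of_real I"
    define g where "g = (\<lambda>x. \<psi> x - S * of_real (b x))"
    have gt: "ctest g" unfolding g_def by (intro ctest_diff \<psi> ctest_mult' bt csmooth_intros)
    have gs: "csmooth g" using gt by (simp add: ctest_def)
    have g0: "g x = 0" if "x \<le> a" for x using \<psi>(2)[OF that] b0[of x] that by (simp add: g_def)
    have gi: "integrable lborel g" unfolding g_def by (intro Bochner_Integration.integrable_diff \<psi>i integrable_mult_right bi)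
    have g_int: "(LINT x|lborel. g x) = 0"
      unfolding g_def using \<psi>i bi I by (simp add: Bochner_Integration.integral_diff S_def flip: I_def)
    obtain R' where R': "\<And>x. \<bar>x\<bar> > R' \<Longrightarrow> g x = 0" using gt by (auto simp: ctest_def)
    obtain G where G: "csmooth G" "vderiv G = g" "\<And>x. x \<le> a \<Longrightarrow> G x = 0"
      by (rule antiderivative_zero_left[OF gs g0]) auto
    \<comment> \<open>The integral of \<open>g\<close> is 0 by the choice of \<open>S\<close>, so
      the antiderivative that starts at 0 on the left returns to 0 on the right.\<close>
    have Gz: "G x = 0" if x: "x > max \<bar>a\<bar> R'" for x
    proof -
      have "(LINT t|lborel. indicator {a..x} t *\<^sub>R g t) = G x - G a"
        by (rule integral_FTC_Icc)
           (use x csmooth_deriv(1)[OF G(1)] G(2) csmooth_continuous_on[OF gs] in \<open>auto intro: has_vector_derivative_at_within\<close>)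
      moreover have "indicator {a..x} t *\<^sub>R g t = g t" for t
        using g0[of t] R'[of t] x by (cases "t \<in> {a..x}") auto
      ultimately show ?thesis using g_int G(3) by simp
    qed
    have "ctest G"
      unfolding ctest_def
    proof (intro conjI G(1) exI allI impI)
      fix x :: real assume "\<bar>x\<bar> > max \<bar>a\<bar> R'"
      then show "G x = 0" using G(3)[of x] Gz[of x] by (cases "x \<ge> 0") auto
    qed
    then have "0 = (LINT x|lborel. y x * g x)" using int[of G] G by simp
    also have "\<dots> = (LINT x|lborel. y x * \<psi> x - S * (y x * of_real (b x)))"
      by (simp add: g_def algebra_simps)
    also have "\<dots> = (LINT x|lborel. y x * \<psi> x) - S * (LINT x|lborel. y x * of_real (b x))"
      using yt[OF \<psi>(1)] yt[OF bt] by (subst Bochner_Integration.integral_diff) auto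
    also have "S * (LINT x|lborel. y x * of_real (b x)) = C * (LINT x|lborel. \<psi> x)"
      by (simp add: S_def C_def)
    also have "(LINT x|lborel. y x * \<psi> x) - C * (LINT x|lborel. \<psi> x) = (LINT x|lborel. (y x - C) * \<psi> x)"
      using yt[OF \<psi>(1)] \<psi>i by (subst left_diff_distrib, subst Bochner_Integration.integral_diff) auto
    finally show "(LINT x|lborel. (y x - C) * \<psi> x) = 0" by simp
  qed
  then show ?thesis using that[of C] by simp
qed

lemma not_L2_if_bounded_below:
  assumes v: "v \<in> L2" and e: "e > 0" and b: "AE x in lborel. a < x \<longrightarrow> e \<le> cmod (v x)"
  shows False
proof -
  have vi: "integrable lborel (\<lambda>x. (cmod (v x))\<^sup>2)" using v by (simp add: L2_def)
  have le: "e\<^sup>2 * real n \<le> (LINT x|lborel. (cmod (v x))\<^sup>2)" for n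
  proof -
    have "e\<^sup>2 * real n = (LINT x|lborel. e\<^sup>2 * indicator {a + 0<..<a + real n} x)"
      by simp
    also have "\<dots> \<le> (LINT x|lborel. (cmod (v x))\<^sup>2)"
    proof (rule integral_mono_AE[OF _ vi])
      show "integrable lborel (\<lambda>x. e\<^sup>2 * indicator {a + 0<..<a + real n} x)"
        by (intro integrable_mult_right integrable_real_indicator) (auto simp: emeasure_lborel_Ioo)
      show "AE x in lborel. e\<^sup>2 * indicator {a + 0<..<a + real n} x \<le> (cmod (v x))\<^sup>2"
        using b by eventually_elim (use e in \<open>auto simp: indicator_def intro!: power_mono\<close>)
    qed
    finally show ?thesis .
  qed
  obtain n where "(LINT x|lborel. (cmod (v x))\<^sup>2) / e\<^sup>2 < real n" using reals_Archimedean2 by blast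
  then have "(LINT x|lborel. (cmod (v x))\<^sup>2) < e\<^sup>2 * real n" using e by (simp add: field_simps)
  with le[of n] show False by simp
qed

section \<open>Asymptotics of the Wronskian and vanishing near infinity\<close>

context solitary_wave
begin

text \<open>Goodness of both roots and \<open>s1 \<noteq> s3\<close> give the Wronskian the exact
  order \<open>exp ((s1 + s3) \<theta>)\<close> at infinity, so it has no zeros there. The sign
  condition on \<open>s1 + s3 + l\<close> then keeps every nonzero candidate for \<open>v\<close>
  bounded away from 0, which excludes square-integrability.\<close>

lemma weak_sol_eq_0_near_top:
  assumes v: "weak_sol l v" and cp: "char_poly K V l s1 = 0" "char_poly K V l s3 = 0"
    and ne: "s1 \<noteq> s3" and Q: "Qinf l s1 \<noteq> 0" "Qinf l s3 \<noteq> 0" and re: "Re (s1 + s3 + l) \<ge> 0"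
  obtains X where "AE x in lborel. X < x \<longrightarrow> v x = 0"
proof -
  have vL2: "v \<in> L2" using v by (simp add: weak_sol_def)
  define \<Omega> where "\<Omega> = (\<lambda>x. eta l s3 x * vderiv (eta l s1) x - eta l s1 x * vderiv (eta l s3) x)"
  define q where "q = (\<lambda>x. wr_poly (sol_coeffs0 K V l s3) (\<omega> x) (\<rho> x) * wr_poly (sol_coeffs1 K V l s1) (\<omega> x) (\<rho> x)
    - wr_poly (sol_coeffs0 K V l s1) (\<omega> x) (\<rho> x) * wr_poly (sol_coeffs1 K V l s3) (\<omega> x) (\<rho> x))"
  have \<Omega>q: "\<Omega> x = exp ((s1 + s3) * of_real (\<theta> x)) * q x" for x
    unfolding \<Omega>_def q_def vderiv_eta unfolding eta_def esol_def
    by (simp add: distrib_right exp_add algebra_simps)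
  have i1: "wr_poly (sol_coeffs1 K V l s) V (- of_real r0) = s * Qinf l s / V" for s
    using wr_poly_sol_coeffs1_inf[of V K l s "- of_real r0"] V_nonzero by (simp add: Qinf_def field_simps)
  \<comment> \<open>In the limit differentiating a solution multiplies its polynomial factor by
    \<open>s / V\<close>, so the Wronskian degenerates to a Vandermonde expression in
    \<open>s1\<close> and \<open>s3\<close>.\<close>
  have "(q \<longlongrightarrow> Qinf l s3 * (s1 * Qinf l s1 / V) - Qinf l s1 * (s3 * Qinf l s3 / V)) at_top"
    unfolding q_def i1[symmetric] unfolding Qinf_def by (intro tendsto_intros wr_poly_tendsto)
  moreover have "Qinf l s3 * (s1 * Qinf l s1 / V) - Qinf l s1 * (s3 * Qinf l s3 / V) = Qinf l s1 * Qinf l s3 * (s1 - s3) / V"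
    by (simp add: diff_divide_distrib algebra_simps)
  ultimately have qlim: "(q \<longlongrightarrow> Qinf l s1 * Qinf l s3 * (s1 - s3) / V) at_top" by simp
  define \<delta> where "\<delta> = cmod (Qinf l s1 * Qinf l s3 * (s1 - s3) / V) / 2"
  have \<delta>: "\<delta> > 0" using Q ne V_nonzero by (simp add: \<delta>_def)
  have "eventually (\<lambda>x. \<delta> < cmod (q x)) at_top"
    by (rule order_tendstoD(1)[OF tendsto_norm[OF qlim]]) (use \<delta> in \<open>simp add: \<delta>_def\<close>)
  then obtain X where X: "\<And>x. x \<ge> X \<Longrightarrow> \<delta> < cmod (q x)" by (auto simp: eventually_at_top_linorder)
  have \<Omega>nz: "\<Omega> x \<noteq> 0" if "x \<ge> X" for x using X[OF that] \<delta> by (auto simp: \<Omega>q)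
  note [csmooth_intros] = csmooth_eta csmooth_deriv(2)
  have \<Omega>s: "csmooth \<Omega>" unfolding \<Omega>_def by (intro csmooth_intros)
  text \<open>\<open>H\<close> is a smooth function on the whole line that agrees with \<open>exp (- l \<theta>) / \<Omega>\<^sup>2\<close> near \<open>\<infinity>\<close>.\<close>
  define n where "n x = cnj (\<Omega> x) * \<Omega> x + of_real (smooth_step (X + 1 - x))" for x
  have n_nz: "n x \<noteq> 0" for x
  proof -
    have n: "n x = of_real ((cmod (\<Omega> x))\<^sup>2 + smooth_step (X + 1 - x))"
      by (simp add: n_def complex_norm_square mult.commute flip: of_real_power)
    have "(cmod (\<Omega> x))\<^sup>2 + smooth_step (X + 1 - x) > 0"
    proof (cases "x < X + 1")
      case True
      then show ?thesis using smooth_step_pos[of "X + 1 - x"] by (intro add_nonneg_pos) auto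
    next
      case False
      then show ?thesis using \<Omega>nz[of x] smooth_step_nonneg by (intro add_pos_nonneg) auto
    qed
    then show ?thesis unfolding n using of_real_eq_0_iff by (metis less_irrefl)
  qed
  have ns: "csmooth n" unfolding n_def[abs_def] by (intro csmooth_intros \<Omega>s)
  \<comment> \<open>The quotient \<open>cnj (\<Omega> x) / n x\<close> replaces
    \<open>1 / \<Omega> x\<close>. Beyond \<open>X + 1\<close> the step in \<open>n\<close> is 0 and
    the two agree; further left the positive step keeps \<open>n\<close> nonzero at possible zeros
    of \<Omega>.\<close>
  define H where "H x = cnj (\<Omega> x) * cnj (\<Omega> x) / (n x * n x) * exp ((- l) * of_real (\<theta> x))" for x
  have Hs: "csmooth H" unfolding H_def[abs_def] by (intro csmooth_intros \<Omega>s ns) (simp add: n_nz)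
  have H\<Omega>: "H x * \<Omega> x * \<Omega> x = exp ((- l) * of_real (\<theta> x))" if "x \<ge> X + 1" for x
  proof -
    have nx: "n x = cnj (\<Omega> x) * \<Omega> x" using that by (simp add: n_def smooth_step_eq_0)
    have "H x * \<Omega> x * \<Omega> x = (n x * n x) / (n x * n x) * exp ((- l) * of_real (\<theta> x))"
      unfolding H_def by (simp add: nx)
    then show ?thesis using n_nz[of x] by simp
  qed
  have dH: "vderiv H x * \<Omega> x * \<Omega> x + 2 * H x * \<Omega> x * vderiv \<Omega> x = - l / \<omega> x * (H x * \<Omega> x * \<Omega> x)" if x: "x > X + 1" for x
  proof -
    have "((\<lambda>x. H x * \<Omega> x * \<Omega> x) has_vector_derivative
        (H x * \<Omega> x) * vderiv \<Omega> x + (H x * vderiv \<Omega> x + vderiv H x * \<Omega> x) * \<Omega> x) (at x)"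
      by (intro has_vector_derivative_mult csmooth_deriv Hs \<Omega>s)
    then have "((\<lambda>x. exp ((- l) * of_real (\<theta> x))) has_vector_derivative
        (H x * \<Omega> x) * vderiv \<Omega> x + (H x * vderiv \<Omega> x + vderiv H x * \<Omega> x) * \<Omega> x) (at x)"
      by (rule has_vector_derivative_transform_within_open[of _ _ _ "{X + 1<..}"]) (use x H\<Omega> in auto)
    moreover have "((\<lambda>x. complex_of_real (\<theta> x)) has_vector_derivative of_real (1 / w x)) (at x)"
      using has_vector_derivative_of_real[OF \<theta>_deriv[of x], where 'a = complex] .
    from field_vector_diff_chain_at[OF has_vector_derivative_mult_right[OF this, of "- l"] DERIV_exp]
    have "((\<lambda>x. exp ((- l) * of_real (\<theta> x))) has_vector_derivative - l * of_real (1 / w x) * exp ((- l) * of_real (\<theta> x))) (at x)"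
      by (simp add: o_def)
    ultimately have "(H x * \<Omega> x) * vderiv \<Omega> x + (H x * vderiv \<Omega> x + vderiv H x * \<Omega> x) * \<Omega> x
        = - l * of_real (1 / w x) * exp ((- l) * of_real (\<theta> x))"
      by (rule vector_derivative_unique_at)
    then show ?thesis unfolding H\<Omega>[OF less_imp_le[OF x]] by (simp add: algebra_simps)
  qed
  \<comment> \<open>\<open>H\<close> is an integrating factor: for
    \<open>\<kappa> = \<phi> * H\<close> the terms without \<open>vderiv \<phi>\<close> cancel where
    \<phi> lives, and the first-order equation says that \<open>y\<close> has weak derivative
    0.\<close>
  define y where "y = (\<lambda>x. v x * (\<omega> x * H x * \<Omega> x))"
  have "loc_integrable y"
    unfolding y_def by (intro L2_loc_integrable vL2 csmooth_continuous_on csmooth_intros Hs \<Omega>s)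
  moreover have "(LINT x|lborel. y x * vderiv \<phi> x) = 0"
    if \<phi>: "ctest \<phi>" and z: "\<And>x. x \<le> X + 2 \<Longrightarrow> \<phi> x = 0" for \<phi>
  proof -
    have \<phi>s: "csmooth \<phi>" using \<phi> by (simp add: ctest_def)
    have eq: "v x * (l * (\<phi> x * H x) * \<Omega> x + \<omega> x * (vderiv (\<lambda>x. \<phi> x * H x) x * \<Omega> x + 2 * (\<phi> x * H x) * vderiv \<Omega> x))
        = y x * vderiv \<phi> x" for x
    proof (cases "x < X + 2")
      case True
      then have "vderiv \<phi> x = 0" by (intro vderiv_eq_0_of_eq_const[where S = "{..<X + 2}"]) (auto simp: z)
      with True show ?thesis by (simp add: z vderiv_mult[OF \<phi>s Hs])
    next
      case False
      then have x: "x \<ge> X + 2" by simp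
      have "(l * (\<phi> x * H x) * \<Omega> x + \<omega> x * (vderiv (\<lambda>x. \<phi> x * H x) x * \<Omega> x + 2 * (\<phi> x * H x) * vderiv \<Omega> x)) * \<Omega> x
         = l * \<phi> x * (H x * \<Omega> x * \<Omega> x) + \<omega> x * vderiv \<phi> x * H x * \<Omega> x * \<Omega> x
          + \<omega> x * \<phi> x * (vderiv H x * \<Omega> x * \<Omega> x + 2 * H x * \<Omega> x * vderiv \<Omega> x)"
        unfolding vderiv_mult[OF \<phi>s Hs] by (simp add: algebra_simps)
      also have "\<dots> = \<omega> x * H x * \<Omega> x * vderiv \<phi> x * \<Omega> x"
        using x \<omega>_nonzero[of x] by (simp add: dH)
      finally have "l * (\<phi> x * H x) * \<Omega> x + \<omega> x * (vderiv (\<lambda>x. \<phi> x * H x) x * \<Omega> x + 2 * (\<phi> x * H x) * vderiv \<Omega> x)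
         = \<omega> x * H x * \<Omega> x * vderiv \<phi> x"
        using \<Omega>nz[of x] x by simp
      then show ?thesis by (simp add: y_def mult.assoc)
    qed
    show ?thesis
      using weak_sol_first_order[OF v cp ctest_mult[OF \<phi> Hs], folded \<Omega>_def[THEN fun_cong], folded \<Omega>_def]
      unfolding eq .
  qed
  ultimately obtain C where C: "AE x in lborel. X + 2 < x \<longrightarrow> y x = C"
    using du_Bois_Reymond by blast
  have est: "cmod (\<omega> x * H x * \<Omega> x) \<le> c * (exp (- Re (s1 + s3 + l) * \<theta> (X + 2)) / \<delta>)" and nz: "\<omega> x * H x * \<Omega> x \<noteq> 0"
    if x: "x > X + 2" for x
  proof -
    have \<Omega>x: "\<Omega> x \<noteq> 0" and q: "\<delta> < cmod (q x)" using x \<Omega>nz[of x] X[of x] by auto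
    have e: "H x * \<Omega> x = exp ((- l) * of_real (\<theta> x)) / \<Omega> x"
      using H\<Omega>[of x] x \<Omega>x by (simp add: field_simps)
    then show "\<omega> x * H x * \<Omega> x \<noteq> 0" using \<Omega>x \<omega>_nonzero[of x] by auto
    have "cmod (H x * \<Omega> x) = exp (- Re (s1 + s3 + l) * \<theta> x) / cmod (q x)"
    proof -
      have "exp (- (Re l * \<theta> x)) = exp (- Re (s1 + s3 + l) * \<theta> x) * exp (Re (s1 + s3) * \<theta> x)"
        by (simp add: algebra_simps flip: exp_add)
      then show ?thesis unfolding e unfolding \<Omega>q by (simp add: norm_divide norm_mult)
    qed
    also have "\<dots> \<le> exp (- Re (s1 + s3 + l) * \<theta> (X + 2)) / \<delta>"
    proof -
      have "Re (s1 + s3 + l) * \<theta> (X + 2) \<le> Re (s1 + s3 + l) * \<theta> x"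
        using x re by (intro mult_left_mono \<theta>_mono) auto
      then have "exp (- Re (s1 + s3 + l) * \<theta> x) \<le> exp (- Re (s1 + s3 + l) * \<theta> (X + 2))"
        by (simp only: exp_le_cancel_iff mult_minus_left neg_le_iff_le)
      then show ?thesis using q \<delta> by (intro frac_le) (simp_all del: exp_le_cancel_iff)
    qed
    finally have "cmod (\<omega> x) * cmod (H x * \<Omega> x) \<le> c * (exp (- Re (s1 + s3 + l) * \<theta> (X + 2)) / \<delta>)"
      using w_pos[of x] w_less[of x] by (intro mult_mono) auto
    then show "cmod (\<omega> x * H x * \<Omega> x) \<le> c * (exp (- Re (s1 + s3 + l) * \<theta> (X + 2)) / \<delta>)"
      by (simp add: norm_mult mult.assoc)
  qed
  \<comment> \<open>With \<open>y = C\<close>, the upper bound \<open>B\<close> for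
    \<open>\<omega> * H * \<Omega>\<close> becomes the lower bound \<open>cmod C / B\<close> for
    \<open>v\<close>.\<close>
  define B where "B = c * (exp (- Re (s1 + s3 + l) * \<theta> (X + 2)) / \<delta>)"
  have B: "B > 0" using c_pos \<delta> by (simp add: B_def)
  have "C = 0"
  proof (rule ccontr)
    assume "C \<noteq> 0"
    have "AE x in lborel. X + 2 < x \<longrightarrow> cmod C / B \<le> cmod (v x)"
      using C
    proof eventually_elim
      case (elim x)
      show ?case
      proof
        assume x: "X + 2 < x"
        then have "C = v x * (\<omega> x * H x * \<Omega> x)" using elim by (simp add: y_def)
        then have "cmod C = cmod (v x) * cmod (\<omega> x * H x * \<Omega> x)" by (simp only: norm_mult)
        also have "\<dots> \<le> cmod (v x) * B" unfolding B_def by (intro mult_left_mono est x) auto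
        finally show "cmod C / B \<le> cmod (v x)" using B by (simp add: field_simps)
      qed
    qed
    then show False using not_L2_if_bounded_below[OF vL2, of "cmod C / B"] B \<open>C \<noteq> 0\<close> by simp
  qed
  with C have "AE x in lborel. X + 2 < x \<longrightarrow> v x = 0"
    by (auto elim!: eventually_mono simp: y_def dest: nz)
  then show ?thesis by (rule that)
qed

section \<open>Unique continuation through a Volterra equation\<close>

lemma dual_op_local:
  assumes "open S" "x \<in> S" "csmooth f" "csmooth g" and eq: "\<And>y. y \<in> S \<Longrightarrow> f y = g y"
  shows "dual_op l f x = dual_op l g x"
proof -
  have *: "vderiv f y = vderiv g y" if "y \<in> S" "csmooth g" "\<And>y. y \<in> S \<Longrightarrow> f y = g y" for f g y
  proof -
    have "(f has_vector_derivative vderiv g y) (at y)"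
      by (rule has_vector_derivative_transform_within_open[OF csmooth_deriv(1)[OF that(2)] assms(1) that(1)])
         (simp add: that(3))
    then show ?thesis unfolding vderiv_def[of f] by (rule vector_derivative_at)
  qed
  have 1: "vderiv f y = vderiv g y" if "y \<in> S" for y using * that assms(4) eq by blast
  have 2: "vderiv (vderiv f) y = vderiv (vderiv g) y" if "y \<in> S" for y
    using *[OF that csmooth_deriv(2)[OF assms(4)] 1] .
  have 3: "vderiv (vderiv (vderiv f)) y = vderiv (vderiv (vderiv g)) y" if "y \<in> S" for y
    using *[OF that csmooth_deriv(2)[OF csmooth_deriv(2)[OF assms(4)]] 2] .
  show ?thesis using eq 1 2 3 assms(2) by (simp add: dual_op_def)
qed

text \<open>Testing with a triple antiderivative of \<open>\<psi>\<close>, cut off where \<open>v\<close> vanishes, turns the weak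
  equation into a Volterra equation for \<open>v\<close> on \<open>(a, X)\<close>.\<close>

lemma weak_sol_volterra:
  assumes v: "weak_sol l v" and vz: "AE x in lborel. X < x \<longrightarrow> v x = 0" and aX: "a < X" "X \<le> a + 1"
  defines "h \<equiv> \<lambda>x. indicator {a..X} x *\<^sub>R v x"
  defines "M \<equiv> 2 * cmod l + 7 * c"
  shows "AE x in lborel. a < x \<longrightarrow> cmod (h x * \<omega> x) \<le> M * (LINT x|lborel. cmod (h x))"
proof -
  have vL2: "v \<in> L2" and weak: "\<And>\<psi>. ctest \<psi> \<Longrightarrow> (LINT x|lborel. v x * dual_op l \<psi> x) = 0"
    using v by (auto simp: weak_sol_def)
  have [measurable]: "v \<in> borel_measurable borel" using vL2 by (rule L2_measurable)
  have [measurable]: "w \<in> borel_measurable borel"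
    using w_deriv by (intro borel_measurable_continuous_onI) (meson DERIV_isCont continuous_at_imp_continuous_on)
  have hm [measurable]: "h \<in> borel_measurable borel" unfolding h_def by measurable
  have hi: "integrable lborel h"
  proof -
    have "(\<lambda>x. complex_of_real (indicator {a..X} x)) \<in> L2"
      by (rule L2I_bounded[of _ 1 "max \<bar>a\<bar> \<bar>X\<bar>"]) (auto simp: indicator_def)
    from L2_mult_integrable[OF this vL2] show ?thesis by (simp add: h_def scaleR_conv_of_real)
  qed
  \<comment> \<open>By Cauchy's formula the first three antiderivatives of \<psi> have the kernels
    \<open>1\<close>, \<open>x - t\<close> and \<open>(x - t)\<^sup>2 / 2\<close>. Inserted into the
    lower-order part of the dual operator at the third antiderivative they give this kernel; locally
    the name \<open>k\<close> no longer denotes the end state.\<close>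
  define k where "k x t = (if a \<le> t \<and> t \<le> x then - l + (4 * \<omega> x - 3 * of_real c) * of_real (x - t)
     + l * of_real ((x - t)\<^sup>2 / 2) else 0)" for x t :: real
  have M: "M \<ge> 0" using c_pos by (simp add: M_def)
  \<comment> \<open>Since \<open>0 \<le> x - t \<le> 1\<close> on the relevant set, the outer two
    terms of the kernel contribute at most \<open>cmod l\<close> each, and the middle one at most
    \<open>4 * c + 3 * c\<close>.\<close>
  have kb: "cmod (h x * k x t) \<le> M * cmod (h x)" for x t
  proof (cases "x \<in> {a..X} \<and> a \<le> t \<and> t \<le> x")
    case True
    then have xt: "0 \<le> x - t" "x - t \<le> 1" using aX by auto
    then have xt2: "(x - t)\<^sup>2 / 2 \<le> 1" using power_mono[of "x - t" 1 2] by simp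
    have w: "cmod (4 * \<omega> x - 3 * of_real c) \<le> 7 * c"
      using norm_triangle_ineq4[of "4 * \<omega> x" "3 * of_real c"] w_pos[of x] w_less[of x] c_pos by (simp add: norm_mult)
    have "cmod ((4 * \<omega> x - 3 * of_real c) * of_real (x - t)) \<le> 7 * c * 1"
      unfolding norm_mult norm_of_real by (intro mult_mono w) (use xt c_pos in auto)
    moreover have "cmod (l * of_real ((x - t)\<^sup>2 / 2)) \<le> cmod l * 1"
      unfolding norm_mult norm_of_real by (intro mult_left_mono) (use xt2 in auto)
    ultimately have "cmod (k x t) \<le> M"
      using True norm_triangle_ineq[of "- l + (4 * \<omega> x - 3 * of_real c) * of_real (x - t)" "l * of_real ((x - t)\<^sup>2 / 2)"]
        norm_triangle_ineq[of "- l" "(4 * \<omega> x - 3 * of_real c) * of_real (x - t)"]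
      by (simp add: k_def M_def)
    then show ?thesis unfolding norm_mult by (metis mult.commute mult_left_mono norm_ge_zero)
  next
    case False
    then have "h x * k x t = 0" by (auto simp: h_def k_def)
    then show ?thesis using M by (simp only: norm_zero) (intro mult_nonneg_nonneg norm_ge_zero)
  qed
  have km [measurable]: "(\<lambda>(x, t). h x * k x t) \<in> borel_measurable (borel \<Otimes>\<^sub>M borel)"
    unfolding k_def by measurable
  have km1 [measurable]: "(\<lambda>x. h x * k x t) \<in> borel_measurable borel" for t
    unfolding k_def by measurable
  have hk: "integrable lborel (\<lambda>x. h x * k x t)" for t
    by (rule Bochner_Integration.integrable_bound[of _ "\<lambda>x. M * cmod (h x)"])
       (use hi M in \<open>auto intro!: order_trans[OF kb]\<close>)
  define f where "f t = h t * \<omega> t - (LINT x|lborel. h x * k x t)" for t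
  have If: "cmod (LINT x|lborel. h x * k x t) \<le> M * (LINT x|lborel. cmod (h x))" for t
  proof -
    have "cmod (LINT x|lborel. h x * k x t) \<le> (LINT x|lborel. M * cmod (h x))"
      by (rule Bochner_Integration.integral_norm_bound_integral[OF hk]) (use hi kb in auto)
    then show ?thesis using hi by simp
  qed
  have Im [measurable]: "(\<lambda>t. LINT x|lborel. h x * k x t) \<in> borel_measurable borel"
  proof -
    have "(\<lambda>t. LINT x|lborel. (\<lambda>(x, t). h x * k x t) (x, t)) \<in> borel_measurable borel"
      by measurable
    then show ?thesis by simp
  qed
  have fl: "loc_integrable f"
    unfolding f_def[abs_def]
  proof (rule loc_integrable_diff)
    have "loc_integrable (\<lambda>x. v x * of_real (w x))"
      by (intro L2_loc_integrable vL2 csmooth_continuous_on csmooth_intros)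
    then have *: "set_integrable lborel {-R..R} (\<lambda>x. v x * of_real (w x))" for R
      by (simp add: loc_integrable_def)
    have "set_integrable lborel {-R..R} (\<lambda>x. h x * \<omega> x)" for R
    proof -
      have "set_integrable lborel ({-R..R} \<inter> {a..X}) (\<lambda>x. v x * of_real (w x))"
        by (rule set_integrable_subset[OF *[of R]]) auto
      then show ?thesis
        by (simp add: set_integrable_def h_def indicator_inter_arith scaleR_conv_of_real mult_ac del: Int_atLeastAtMost)
    qed
    then show "loc_integrable (\<lambda>x. h x * \<omega> x)" by (simp add: loc_integrable_def)
    show "loc_integrable (\<lambda>t. LINT x|lborel. h x * k x t)"
      unfolding loc_integrable_def
    proof (intro conjI allI Im)
      fix R :: real
      show "set_integrable lborel {-R..R} (\<lambda>t. LINT x|lborel. h x * k x t)"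
        unfolding set_integrable_def
      proof (rule Bochner_Integration.integrable_bound)
        show "integrable lborel (\<lambda>x. (M * (LINT x|lborel. cmod (h x))) * indicator {-R..R} x)"
          by (intro integrable_mult_right integrable_real_indicator) (auto simp: emeasure_lborel_Icc_eq)
        have "norm (indicator {-R..R} t *\<^sub>R (LINT x|lborel. h x * k x t))
           \<le> norm ((M * (LINT x|lborel. cmod (h x))) * indicator {-R..R} t)" for t
          using If[of t] by (auto simp: indicator_def)
        then show "AE t in lborel. norm (indicator {-R..R} t *\<^sub>R (LINT x|lborel. h x * k x t))
           \<le> norm ((M * (LINT x|lborel. cmod (h x))) * indicator {-R..R} t)" by simp
      qed measurable
    qed
  qed
  have "AE x in lborel. a < x \<longrightarrow> f x = 0"
  proof (rule fundamental_lemma_calculus_of_variations[OF fl])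
    fix \<psi> assume \<psi>: "ctest \<psi>" and \<psi>0: "\<And>x. x \<le> a \<Longrightarrow> \<psi> x = 0"
    have \<psi>s: "csmooth \<psi>" using \<psi> by (simp add: ctest_def)
    obtain A1 where A1: "csmooth A1" "vderiv A1 = \<psi>" "\<And>x. x \<le> a \<Longrightarrow> A1 x = 0"
      by (rule antiderivative_zero_left[OF \<psi>s \<psi>0]) auto
    obtain A2 where A2: "csmooth A2" "vderiv A2 = A1" "\<And>x. x \<le> a \<Longrightarrow> A2 x = 0"
      by (rule antiderivative_zero_left[OF A1(1,3)]) auto
    obtain A3 where A3: "csmooth A3" "vderiv A3 = A2" "\<And>x. x \<le> a \<Longrightarrow> A3 x = 0"
      by (rule antiderivative_zero_left[OF A2(1,3)]) auto
    define E where "E x = l * (A3 x - A1 x) + (4 * \<omega> x - 3 * of_real c) * A2 x" for x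
    have dA3: "dual_op l A3 x = E x - \<omega> x * \<psi> x" for x
      by (simp add: dual_op_def A1(2) A2(2) A3(2) E_def)
    have Eint: "h x * E x = (LINT t|lborel. h x * k x t * \<psi> t)" for x
    proof (cases "x \<in> {a..X}")
      case True
      \<comment> \<open>An explicit antiderivative in \<open>t\<close> of the kernel times \<psi>,
        obtained by repeated integration by parts. Its boundary values are \<open>0\<close> at
        \<open>a\<close> and \<open>E x\<close> at \<open>x\<close>.\<close>
      define T where "T = (\<lambda>t. - l * A1 t + (4 * \<omega> x - 3 * of_real c) * (of_real (x - t) * A1 t + A2 t)
         + l * (of_real ((x - t)\<^sup>2 / 2) * A1 t + of_real (x - t) * A2 t + A3 t))"
      let ?k = "\<lambda>t. - l + (4 * \<omega> x - 3 * of_real c) * of_real (x - t) + l * of_real ((x - t)\<^sup>2 / 2)"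
      have dT: "(T has_vector_derivative ?k t * \<psi> t) (at t)" for t
      proof -
        have d1: "((\<lambda>t. complex_of_real (x - t)) has_vector_derivative of_real (- 1)) (at t)"
          by (rule has_vector_derivative_of_real) (auto intro!: derivative_eq_intros)
        have d2: "((\<lambda>t. complex_of_real ((x - t)\<^sup>2 / 2)) has_vector_derivative of_real (- (x - t))) (at t)"
          by (rule has_vector_derivative_of_real) (auto intro!: derivative_eq_intros)
        have dA: "(A1 has_vector_derivative \<psi> t) (at t)" "(A2 has_vector_derivative A1 t) (at t)"
          "(A3 has_vector_derivative A2 t) (at t)"
          using csmooth_deriv(1)[OF A1(1)] csmooth_deriv(1)[OF A2(1)] csmooth_deriv(1)[OF A3(1)] A1(2) A2(2) A3(2) by auto
        show ?thesis
          unfolding T_def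
          by (rule has_vector_derivative_eq_rhs,
              (rule has_vector_derivative_mult has_vector_derivative_add d1 d2 dA has_vector_derivative_const)+)
             (simp add: algebra_simps)
      qed
      have "(LINT t|lborel. indicator {a..x} t *\<^sub>R (?k t * \<psi> t)) = T x - T a"
      proof (rule integral_FTC_Icc)
        show "(T has_vector_derivative ?k t * \<psi> t) (at t within {a..x})" for t
          using dT by (rule has_vector_derivative_at_within)
        show "continuous_on {a..x} (\<lambda>t. ?k t * \<psi> t)"
          using csmooth_continuous_on[OF \<psi>s] by (intro continuous_intros) auto
      qed (use True in auto)
      moreover have "T a = 0" by (simp add: T_def A1 A2 A3)
      moreover have "T x = E x" by (simp add: T_def E_def algebra_simps)
      moreover have "indicator {a..x} t *\<^sub>R (?k t * \<psi> t) = k x t * \<psi> t" for t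
        by (simp add: k_def indicator_def)
      ultimately have "(LINT t|lborel. k x t * \<psi> t) = E x" by simp
      then show ?thesis by (simp add: mult.assoc)
    qed (simp add: h_def)
    define \<phi> where "\<phi> = (\<lambda>x. complex_of_real (smooth_step (X + 1 - x)) * A3 x)"
    have \<phi>s: "csmooth \<phi>" unfolding \<phi>_def by (intro csmooth_intros A3)
    have "ctest \<phi>"
      unfolding ctest_def
    proof (intro conjI \<phi>s exI allI impI)
      fix x assume "\<bar>x\<bar> > max \<bar>a\<bar> (\<bar>X\<bar> + 1)"
      then show "\<phi> x = 0" by (cases "x \<le> a") (auto simp: \<phi>_def A3(3) smooth_step_eq_0)
    qed
    then have "0 = (LINT x|lborel. v x * dual_op l \<phi> x)" using weak by simp
    also have "\<dots> = (LINT x|lborel. h x * (E x - \<omega> x * \<psi> x))"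
    proof (rule integral_cong_AE)
      show "AE x in lborel. v x * dual_op l \<phi> x = h x * (E x - \<omega> x * \<psi> x)"
        using vz AE_lborel_singleton[of X]
      proof eventually_elim
        case (elim x)
        show ?case
        proof (cases "x < X")
          case True
          have "dual_op l \<phi> x = dual_op l A3 x"
            by (rule dual_op_local[of "{..<X}"]) (use True \<phi>s A3 in \<open>auto simp: \<phi>_def smooth_step_eq_1\<close>)
          moreover have "E x - \<omega> x * \<psi> x = 0" if "x < a"
            using that by (simp add: E_def A1 A2 A3 \<psi>0)
          ultimately show ?thesis using True dA3 by (cases "x < a") (auto simp: h_def)
        next
          case False
          then show ?thesis using elim by (simp add: h_def)
        qed
      qed
      have [measurable]: "E \<in> borel_measurable borel" "\<psi> \<in> borel_measurable borel" "dual_op l \<phi> \<in> borel_measurable borel"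
        unfolding E_def[abs_def] by (intro csmooth_measurable csmooth_intros csmooth_dual_op A1 A2 A3 \<psi>s \<phi>s)+
      show "(\<lambda>x. v x * dual_op l \<phi> x) \<in> borel_measurable lborel"
        "(\<lambda>x. h x * (E x - \<omega> x * \<psi> x)) \<in> borel_measurable lborel" by measurable
    qed
    also have "\<dots> = (LINT x|lborel. (LINT t|lborel. h x * k x t * \<psi> t) - h x * \<omega> x * \<psi> x)"
      by (simp add: right_diff_distrib Eint mult.assoc)
    finally have 1: "(LINT x|lborel. (LINT t|lborel. h x * k x t * \<psi> t) - h x * \<omega> x * \<psi> x) = 0" by simp
    have pm [measurable]: "\<psi> \<in> borel_measurable borel" by (rule csmooth_measurable[OF \<psi>s])
    have \<psi>i: "integrable lborel \<psi>"
    proof -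
      obtain R where R: "\<And>x. \<bar>x\<bar> > R \<Longrightarrow> \<psi> x = 0" using \<psi> by (auto simp: ctest_def)
      from loc_integrable_mult_test[OF loc_integrable_const[of 1] csmooth_continuous_on[OF \<psi>s] R] show ?thesis by simp
    qed
    have prod: "integrable (lborel \<Otimes>\<^sub>M lborel) (\<lambda>(x, t). h x * k x t * \<psi> t)"
    proof (rule lborel_pair.Fubini_integrable)
      have hkp: "integrable lborel (\<lambda>t. h x * k x t * \<psi> t)" for x
      proof (rule Bochner_Integration.integrable_bound[of _ "\<lambda>t. M * cmod (h x) * cmod (\<psi> t)"])
        show "AE t in lborel. norm (h x * k x t * \<psi> t) \<le> norm (M * cmod (h x) * cmod (\<psi> t))"
          using kb[of x] M by (auto simp: norm_mult[of "_ * _" "\<psi> _"] abs_mult intro!: mult_right_mono)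
        show "(\<lambda>t. h x * k x t * \<psi> t) \<in> borel_measurable lborel"
          using km by measurable
      qed (use \<psi>i in auto)
      then show "AE x in lborel. integrable lborel (\<lambda>t. (\<lambda>(x, t). h x * k x t * \<psi> t) (x, t))" by simp
      have mm: "(\<lambda>(x, t). h x * k x t * \<psi> t) \<in> borel_measurable (lborel \<Otimes>\<^sub>M lborel)"
        using km by measurable
      then show "(\<lambda>(x, t). h x * k x t * \<psi> t) \<in> borel_measurable (lborel \<Otimes>\<^sub>M lborel)" .
      have "integrable lborel (\<lambda>x. LINT t|lborel. norm (h x * k x t * \<psi> t))"
      proof (rule Bochner_Integration.integrable_bound[of _ "\<lambda>x. M * cmod (h x) * (LINT t|lborel. cmod (\<psi> t))"])
        have "norm (LINT t|lborel. norm (h x * k x t * \<psi> t)) \<le> norm (M * cmod (h x) * (LINT t|lborel. cmod (\<psi> t)))" for x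
        proof -
          have "(LINT t|lborel. norm (h x * k x t * \<psi> t)) \<le> (LINT t|lborel. M * cmod (h x) * cmod (\<psi> t))"
          proof (rule integral_mono)
            show "integrable lborel (\<lambda>t. norm (h x * k x t * \<psi> t))" by (rule integrable_norm[OF hkp])
            show "integrable lborel (\<lambda>t. M * cmod (h x) * cmod (\<psi> t))"
              by (intro integrable_mult_right integrable_norm \<psi>i)
            show "norm (h x * k x t * \<psi> t) \<le> M * cmod (h x) * cmod (\<psi> t)" for t
              unfolding norm_mult[of "h x * k x t"] by (intro mult_right_mono kb) auto
          qed
          then show ?thesis using M by (simp add: abs_mult)
        qed
        then show "AE x in lborel. norm (LINT t|lborel. norm (h x * k x t * \<psi> t)) \<le> norm (M * cmod (h x) * (LINT t|lborel. cmod (\<psi> t)))"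
          by simp
        have "(\<lambda>x. LINT t|lborel. norm ((\<lambda>(x, t). h x * k x t * \<psi> t) (x, t))) \<in> borel_measurable lborel"
          using mm by measurable
        then show "(\<lambda>x. LINT t|lborel. norm (h x * k x t * \<psi> t)) \<in> borel_measurable lborel" by simp
      qed (use hi in auto)
      then show "integrable lborel (\<lambda>x. LINT t|lborel. norm ((\<lambda>(x, t). h x * k x t * \<psi> t) (x, t)))" by simp
    qed
    have i1: "integrable lborel (\<lambda>x. LINT t|lborel. h x * k x t * \<psi> t)"
      using lborel_pair.integrable_fst'[OF prod] by simp
    have i2: "integrable lborel (\<lambda>x. h x * \<omega> x * \<psi> x)"
    proof -
      have "(\<lambda>x. \<omega> x * \<psi> x) \<in> L2" using ctest_L2 ctest_mult'[OF \<psi> csmooth_w] by blast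
      moreover have "h \<in> L2"
      proof -
        have "integrable lborel (\<lambda>x. (cmod (h x))\<^sup>2)"
          by (rule Bochner_Integration.integrable_bound[of _ "\<lambda>x. (cmod (v x))\<^sup>2"])
             (use vL2 in \<open>auto simp: L2_def h_def indicator_def\<close>)
        then show ?thesis by (simp add: L2_def)
      qed
      ultimately show ?thesis using L2_mult_integrable[of h "\<lambda>x. \<omega> x * \<psi> x"] by (simp add: mult.assoc)
    qed
    \<comment> \<open>Exchanging the integrals frees the factor \<psi>, so that the weak equation
      becomes the statement that \<open>f\<close> is orthogonal to \<psi>.\<close>
    have "(LINT x|lborel. LINT t|lborel. h x * k x t * \<psi> t) = (LINT t|lborel. LINT x|lborel. h x * k x t * \<psi> t)"
      using lborel_pair.Fubini_integral[of "\<lambda>x t. h x * k x t * \<psi> t"] prod by simp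
    also have "\<dots> = (LINT t|lborel. (LINT x|lborel. h x * k x t) * \<psi> t)" by simp
    finally have fub: "(LINT x|lborel. LINT t|lborel. h x * k x t * \<psi> t) = (LINT t|lborel. (LINT x|lborel. h x * k x t) * \<psi> t)" .
    have i3: "integrable lborel (\<lambda>t. (LINT x|lborel. h x * k x t) * \<psi> t)"
      using lborel_pair.integrable_snd[of "\<lambda>x t. h x * k x t * \<psi> t"] prod by simp
    have "(LINT x|lborel. f x * \<psi> x) = (LINT x|lborel. h x * \<omega> x * \<psi> x) - (LINT t|lborel. (LINT x|lborel. h x * k x t) * \<psi> t)"
      unfolding f_def left_diff_distrib using i2 i3 by (rule Bochner_Integration.integral_diff)
    also have "\<dots> = 0"
      using 1 unfolding Bochner_Integration.integral_diff[OF i1 i2] fub by simp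
    finally show "(LINT x|lborel. f x * \<psi> x) = 0" .
  qed
  then show ?thesis
  proof eventually_elim
    case (elim x)
    show ?case
    proof
      assume "a < x"
      then have "h x * \<omega> x = (LINT y|lborel. h y * k y x)" using elim by (simp add: f_def)
      then show "cmod (h x * \<omega> x) \<le> M * (LINT x|lborel. cmod (h x))" using If[of x] by simp
    qed
  qed
qed

end

section \<open>Integrability criteria and integrals of derivatives\<close>

lemma indicator_L2_integrable:
  fixes v :: "real \<Rightarrow> complex"
  assumes v: "v \<in> L2"
  shows "integrable lborel (\<lambda>x. indicator {a..b} x *\<^sub>R v x)"
proof -
  have "(\<lambda>x. complex_of_real (indicator {a..b} x)) \<in> L2"
    by (rule L2I_bounded[of _ 1 "max \<bar>a\<bar> \<bar>b\<bar>"]) (auto simp: indicator_def)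
  from L2_mult_integrable[OF this v] show ?thesis by (simp add: scaleR_conv_of_real)
qed

lemma L2_bound:
  assumes f: "f \<in> L2" and [measurable]: "g \<in> borel_measurable borel" and le: "\<And>x. cmod (g x) \<le> C * cmod (f x)"
  shows "g \<in> L2"
proof -
  have "integrable lborel (\<lambda>x. (cmod (g x))\<^sup>2)"
  proof (rule Bochner_Integration.integrable_bound)
    show "integrable lborel (\<lambda>x. C\<^sup>2 * (cmod (f x))\<^sup>2)"
      using f by (intro integrable_mult_right) (simp add: L2_def)
    have "norm ((cmod (g x))\<^sup>2) \<le> norm (C\<^sup>2 * (cmod (f x))\<^sup>2)" for x
      using power_mono[OF le[of x], of 2] by (simp add: power_mult_distrib)
    then show "AE x in lborel. norm ((cmod (g x))\<^sup>2) \<le> norm (C\<^sup>2 * (cmod (f x))\<^sup>2)" by simp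
  qed measurable
  then show ?thesis by (simp add: L2_def)
qed

lemma integral_vderiv_ctest:
  assumes "ctest f"
  shows "(LINT x|lborel. vderiv f x) = 0"
proof -
  obtain R where R: "\<And>x. \<bar>x\<bar> > R \<Longrightarrow> f x = 0" using assms by (auto simp: ctest_def)
  obtain R' where R': "\<And>x. \<bar>x\<bar> > R' \<Longrightarrow> vderiv f x = 0" using ctest_vderiv[OF assms] by (auto simp: ctest_def)
  define b where "b = \<bar>R\<bar> + \<bar>R'\<bar> + 1"
  have s: "csmooth f" using assms by (simp add: ctest_def)
  have "(LINT x|lborel. indicator {-b..b} x *\<^sub>R vderiv f x) = f b - f (- b)"
    by (rule integral_FTC_Icc)
       (use csmooth_deriv(1)[OF s] csmooth_continuous_on[OF csmooth_deriv(2)[OF s]] in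
         \<open>auto intro: has_vector_derivative_at_within simp: b_def\<close>)
  moreover have "indicator {-b..b} x *\<^sub>R vderiv f x = vderiv f x" for x
    using R'[of x] by (cases "x \<in> {-b..b}") (auto simp: b_def)
  moreover have "f b = 0" "f (- b) = 0" by (auto intro!: R simp: b_def)
  ultimately show ?thesis by simp
qed

section \<open>The choice of the two solutions\<close>

lemma cubic_roots:
  fixes a b d :: complex
  obtains s1 s2 s3 where "\<And>s. s^3 + a * s^2 + b * s + d = (s - s1) * (s - s2) * (s - s3)"
proof -
  define p where "p = [:d, b, a, 1:]"
  have p: "p \<noteq> 0" "degree p = 3" "lead_coeff p = 1" by (simp_all add: p_def)
  obtain A where A: "size A = 3" "p = (\<Prod>x\<in>#A. [:-x, 1:])"
    using alg_closed_imp_factorization[OF p(1)] p by auto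
  obtain xs where xs: "mset xs = A" using ex_mset by blast
  then have "length xs = 3" using A(1) by (metis size_mset)
  then obtain s1 s2 s3 where "xs = [s1, s2, s3]"
    by (auto simp: numeral_3_eq_3 length_Suc_conv)
  then have "p = [:-s1, 1:] * ([:-s2, 1:] * [:-s3, 1:])" using A(2) xs by auto
  then have 1: "poly p s = (s - s1) * (s - s2) * (s - s3)" for s by (simp only: poly_mult) simp
  have 2: "poly p s = s^3 + a * s^2 + b * s + d" for s by (simp add: p_def eval_nat_numeral algebra_simps)
  show ?thesis by (rule that[of s1 s2 s3]) (simp only: 1 flip: 2)
qed

text \<open>The sign change \<open>(l, s) \<mapsto> (- l, - s)\<close> corresponds to the reflection \<open>x \<mapsto> - x\<close>. A root is good if its
  solution does not vanish to leading order at \<open>\<infinity>\<close>. If all roots are good for both signs, any two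
  different ones will do. Otherwise \<open>l\<close> is one of \<open>\<plusminus> L\<close> below and the roots for \<open>L\<close> are \<open>- t\<close>,
  \<open>- (t + R)\<close> and \<open>u\<close>, of which only the first is not good.\<close>

lemma exists_good_roots:
  fixes R V :: real and l :: complex
  assumes R: "0 < R" "R < V" and l: "l \<noteq> 0"
  defines "P \<equiv> \<lambda>l s. s^3 + l * s^2 - of_real (R\<^sup>2) * s - l * of_real (V\<^sup>2) :: complex"
    and "good \<equiv> \<lambda>s. of_real (3 * V\<^sup>2) - s\<^sup>2 + s * of_real R - of_real (R\<^sup>2) \<noteq> (0 :: complex)"
  obtains l' s1 s3 where "l' = l \<or> l' = - l" "P l' s1 = 0" "P l' s3 = 0" "s1 \<noteq> s3" "good s1" "good s3"
    "Re (s1 + s3 + l') \<ge> 0"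
proof (cases "\<exists>l' s. (l' = l \<or> l' = - l) \<and> P l' s = 0 \<and> \<not> good s")
  case False
  note that' = that
  have neg: "P (- l) (- s) = - P l s" for s by (simp add: P_def algebra_simps)
  have good: "good s" "good (- s)" if "P l s = 0" for s
  proof -
    show "good s" using False that by blast
    have "P (- l) (- s) = 0" using that neg by simp
    then show "good (- s)" using False by blast
  qed
  obtain s1 s2 s3 where f: "\<And>s. s^3 + l * s^2 + (- of_real (R\<^sup>2)) * s + (- l * of_real (V\<^sup>2)) = (s - s1) * (s - s2) * (s - s3)"
    by (rule cubic_roots[of l "- of_real (R\<^sup>2)" "- l * of_real (V\<^sup>2)"]) blast
  have P: "P l s = (s - s1) * (s - s2) * (s - s3)" for s
    using f[of s] by (simp add: P_def)
  have r: "P l s1 = 0" "P l s2 = 0" "P l s3 = 0" by (simp_all add: P)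
  have e3: "s1 * s2 * s3 = l * of_real (V\<^sup>2)" using f[of 0] by simp
  have e1: "s1 + s2 + s3 = - l" and e2: "s1 * s2 + s1 * s3 + s2 * s3 = - of_real (R\<^sup>2)"
  proof -
    \<comment> \<open>Vieta's formulas are read off from the values of the cubic at
      \<open>1\<close>, \<open>-1\<close> and, through \<open>e3\<close>, at
      \<open>0\<close>.\<close>
    define x y where "x = complex_of_real (R\<^sup>2)" and "y = l * complex_of_real (V\<^sup>2)"
    have f1: "1 + l - x - y = (1 - s1) * (1 - s2) * (1 - s3)"
      and f2: "- 1 + l + x - y = (- 1 - s1) * (- 1 - s2) * (- 1 - s3)"
      using f[of 1] f[of "-1"] by (simp_all add: x_def y_def)
    have "2 * l - 2 * y = (1 - s1) * (1 - s2) * (1 - s3) + (- 1 - s1) * (- 1 - s2) * (- 1 - s3)"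
      unfolding f1[symmetric] f2[symmetric] by simp
    also have "\<dots> = 2 * (- (s1 + s2 + s3)) - 2 * y"
      unfolding y_def e3[symmetric] by (simp add: algebra_simps)
    finally have "2 * l = 2 * (- (s1 + s2 + s3))" by (metis diff_add_cancel)
    then have "l = - (s1 + s2 + s3)" by (rule mult_left_cancel[THEN iffD1, rotated]) simp
    then show "s1 + s2 + s3 = - l" by simp
    have "2 - 2 * x = (1 - s1) * (1 - s2) * (1 - s3) - (- 1 - s1) * (- 1 - s2) * (- 1 - s3)"
      unfolding f1[symmetric] f2[symmetric] by simp
    then have "2 * ((s1 * s2 + s1 * s3 + s2 * s3) + x) = 0"
      by (simp add: algebra_simps)
    then have "s1 * s2 + s1 * s3 + s2 * s3 = - x"
      by (simp only: mult_eq_0_iff eq_neg_iff_add_eq_0) simp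
    then show "s1 * s2 + s1 * s3 + s2 * s3 = - of_real (R\<^sup>2)" by (simp add: x_def)
  qed
  \<comment> \<open>A triple root would be \<open>- l / 3\<close>; comparing the other two symmetric
    functions then gives \<open>9 * V\<^sup>2 = R\<^sup>2\<close>, against
    \<open>R < V\<close>.\<close>
  have ne: "s1 \<noteq> s2 \<or> s2 \<noteq> s3"
  proof (rule ccontr)
    assume "\<not> (s1 \<noteq> s2 \<or> s2 \<noteq> s3)"
    then have eq: "s2 = s1" "s3 = s1" by auto
    have l3: "l = - 3 * s1" using e1 eq by (simp add: algebra_simps)
    have s0: "s1 \<noteq> 0" using l l3 by auto
    have "s1 * (s1 * s1) = s1 * (- 3 * of_real (V\<^sup>2))" using e3 l3 eq by (simp add: algebra_simps)
    then have "s1 * s1 = - 3 * of_real (V\<^sup>2)" using s0 by (metis mult_left_cancel)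
    moreover have "3 * (s1 * s1) = - of_real (R\<^sup>2)" using e2 eq by simp
    ultimately have "of_real (9 * V\<^sup>2) = complex_of_real (R\<^sup>2)" by simp
    then have "9 * V\<^sup>2 = R\<^sup>2" using of_real_eq_iff by blast
    moreover have "R\<^sup>2 < V\<^sup>2" using R by (intro power_strict_mono) auto
    ultimately show False using zero_le_power2[of V] by linarith
  qed
  \<comment> \<open>As the roots sum to \<open>- l\<close>, the quantity whose real part matters is
    \<open>- t\<close> for the omitted root \<open>t\<close>. If its sign is wrong, passing to
    \<open>- l\<close> and the negated roots reverses it.\<close>
  have fin: thesis if "P l p = 0" "P l q = 0" "p \<noteq> q" "p + q + t = - l" for p q t
  proof (cases "Re t \<le> 0")
    case True
    have "p + q + l = (p + q + t) + l - t" by simp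
    also have "\<dots> = - t" unfolding that(4) by simp
    finally have "p + q + l = - t" .
    then have "Re (p + q + l) \<ge> 0" using True by simp
    then show thesis using that good by (intro that'[of l p q]) auto
  next
    case False
    have "- p + - q + - l = - (p + q + t) - l + t" by simp
    also have "\<dots> = t" unfolding that(4) by simp
    finally have "- p + - q + - l = t" .
    then have "Re (- p + - q + - l) \<ge> 0" using False by simp
    then show thesis using that good neg by (intro that'[of "- l" "- p" "- q"]) auto
  qed
  show thesis
  proof (cases "s1 = s2")
    case False
    then show thesis using fin[of s1 s2 s3] r e1 by blast
  next
    case True
    then show thesis using fin[of s2 s3 s1] r e1 ne by (simp add: algebra_simps)
  qed
next
  case True
  then obtain l' s where l': "l' = l \<or> l' = - l" and Ps: "P l' s = 0" and bad: "\<not> good s" by blast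
  \<comment> \<open>A root is bad iff it solves
    \<open>s\<^sup>2 - R * s + R\<^sup>2 - 3 * V\<^sup>2 = 0\<close>. The two solutions are
    \<open>t + R\<close> and \<open>- t\<close>.\<close>
  define t where "t = (sqrt (12 * V\<^sup>2 - 3 * R\<^sup>2) - R) / 2"
  have RV: "R\<^sup>2 < V\<^sup>2" using R by (intro power_strict_mono) auto
  have t2: "t\<^sup>2 + t * R + R\<^sup>2 = 3 * V\<^sup>2"
  proof -
    have "2 * t + R = sqrt (12 * V\<^sup>2 - 3 * R\<^sup>2)" by (simp add: t_def field_simps)
    moreover have "0 \<le> 12 * V\<^sup>2 - 3 * R\<^sup>2" using RV zero_le_power2[of V] by linarith
    ultimately have "(2 * t + R)\<^sup>2 = 12 * V\<^sup>2 - 3 * R\<^sup>2" using real_sqrt_pow2 by metis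
    then show ?thesis by (simp add: power2_eq_square algebra_simps)
  qed
  have tR: "t > R"
  proof -
    have "(3 * R)\<^sup>2 = 9 * R\<^sup>2" by (simp add: power_mult_distrib)
    with RV have "(3 * R)\<^sup>2 < 12 * V\<^sup>2 - 3 * R\<^sup>2" by linarith
    then have "3 * R < sqrt (12 * V\<^sup>2 - 3 * R\<^sup>2)" by (rule real_less_rsqrt)
    then show ?thesis by (simp add: t_def)
  qed
  have t0: "t > 0" "2 * t + R > 0" using tR R by auto
  \<comment> \<open>\<open>L\<close> is the value of \<open>l\<close> for which \<open>- t\<close>
    solves the cubic; \<open>b1\<close> and \<open>b2\<close> show that \<open>- (t + R)\<close>
    then does so too. The third root \<open>u\<close> follows from the product of the roots,
    \<open>t * (t + R) * u = L * V\<^sup>2\<close>.\<close>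
  define L where "L = 3 * t * (t + R) / (2 * t + R)"
  define u where "u = 3 * V\<^sup>2 / (2 * t + R)"
  have Lt: "L * (2 * t + R) = 3 * t * (t + R)" and ut: "u * (2 * t + R) = 3 * V\<^sup>2"
    using t0 by (simp_all add: L_def u_def)
  have a1: "3 * ((t + R)\<^sup>2 - V\<^sup>2) = (2 * t + R) * (t + 2 * R)"
    using t2 by (simp add: power2_eq_square algebra_simps)
  have a2: "3 * (t\<^sup>2 - V\<^sup>2) = (2 * t + R) * (t - R)"
    using t2 by (simp add: power2_eq_square algebra_simps)
  have b1: "L * ((t + R)\<^sup>2 - V\<^sup>2) = t * (t + R) * (t + 2 * R)"
  proof -
    have "3 * (L * ((t + R)\<^sup>2 - V\<^sup>2)) = L * (3 * ((t + R)\<^sup>2 - V\<^sup>2))" by (simp only: mult_ac)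
    also have "\<dots> = L * (2 * t + R) * (t + 2 * R)" unfolding a1 by (simp only: mult_ac)
    also have "\<dots> = 3 * (t * (t + R) * (t + 2 * R))" unfolding Lt by (simp only: mult_ac)
    finally show ?thesis by simp
  qed
  have b2: "L * (t\<^sup>2 - V\<^sup>2) = t * (t + R) * (t - R)"
  proof -
    have "3 * (L * (t\<^sup>2 - V\<^sup>2)) = L * (3 * (t\<^sup>2 - V\<^sup>2))" by (simp only: mult_ac)
    also have "\<dots> = L * (2 * t + R) * (t - R)" unfolding a2 by (simp only: mult_ac)
    also have "\<dots> = 3 * (t * (t + R) * (t - R))" unfolding Lt by (simp only: mult_ac)
    finally show ?thesis by simp
  qed
  have tu: "(2 * t + R) * (u + L - (2 * t + R)) = 0"
  proof -
    have "(2 * t + R) * (u + L - (2 * t + R)) = u * (2 * t + R) + L * (2 * t + R) - (2 * t + R)\<^sup>2"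
      by (simp add: power2_eq_square algebra_simps)
    also have "\<dots> = 0" unfolding ut Lt t2[symmetric] by (simp add: power2_eq_square algebra_simps)
    finally show ?thesis .
  qed
  then have uL: "u + L = 2 * t + R" using t0 by simp
  have PL: "P (of_real L) (of_real (- (t + R))) = 0"
  proof -
    have "(- (t + R))^3 + L * (- (t + R))\<^sup>2 - R\<^sup>2 * (- (t + R)) - L * V\<^sup>2
       = L * ((t + R)\<^sup>2 - V\<^sup>2) - t * (t + R) * (t + 2 * R)"
      by (simp add: power2_eq_square power3_eq_cube algebra_simps)
    also have "\<dots> = 0" unfolding b1 by simp
    finally have "complex_of_real ((- (t + R))^3 + L * (- (t + R))\<^sup>2 - R\<^sup>2 * (- (t + R)) - L * V\<^sup>2) = 0" by simp
    then show ?thesis unfolding P_def by (simp only: of_real_add of_real_diff of_real_mult of_real_power)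
  qed
  have Pu: "P (of_real L) (of_real u) = 0"
  proof -
    have LV: "L * V\<^sup>2 = u * (t * (t + R))"
      using t0 by (simp add: L_def u_def)
    have "u^3 + L * u\<^sup>2 - R\<^sup>2 * u - L * V\<^sup>2 = u * (u * (u + L) - R\<^sup>2 - t * (t + R))"
      unfolding LV by (simp add: power2_eq_square power3_eq_cube algebra_simps)
    also have "u * (u + L) - R\<^sup>2 - t * (t + R) = 0"
      unfolding uL ut t2[symmetric] by (simp add: power2_eq_square algebra_simps)
    finally have "complex_of_real (u^3 + L * u\<^sup>2 - R\<^sup>2 * u - L * V\<^sup>2) = 0" by simp
    then show ?thesis unfolding P_def by (simp only: of_real_add of_real_diff of_real_mult of_real_power)
  qed
  have goodr: "good (of_real x) \<longleftrightarrow> (x - (t + R)) * (x + t) \<noteq> 0" for x :: real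
  proof -
    have "of_real (3 * V\<^sup>2) - (of_real x)\<^sup>2 + of_real x * of_real R - of_real (R\<^sup>2) = complex_of_real (3 * V\<^sup>2 - x\<^sup>2 + x * R - R\<^sup>2)"
      by simp
    also have "3 * V\<^sup>2 - x\<^sup>2 + x * R - R\<^sup>2 = - ((x - (t + R)) * (x + t))"
      unfolding t2[symmetric] by (simp add: power2_eq_square algebra_simps)
    finally show ?thesis unfolding good_def by (simp only: of_real_eq_0_iff neg_equal_0_iff_equal)
  qed
  have u0: "u > 0" using t0 R by (simp add: u_def)
  have g1: "good (of_real (- (t + R)))" unfolding goodr using t0 R by auto
  have g3: "good (of_real u)"
  proof -
    have "u \<noteq> t + R"
    proof
      assume "u = t + R"
      then have "(t + R) * (2 * t + R) = t\<^sup>2 + t * R + R\<^sup>2" using ut t2 by simp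
      then have "t * (t + 2 * R) = 0" by (simp add: power2_eq_square algebra_simps)
      then show False using t0 R by auto
    qed
    then show ?thesis unfolding goodr using u0 t0 by auto
  qed
  have "s = of_real (t + R) \<or> s = of_real (- t)"
  proof -
    have "(s - of_real (t + R)) * (s - of_real (- t)) = s\<^sup>2 - s * of_real R - of_real (t\<^sup>2 + t * R)"
      by (simp add: power2_eq_square algebra_simps)
    also have "t\<^sup>2 + t * R = 3 * V\<^sup>2 - R\<^sup>2" using t2 by simp
    also have "s\<^sup>2 - s * of_real R - of_real (3 * V\<^sup>2 - R\<^sup>2) = 0"
      using bad by (simp add: good_def algebra_simps)
    finally show ?thesis by (simp only: mult_eq_0_iff right_minus_eq)
  qed
  \<comment> \<open>The cubic is linear in \<open>l'\<close>, so a bad root determines it: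
    \<open>t + R\<close> gives \<open>- L\<close> and \<open>- t\<close> gives \<open>L\<close>. In
    both cases \<open>L\<close> itself is \<open>l\<close> or \<open>- l\<close>, and the pair of
    roots for \<open>L\<close> can be used.\<close>
  then have "l' = of_real L \<or> l' = - of_real L"
  proof
    assume s: "s = of_real (t + R)"
    have "l' * of_real ((t + R)\<^sup>2 - V\<^sup>2) = - of_real (t * (t + R) * (t + 2 * R))"
      using Ps unfolding s P_def by (simp add: power2_eq_square power3_eq_cube algebra_simps)
    also have "\<dots> = - of_real L * of_real ((t + R)\<^sup>2 - V\<^sup>2)" unfolding b1[symmetric] by simp
    finally have "l' * of_real ((t + R)\<^sup>2 - V\<^sup>2) = - of_real L * of_real ((t + R)\<^sup>2 - V\<^sup>2)" .
    moreover have "(t + R)\<^sup>2 - V\<^sup>2 \<noteq> 0" using a1 t0 R by auto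
    ultimately show ?thesis by (metis mult_right_cancel of_real_eq_0_iff)
  next
    assume s: "s = of_real (- t)"
    have "l' * of_real (t\<^sup>2 - V\<^sup>2) = of_real (t * (t + R) * (t - R))"
      using Ps unfolding s P_def by (simp add: power2_eq_square power3_eq_cube algebra_simps)
    also have "\<dots> = of_real L * of_real (t\<^sup>2 - V\<^sup>2)" unfolding b2[symmetric] by simp
    finally have "l' * of_real (t\<^sup>2 - V\<^sup>2) = of_real L * of_real (t\<^sup>2 - V\<^sup>2)" .
    moreover have "t\<^sup>2 - V\<^sup>2 \<noteq> 0" using a2 t0 tR by auto
    ultimately show ?thesis by (metis mult_right_cancel of_real_eq_0_iff)
  qed
  then have "of_real L = l \<or> of_real L = - l" using l' by auto
  moreover have ne: "complex_of_real (- (t + R)) \<noteq> of_real u" unfolding of_real_eq_iff using t0 R u0 by auto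
  \<comment> \<open>By \<open>uL\<close> this sum is \<open>t\<close>, the negative of the omitted
    bad root.\<close>
  moreover have "Re (of_real (- (t + R)) + of_real u + of_real L) \<ge> 0" using uL t0 by simp
  ultimately show thesis by (intro that[OF _ PL Pu ne g1 g3])
qed

section \<open>Reflection and vanishing on the whole line\<close>

context solitary_wave
begin

lemma w_minus: "w (- x) = w x"
  using profile by (simp add: solitary_wave_profile_def w_def)

text \<open>Since \<open>w\<close> is even, reflection changes the sign of the odd-order terms of
  \<open>dual_op\<close> but not of those with the factor \<open>l\<close>; up to an overall sign
  this amounts to replacing \<open>l\<close> by \<open>- l\<close>.\<close>

lemma weak_sol_reflect:
  assumes "weak_sol l v"
  shows "weak_sol (- l) (\<lambda>x. v (- x))"
  unfolding weak_sol_def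
proof (intro conjI allI impI)
  have v: "v \<in> L2" and weak: "\<And>\<psi>. ctest \<psi> \<Longrightarrow> (LINT x|lborel. v x * dual_op l \<psi> x) = 0"
    using assms by (auto simp: weak_sol_def)
  have [measurable]: "v \<in> borel_measurable borel" using v by (rule L2_measurable)
  have "integrable lborel (\<lambda>x. (cmod (v (0 + - 1 * x)))\<^sup>2)"
    using v by (intro lborel_integrable_real_affine[of "\<lambda>x. (cmod (v x))\<^sup>2"]) (auto simp: L2_def)
  then show "(\<lambda>x. v (- x)) \<in> L2" by (simp add: L2_def)
  fix \<phi> assume \<phi>: "ctest \<phi>"
  have s: "csmooth \<phi>" using \<phi> by (simp add: ctest_def)
  have t: "ctest (\<lambda>x. \<phi> (- 1 * x))"
    using \<phi> csmooth_scale[OF s, of "- 1"] unfolding ctest_def by (metis abs_minus_cancel mult_minus1)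
  have s3: "vderiv (\<lambda>x. \<phi> (- 1 * x)) = (\<lambda>x. of_real (- 1) * vderiv \<phi> (- 1 * x))"
     "vderiv (\<lambda>x. of_real (- 1) * vderiv \<phi> (- 1 * x)) = (\<lambda>x. vderiv (vderiv \<phi>) (- 1 * x))"
     "vderiv (\<lambda>x. vderiv (vderiv \<phi>) (- 1 * x)) = (\<lambda>x. of_real (- 1) * vderiv (vderiv (vderiv \<phi>)) (- 1 * x))"
    using vderiv_scale[OF s, of "- 1"] vderiv_scale[OF csmooth_deriv(2)[OF s], of "- 1"]
      vderiv_scale[OF csmooth_deriv(2)[OF csmooth_deriv(2)[OF s]], of "- 1"]
      vderiv_cmult[OF csmooth_scale[OF csmooth_deriv(2)[OF s]], of "of_real (- 1)" "- 1"]
    by simp_all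
  have d: "dual_op l (\<lambda>x. \<phi> (- 1 * x)) x = - dual_op (- l) \<phi> (- x)" for x
    unfolding dual_op_def s3 by (simp add: w_minus algebra_simps)
  have "(LINT x|lborel. v (- x) * dual_op (- l) \<phi> x) = (LINT x|lborel. v x * dual_op (- l) \<phi> (- x))"
    by (subst lborel_integral_real_affine[of "- 1" _ 0]) simp_all
  also have "\<dots> = - (LINT x|lborel. v x * dual_op l (\<lambda>x. \<phi> (- 1 * x)) x)"
    unfolding d by simp
  also have "\<dots> = 0" using weak[OF t] by simp
  finally show "(LINT x|lborel. v (- x) * dual_op (- l) \<phi> x) = 0" .
qed

text \<open>On a short interval to the left of \<open>X\<close> the Volterra inequality bounds the
  \<open>L\<^sup>1\<close> norm of \<open>v\<close> by half of itself. The length \<delta> depends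
  only on \<open>l\<close>, \<open>c\<close> and the lower bound of \<open>w\<close>, not on
  \<open>X\<close>, so that the step can be iterated.\<close>

lemma weak_sol_vanish_step:
  "\<exists>\<delta>>0. \<forall>X. (AE x in lborel. X < x \<longrightarrow> v x = 0) \<longrightarrow> (AE x in lborel. X - \<delta> < x \<longrightarrow> v x = 0)"
  if v: "weak_sol l v"
proof -
  obtain m where m: "m > 0" "\<And>x. m \<le> w x" by (rule w_bounded_below) auto
  define M where "M = 2 * cmod l + 7 * c"
  have M: "M > 0" using c_pos by (simp add: M_def add_nonneg_pos)
  \<comment> \<open>The bound 1 is the length allowed in the Volterra inequality; the other one
    makes the contraction factor \<open>\<delta> * M / m\<close> at most
    \<open>1 / 2\<close>.\<close>
  define \<delta> where "\<delta> = min 1 (m / (2 * M))"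
  have \<delta>: "\<delta> > 0" "\<delta> \<le> 1" "\<delta> * M / m \<le> 1 / 2"
    using m(1) M by (auto simp: \<delta>_def min_def field_simps)
  have "AE x in lborel. X - \<delta> < x \<longrightarrow> v x = 0" if vz: "AE x in lborel. X < x \<longrightarrow> v x = 0" for X
  proof -
    let ?a = "X - \<delta>"
    define h where "h = (\<lambda>x. indicator {?a..X} x *\<^sub>R v x)"
    define N where "N = (LINT x|lborel. cmod (h x))"
    have hi: "integrable lborel h" unfolding h_def using v by (intro indicator_L2_integrable) (simp add: weak_sol_def)
    have ev: "AE x in lborel. ?a < x \<longrightarrow> cmod (h x * \<omega> x) \<le> M * N"
      using weak_sol_volterra[OF v vz, of ?a] \<delta> unfolding h_def N_def M_def by simp
    have N0: "N \<ge> 0" unfolding N_def by (rule integral_nonneg_AE) simp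
    have "N \<le> (LINT x|lborel. M * N / m * indicator {?a..X} x)"
      unfolding N_def
    proof (rule integral_mono_AE)
      show "AE x in lborel. cmod (h x) \<le> M * (LINT x|lborel. cmod (h x)) / m * indicator {?a..X} x"
        using ev AE_lborel_singleton[of ?a]
      proof eventually_elim
        case (elim x)
        show ?case
        proof (cases "x \<in> {?a..X}")
          case True
          have "cmod (h x) * m \<le> cmod (h x) * w x" by (intro mult_left_mono m) auto
          also have "\<dots> = cmod (h x * \<omega> x)" using w_pos[of x] by (simp add: norm_mult)
          also have "\<dots> \<le> M * N" using elim True by auto
          finally show ?thesis using m(1) True by (simp add: N_def field_simps)
        next
          case False
          then show ?thesis by (simp add: h_def)
        qed
      qed
      show "integrable lborel (\<lambda>x. M * (LINT x|lborel. cmod (h x)) / m * indicator {?a..X} x)"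
        by (intro integrable_mult_right integrable_real_indicator) (auto simp: emeasure_lborel_Icc_eq)
    qed (use hi in auto)
    also have "\<dots> = \<delta> * M / m * N" using \<delta> by simp
    also have "\<dots> \<le> 1 / 2 * N" using \<delta>(3) N0 by (rule mult_right_mono)
    finally have "N = 0" using N0 by simp
    then have "AE x in lborel. cmod (h x) = 0"
      using hi unfolding N_def by (subst (asm) integral_nonneg_eq_0_iff_AE) auto
    then show ?thesis
      using vz AE_lborel_singleton[of X]
      by eventually_elim (auto simp: h_def indicator_def split: if_splits)
  qed
  with \<delta>(1) show ?thesis by blast
qed

lemma weak_sol_eq_0_if_near_top:
  assumes v: "weak_sol l v" and X: "AE x in lborel. X < x \<longrightarrow> v x = 0"
  shows "AE x in lborel. v x = 0"
proof -
  obtain \<delta> where \<delta>: "\<delta> > 0" "\<And>X. (AE x in lborel. X < x \<longrightarrow> v x = 0) \<Longrightarrow> (AE x in lborel. X - \<delta> < x \<longrightarrow> v x = 0)"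
    using weak_sol_vanish_step[OF v] by blast
  have "AE x in lborel. X - real n * \<delta> < x \<longrightarrow> v x = 0" for n
  proof (induction n)
    case (Suc n)
    from \<delta>(2)[OF this] show ?case by (simp add: algebra_simps)
  qed (use X in simp)
  then have "AE x in lborel. \<forall>n. X - real n * \<delta> < x \<longrightarrow> v x = 0"
    unfolding AE_all_countable by blast
  then show ?thesis
  proof eventually_elim
    case (elim x)
    obtain n where "(X - x) / \<delta> < real n" using reals_Archimedean2 by blast
    then show ?case using elim[rule_format, of n] \<delta>(1) by (simp add: field_simps)
  qed
qed

text \<open>The selection of roots may call for \<open>- l\<close> in place of \<open>l\<close>;
  then the argument at \<open>+\<infinity>\<close> is applied to the reflected function, which
  amounts to working at the other end.\<close>

lemma weak_sol_eq_0:
  assumes v: "weak_sol l v" and l: "l \<noteq> 0"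
  shows "AE x in lborel. v x = 0"
proof -
  have cpP: "char_poly K V l s = s^3 + l * s^2 - of_real (r0\<^sup>2) * s - l * of_real (W\<^sup>2)" for l s
    unfolding char_poly_def V_def r0_sq by simp
  obtain l' s1 s3 where l': "l' = l \<or> l' = - l" and cp: "char_poly K V l' s1 = 0" "char_poly K V l' s3 = 0"
    and ne: "s1 \<noteq> s3" and good: "of_real (3 * W\<^sup>2) - s1\<^sup>2 + s1 * of_real r0 - of_real (r0\<^sup>2) \<noteq> (0 :: complex)"
      "of_real (3 * W\<^sup>2) - s3\<^sup>2 + s3 * of_real r0 - of_real (r0\<^sup>2) \<noteq> (0 :: complex)"
    and re: "Re (s1 + s3 + l') \<ge> 0"
    unfolding cpP using exists_good_roots[OF r0_pos r0_less l] by blast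
  have l'0: "l' \<noteq> 0" using l l' by auto
  have Q: "Qinf l' s \<noteq> 0"
    if cps: "char_poly K V l' s = 0" and gd: "of_real (3 * W\<^sup>2) - s\<^sup>2 + s * of_real r0 - of_real (r0\<^sup>2) \<noteq> (0 :: complex)" for s
  proof
    assume "Qinf l' s = 0"
    then have "s * V\<^sup>2 * (s - of_real r0)\<^sup>2 * (3 * V\<^sup>2 - s\<^sup>2 + s * of_real r0 - (of_real r0)\<^sup>2) = 0"
      using Qinf_eq[OF cps] by simp
    moreover have "3 * V\<^sup>2 - s\<^sup>2 + s * of_real r0 - (of_real r0)\<^sup>2 \<noteq> 0" using gd by (simp add: V_def)
    \<comment> \<open>Besides the factor excluded by goodness, the limit could vanish only through
      \<open>s = 0\<close> or \<open>s = r0\<close>. Neither solves the characteristic equation when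
      \<open>l' \<noteq> 0\<close>, as they give \<open>l' * W\<^sup>2 = 0\<close> and
      \<open>l' * (r0\<^sup>2 - W\<^sup>2) = 0\<close>.\<close>
    ultimately consider "s = 0" | "s = of_real r0" using V_nonzero by auto
    then show False
    proof cases
      case 1
      then have "l' * of_real (W\<^sup>2) = 0" using cps by (simp add: cpP)
      then show False using l'0 W_pos by (simp only: mult_eq_0_iff of_real_eq_0_iff power_eq_0_iff) simp
    next
      case 2
      have "l' * of_real (r0\<^sup>2 - W\<^sup>2) = (of_real r0)^3 + l' * (of_real r0)\<^sup>2 - of_real (r0\<^sup>2) * of_real r0 - l' * of_real (W\<^sup>2)"
        by (simp add: power3_eq_cube power2_eq_square right_diff_distrib)
      also have "\<dots> = 0" using cps unfolding 2 cpP .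
      finally have "r0\<^sup>2 = W\<^sup>2" using l'0 by (simp only: mult_eq_0_iff of_real_eq_0_iff) simp
      moreover have "r0\<^sup>2 < W\<^sup>2" using r0_less r0_pos by (intro power_strict_mono) auto
      ultimately show False by simp
    qed
  qed
  have main: "AE x in lborel. u x = 0" if u: "weak_sol l' u" for u
  proof -
    obtain X where "AE x in lborel. X < x \<longrightarrow> u x = 0"
      by (rule weak_sol_eq_0_near_top[OF u cp ne Q[OF cp(1) good(1)] Q[OF cp(2) good(2)] re])
    then show ?thesis by (rule weak_sol_eq_0_if_near_top[OF u])
  qed
  show ?thesis
  proof (cases "l' = l")
    case True
    then show ?thesis using main v by blast
  next
    case False
    then have "AE x in lborel. v (- x) = 0" using main[of "\<lambda>x. v (- x)"] weak_sol_reflect[OF v] l' by simp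
    then have "AE x in distr lborel borel uminus. v (- x) = 0" unfolding lborel_distr_uminus .
    moreover have [measurable]: "v \<in> borel_measurable borel"
      using v by (auto simp: weak_sol_def intro: L2_measurable)
    ultimately show ?thesis by (subst (asm) AE_distr_iff) auto
  qed
qed

end

section \<open>The point spectrum\<close>

lemma ctest_of_real:
  assumes "f \<in> test_functions"
  shows "ctest (\<lambda>x. complex_of_real (f x))"
proof -
  have s: "csmooth (\<lambda>x. complex_of_real (f x))"
    using assms by (simp add: test_functions_def csmooth_of_real_iff)
  have "bounded (closure {x. f x \<noteq> 0})"
    using assms by (auto simp: test_functions_def intro: compact_imp_bounded)
  then obtain R where R: "\<And>x. x \<in> closure {x. f x \<noteq> 0} \<Longrightarrow> norm x \<le> R"
    by (auto simp: bounded_iff)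
  have "complex_of_real (f x) = 0" if "\<bar>x\<bar> > R" for x
    using R[of x] that closure_subset[of "{x. f x \<noteq> 0}"] by auto
  with s show ?thesis unfolding ctest_def by blast
qed

lemma test_function_of_ctest:
  assumes "ctest \<phi>" "\<And>x. \<phi> x = of_real (f x)"
  shows "f \<in> test_functions"
proof -
  obtain R where R: "\<And>x. \<bar>x\<bar> > R \<Longrightarrow> \<phi> x = 0" and s: "csmooth \<phi>" using assms(1) by (auto simp: ctest_def)
  have "\<phi> = (\<lambda>x. of_real (f x))" using assms(2) by auto
  then have "smooth f" using s by (simp add: csmooth_of_real_iff)
  moreover have "{x. f x \<noteq> 0} \<subseteq> {-R..R}"
  proof
    fix x assume "x \<in> {x. f x \<noteq> 0}"
    then have "\<not> R < \<bar>x\<bar>" using R[of x] assms(2)[of x] by auto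
    then show "x \<in> {-R..R}" by auto
  qed
  then have "bounded {x. f x \<noteq> 0}" using bounded_subset bounded_closed_interval by blast
  then have "compact (closure {x. f x \<noteq> 0})" by (simp add: compact_closure)
  ultimately show ?thesis by (simp add: test_functions_def)
qed

lemma ctest_split:
  assumes "ctest \<phi>"
  obtains f g where "f \<in> test_functions" "g \<in> test_functions"
    "\<phi> = (\<lambda>x. of_real (f x) + \<i> * of_real (g x))"
proof (rule that)
  have s: "csmooth \<phi>" using assms by (simp add: ctest_def)
  obtain R where R: "\<And>x. \<bar>x\<bar> > R \<Longrightarrow> \<phi> x = 0" using assms by (auto simp: ctest_def)
  have t: "ctest (\<lambda>x. of_real (Re (\<phi> x)))" "ctest (\<lambda>x. of_real (Im (\<phi> x)))"
    unfolding ctest_def using R by (intro conjI csmooth_of_Re csmooth_of_Im s exI[of _ R]; simp)+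
  show "(\<lambda>x. Re (\<phi> x)) \<in> test_functions" "(\<lambda>x. Im (\<phi> x)) \<in> test_functions"
    using test_function_of_ctest[OF t(1) refl] test_function_of_ctest[OF t(2) refl] .
  show "\<phi> = (\<lambda>x. of_real (Re (\<phi> x)) + \<i> * of_real (Im (\<phi> x)))" by (rule ext) (rule complex_eq)
qed

section \<open>The graph of the linearized operator in weak form\<close>

context solitary_wave
begin

lemma dual_op_of_real:
  assumes "f \<in> test_functions"
  shows "dual_op l (\<lambda>x. of_real (f x)) x = l * (of_real (f x) - of_real (deriv (deriv f) x))
     + (4 * \<omega> x - 3 * of_real c) * of_real (deriv f x) - \<omega> x * of_real (deriv (deriv (deriv f)) x)"
proof -
  have s: "csmooth (\<lambda>x. complex_of_real (f x))" using ctest_of_real[OF assms] by (simp add: ctest_def)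
  note s1 = csmooth_of_real_deriv(3)[OF s] and d1 = csmooth_of_real_deriv(2)[OF s]
  note s2 = csmooth_of_real_deriv(3)[OF s1] and d2 = csmooth_of_real_deriv(2)[OF s1]
  note d3 = csmooth_of_real_deriv(2)[OF s2]
  show ?thesis unfolding dual_op_def by (simp only: d1 d2 d3)
qed

lemma linearized_dist_eq:
  assumes v: "v \<in> L2" and f: "f \<in> test_functions"
  shows "const_minus_deriv2 1 (dist_of (\<lambda>x. z * v x)) f
      - (of_real c * dist_deriv (const_minus_deriv2 1 (dist_of v)) f
          - dist_deriv (const_minus_deriv2 4 (dist_of (\<lambda>\<xi>. of_real (u0 \<xi>) * v \<xi>))) f)
    = (LINT x|lborel. v x * dual_op z (\<lambda>x. of_real (f x)) x)"
proof -
  have t0: "ctest (\<lambda>x. complex_of_real (f x))" by (rule ctest_of_real[OF f])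
  have s: "csmooth (\<lambda>x. complex_of_real (f x))" using t0 by (simp add: ctest_def)
  note s1 = csmooth_of_real_deriv(3)[OF s] and d1 = csmooth_of_real_deriv(2)[OF s]
  note s2 = csmooth_of_real_deriv(3)[OF s1] and d2 = csmooth_of_real_deriv(2)[OF s1]
  note d3 = csmooth_of_real_deriv(2)[OF s2]
  have t1: "ctest (\<lambda>x. complex_of_real (deriv f x))" using ctest_vderiv[OF t0] unfolding d1 .
  have t2: "ctest (\<lambda>x. complex_of_real (deriv (deriv f) x))" using ctest_vderiv[OF t1] unfolding d2 .
  have t3: "ctest (\<lambda>x. complex_of_real (deriv (deriv (deriv f)) x))" using ctest_vderiv[OF t2] unfolding d3 .
  have i: "integrable lborel (\<lambda>x. v x * of_real (g x))" "integrable lborel (\<lambda>x. v x * (of_real (u0 x) * of_real (g x)))"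
    if "ctest (\<lambda>x. complex_of_real (g x))" for g
    using that by (auto intro!: L2_mult_integrable v ctest_L2 ctest_mult' csmooth_u0)
  define I where "I g = (LINT x|lborel. v x * complex_of_real (g x))" for g
  define J where "J g = (LINT x|lborel. v x * (complex_of_real (u0 x) * of_real (g x)))" for g
  have D1: "dist_of v g = I g" for g
    unfolding dist_of_def I_def by (simp add: scaleR_conv_of_real mult.commute)
  have D2: "dist_of (\<lambda>\<xi>. of_real (u0 \<xi>) * v \<xi>) g = J g" for g
    unfolding dist_of_def J_def by (simp add: scaleR_conv_of_real mult_ac)
  have D3: "dist_of (\<lambda>x. z * v x) g = z * I g" if "ctest (\<lambda>x. complex_of_real (g x))" for g
  proof -
    have "dist_of (\<lambda>x. z * v x) g = (LINT x|lborel. z * (v x * complex_of_real (g x)))"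
      unfolding dist_of_def by (simp add: scaleR_conv_of_real mult_ac)
    then show ?thesis using i(1)[OF that] by (simp add: I_def)
  qed
  have "(LINT x|lborel. v x * dual_op z (\<lambda>x. of_real (f x)) x)
     = (LINT x|lborel. z * (v x * of_real (f x)) - z * (v x * of_real (deriv (deriv f) x))
       + of_real c * (v x * of_real (deriv f x)) - 4 * (v x * (of_real (u0 x) * of_real (deriv f x)))
       - of_real c * (v x * of_real (deriv (deriv (deriv f)) x)) + v x * (of_real (u0 x) * of_real (deriv (deriv (deriv f)) x)))"
    by (simp add: dual_op_of_real[OF f] w_def algebra_simps)
  also have "\<dots> = z * I f - z * I (deriv (deriv f)) + of_real c * I (deriv f) - 4 * J (deriv f)
       - of_real c * I (deriv (deriv (deriv f))) + J (deriv (deriv (deriv f)))"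
    unfolding I_def J_def using i[OF t0] i[OF t1] i[OF t2] i[OF t3] by simp
  also have "\<dots> = const_minus_deriv2 1 (dist_of (\<lambda>x. z * v x)) f
      - (of_real c * dist_deriv (const_minus_deriv2 1 (dist_of v)) f
          - dist_deriv (const_minus_deriv2 4 (dist_of (\<lambda>\<xi>. of_real (u0 \<xi>) * v \<xi>))) f)"
    unfolding const_minus_deriv2_def dist_deriv_def D1 D2 D3[OF t0] D3[OF t2]
    by (simp add: algebra_simps)
  finally show ?thesis by simp
qed

text \<open>The eigenvalue relation in the graph is an identity of distributions on real test
  functions. As \<open>dual_op\<close> is complex linear, splitting into real and imaginary parts
  extends it to complex ones.\<close>

lemma graph_linearized_DP_iff:
  assumes v: "v \<in> L2"
  shows "(v, \<lambda>x. z * v x) \<in> linearized_DP c u0 \<longleftrightarrow> v \<in> H1 \<and> weak_sol z v"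
proof -
  have zv: "(\<lambda>x. z * v x) \<in> L2"
    using v by (rule L2_bound[of v _ "cmod z"]) (use L2_measurable[OF v] in \<open>auto simp: norm_mult\<close>)
  have "(\<forall>f\<in>test_functions. (LINT x|lborel. v x * dual_op z (\<lambda>x. of_real (f x)) x) = 0) \<longleftrightarrow> weak_sol z v"
  proof
    assume "weak_sol z v"
    then show "\<forall>f\<in>test_functions. (LINT x|lborel. v x * dual_op z (\<lambda>x. of_real (f x)) x) = 0"
      using ctest_of_real by (auto simp: weak_sol_def)
  next
    assume *: "\<forall>f\<in>test_functions. (LINT x|lborel. v x * dual_op z (\<lambda>x. of_real (f x)) x) = 0"
    show "weak_sol z v"
      unfolding weak_sol_def
    proof (intro conjI v allI impI)
      fix \<phi> assume "ctest \<phi>"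
      then obtain f g where fg: "f \<in> test_functions" "g \<in> test_functions" "\<phi> = (\<lambda>x. of_real (f x) + \<i> * of_real (g x))"
        by (rule ctest_split)
      have t: "ctest (\<lambda>x. complex_of_real (f x))" "ctest (\<lambda>x. complex_of_real (g x))"
        using fg ctest_of_real by auto
      then have s: "csmooth (\<lambda>x. complex_of_real (f x))" "csmooth (\<lambda>x. complex_of_real (g x))"
        by (auto simp: ctest_def)
      have d: "dual_op z \<phi> x = dual_op z (\<lambda>x. of_real (f x)) x + \<i> * dual_op z (\<lambda>x. of_real (g x)) x" for x
      proof -
        have "dual_op z (\<lambda>x. \<i> * of_real (g x)) x = \<i> * dual_op z (\<lambda>x. of_real (g x)) x"
          using vderiv_cmult[OF s(2), of \<i>] vderiv_cmult[OF csmooth_deriv(2)[OF s(2)], of \<i>]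
            vderiv_cmult[OF csmooth_deriv(2)[OF csmooth_deriv(2)[OF s(2)]], of \<i>]
          by (simp add: dual_op_def algebra_simps)
        moreover have "csmooth (\<lambda>x. \<i> * of_real (g x))" by (intro csmooth_intros s)
        ultimately show ?thesis unfolding fg(3) by (simp add: dual_op_add s)
      qed
      have i: "integrable lborel (\<lambda>x. v x * dual_op z h x)" if "ctest h" for h
      proof -
        obtain R where R: "\<And>x. \<bar>x\<bar> > R \<Longrightarrow> h x = 0" and hs: "csmooth h" using \<open>ctest h\<close> by (auto simp: ctest_def)
        have "dual_op z h x = 0" if x: "\<bar>x\<bar> > R" for x
        proof -
          have "dual_op z h x = dual_op z (\<lambda>_. 0) x"
            by (rule dual_op_local[of "{x. \<bar>x\<bar> > R}"])
               (use R x hs in \<open>auto intro!: open_Collect_less continuous_intros csmooth_const\<close>)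
          moreover have "vderiv (\<lambda>_. 0) = (\<lambda>_. 0)" by (rule vderiv_eqI) simp
          ultimately show ?thesis by (simp add: dual_op_def)
        qed
        then show ?thesis
          by (intro L2_mult_integrable v L2I_continuous[of _ R] csmooth_continuous_on csmooth_dual_op hs)
      qed
      have "(LINT x|lborel. v x * dual_op z \<phi> x) = (LINT x|lborel. v x * dual_op z (\<lambda>x. of_real (f x)) x + \<i> * (v x * dual_op z (\<lambda>x. of_real (g x)) x))"
        by (simp add: d algebra_simps)
      also have "\<dots> = (LINT x|lborel. v x * dual_op z (\<lambda>x. of_real (f x)) x) + \<i> * (LINT x|lborel. v x * dual_op z (\<lambda>x. of_real (g x)) x)"
        using i[OF t(1)] i[OF t(2)] by simp
      also have "\<dots> = 0" using * fg by simp
      finally show "(LINT x|lborel. v x * dual_op z \<phi> x) = 0" .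
    qed
  qed
  moreover have "const_minus_deriv2 1 (dist_of (\<lambda>x. z * v x)) f
      = of_real c * dist_deriv (const_minus_deriv2 1 (dist_of v)) f
          - dist_deriv (const_minus_deriv2 4 (dist_of (\<lambda>\<xi>. of_real (u0 \<xi>) * v \<xi>))) f
    \<longleftrightarrow> (LINT x|lborel. v x * dual_op z (\<lambda>x. of_real (f x)) x) = 0" if "f \<in> test_functions" for f
    unfolding linearized_dist_eq[OF v that, symmetric] right_minus_eq ..
  ultimately show ?thesis
    unfolding linearized_DP_def inv_one_minus_deriv2_def dist_eq_def
    using zv by simp
qed

section \<open>The translation mode as an eigenfunction\<close>

lemma w_minus_W_L2: "(\<lambda>x. complex_of_real (w x - W)) \<in> L2"
proof -
  define q where "q x = (w x - W)\<^sup>2" for x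
  have [measurable]: "w \<in> borel_measurable borel"
    using w_deriv by (intro borel_measurable_continuous_onI) (meson DERIV_isCont continuous_at_imp_continuous_on)
  have [measurable]: "r \<in> borel_measurable borel"
    using r_deriv by (intro borel_measurable_continuous_onI) (meson DERIV_isCont continuous_at_imp_continuous_on)
  have qm [measurable]: "q \<in> borel_measurable borel" unfolding q_def by measurable
  have "eventually (\<lambda>x. r x < - r0 / 2) at_top"
    by (rule order_tendstoD(2)[OF r_tendsto]) (use r0_pos in simp)
  then obtain X where X: "\<And>x. x \<ge> X \<Longrightarrow> r x < - r0 / 2" by (auto simp: eventually_at_top_linorder)
  define Y where "Y = max X 0"
  \<comment> \<open>\<open>?g\<close> is the derivative of \<open>- q\<close>. Beyond
    \<open>Y\<close> it dominates \<open>r0 / c * q\<close>, because there \<open>r\<close> is below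
    \<open>- r0 / 2\<close>, while its integral over \<open>[Y, \<infinity>)\<close> is
    \<open>q Y\<close>. So \<open>q\<close> is integrable to the right without any explicit decay
    rate, and evenness of \<open>w\<close> settles the left half-line.\<close>
  let ?g = "\<lambda>x. - (2 * q x * r x / w x)"
  have dq: "((\<lambda>x. - q x) has_real_derivative ?g x) (at x)" for x
    unfolding q_def by (auto intro!: derivative_eq_intros w_deriv_eq simp: power2_eq_square)
  have g0: "0 \<le> ?g x" if "x \<ge> Y" for x
  proof -
    have "r x \<le> 0" using X[of x] that r0_pos by (auto simp: Y_def)
    then have "2 * q x * r x \<le> 0" by (intro mult_nonneg_nonpos) (auto simp: q_def)
    then show ?thesis using w_pos[of x] by (simp add: divide_le_0_iff)
  qed
  have "(\<integral>\<^sup>+x. ennreal (?g x) * indicator {Y..} x \<partial>lborel) = ennreal (0 - - q Y)"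
  proof (rule nn_integral_FTC_atLeast[OF _ dq g0])
    have "((\<lambda>x. - q x) \<longlongrightarrow> - (W - W)\<^sup>2) at_top" unfolding q_def by (intro tendsto_intros w_tendsto)
    then show "((\<lambda>x. - q x) \<longlongrightarrow> 0) at_top" by simp
  qed measurable
  moreover have "(\<integral>\<^sup>+x. ennreal (indicator {Y..} x * ?g x) \<partial>lborel) = (\<integral>\<^sup>+x. ennreal (?g x) * indicator {Y..} x \<partial>lborel)"
    by (rule nn_integral_cong) (auto simp: indicator_def)
  ultimately have fin: "(\<integral>\<^sup>+x. ennreal (indicator {Y..} x * ?g x) \<partial>lborel) < \<infinity>" by simp
  have gi: "integrable lborel (\<lambda>x. indicator {Y..} x * ?g x)"
  proof (rule integrableI_nonneg[OF _ _ fin])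
    have "0 \<le> indicator {Y..} x * ?g x" for x
      using g0[of x] by (cases "x \<ge> Y") (simp_all only: indicator_simps atLeast_iff mult_1 mult_zero_left not_le order_refl)
    then show "AE x in lborel. 0 \<le> indicator {Y..} x * ?g x" by (rule AE_I2)
  qed measurable
  have i1: "integrable lborel (\<lambda>x. indicator {Y..} x * q x)"
  proof (rule Bochner_Integration.integrable_bound)
    show "integrable lborel (\<lambda>x. c / r0 * (indicator {Y..} x * ?g x))" using gi by (rule integrable_mult_right)
    have "norm (indicator {Y..} x * q x) \<le> norm (c / r0 * (indicator {Y..} x * ?g x))" for x
    proof (cases "x \<ge> Y")
      case True
      then have rx: "r x < - r0 / 2" using X by (simp add: Y_def)
      have q0: "q x \<ge> 0" by (simp add: q_def)
      have "q x * w x * r0 \<le> c * (q x * (- 2 * r x))"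
      proof -
        have "w x * r0 \<le> c * (- 2 * r x)"
          using rx r0_pos w_pos[of x] w_less[of x] by (intro mult_mono) auto
        from mult_left_mono[OF this q0] show ?thesis by (simp add: mult_ac)
      qed
      then have "q x \<le> c / r0 * ?g x" using r0_pos w_pos[of x] by (simp add: field_simps)
      then have "norm (q x) \<le> norm (c / r0 * ?g x)"
        using abs_of_nonneg[OF q0] abs_ge_self[of "c / r0 * ?g x"] unfolding real_norm_def by linarith
      then show ?thesis using True by (simp only: indicator_simps atLeast_iff mult_1)
    qed simp
    then show "AE x in lborel. norm (indicator {Y..} x * q x) \<le> norm (c / r0 * (indicator {Y..} x * ?g x))" by simp
  qed measurable
  have i2: "integrable lborel (\<lambda>x. indicator {..-Y} x * q x)"
  proof -
    have "integrable lborel (\<lambda>x. indicator {Y..} (0 + - 1 * x) * q (0 + - 1 * x))"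
      by (rule lborel_integrable_real_affine[OF i1]) simp
    moreover have "indicator {Y..} (0 + - 1 * x) * q (0 + - 1 * x) = indicator {..-Y} x * q x" for x
      by (auto simp: indicator_def q_def w_minus)
    ultimately show ?thesis by simp
  qed
  have i3: "integrable lborel (\<lambda>x. c\<^sup>2 * indicator {-Y..Y} x)"
    by (intro integrable_mult_right integrable_real_indicator) (auto simp: emeasure_lborel_Icc_eq)
  have "integrable lborel q"
  proof (rule Bochner_Integration.integrable_bound[OF Bochner_Integration.integrable_add[OF Bochner_Integration.integrable_add[OF i1 i2] i3]])
    have "norm (q x) \<le> norm (indicator {Y..} x * q x + indicator {..-Y} x * q x + c\<^sup>2 * indicator {-Y..Y} x)" for x
    proof -
      have q0: "q x \<ge> 0" by (simp add: q_def)
      have "\<bar>w x - W\<bar> \<le> c" using w_pos[of x] w_less[of x] W_pos k_pos by (simp add: abs_le_iff)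
      then have "q x \<le> c\<^sup>2" using power_mono[of "\<bar>w x - W\<bar>" c 2] by (simp add: q_def)
      moreover have "x \<in> {Y..} \<or> x \<in> {..-Y} \<or> x \<in> {-Y..Y}" by auto
      ultimately have "q x \<le> indicator {Y..} x * q x + indicator {..-Y} x * q x + c\<^sup>2 * indicator {-Y..Y} x"
        using q0 by (auto simp: indicator_def)
      then show ?thesis using q0 by simp
    qed
    then show "AE x in lborel. norm (q x) \<le> norm (indicator {Y..} x * q x + indicator {..-Y} x * q x + c\<^sup>2 * indicator {-Y..Y} x)"
      by simp
  qed measurable
  then show ?thesis by (simp add: L2_def q_def[abs_def] del: of_real_diff)
qed

lemma csmooth_u0': "csmooth (\<lambda>x. complex_of_real (deriv u0 x))" "csmooth (\<lambda>x. complex_of_real (deriv (deriv u0) x))"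
  using csmooth_of_real_deriv(3)[OF csmooth_u0] csmooth_of_real_deriv(3) by blast+

lemma u0'_L2: "(\<lambda>x. complex_of_real (deriv u0 x)) \<in> L2"
proof -
  obtain m where m: "m > 0" "\<And>x. m \<le> w x" by (rule w_bounded_below) auto
  have "\<bar>deriv u0 x\<bar> \<le> c / m * \<bar>w x - W\<bar>" for x
  proof -
    have "\<bar>deriv u0 x\<bar> = \<bar>w x - W\<bar> * \<bar>r x\<bar> / w x"
      using w_pos[of x] by (simp add: u0_deriv_eq abs_mult)
    also have "\<dots> \<le> \<bar>w x - W\<bar> * c / m"
      using m r_abs_le[of x] c_pos by (intro frac_le mult_left_mono) auto
    finally show ?thesis by (simp add: mult.commute)
  qed
  then show ?thesis
    by (intro L2_bound[OF w_minus_W_L2 csmooth_measurable[OF csmooth_u0'(1)], of "c / m"])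
       (simp only: norm_of_real)
qed

text \<open>By the profile equation, \<open>w ^ 3\<close> times the second derivative of
  \<open>u0\<close> is a polynomial in \<open>w\<close> that vanishes at \<open>W\<close>. After
  splitting off \<open>w - W\<close>, each of the four terms of the cofactor is at most
  \<open>c ^ 3\<close>.\<close>

lemma u0''_L2: "(\<lambda>x. complex_of_real (deriv (deriv u0) x)) \<in> L2"
proof -
  obtain m where m: "m > 0" "\<And>x. m \<le> w x" by (rule w_bounded_below) auto
  have "\<bar>deriv (deriv u0) x\<bar> \<le> 4 * c ^ 3 / m ^ 3 * \<bar>w x - W\<bar>" for x
  proof -
    have fac: "z ^ 3 * (W + k - z) - k * W ^ 3 = (z - W) * (k * z\<^sup>2 + k * W * z + k * W\<^sup>2 - z ^ 3)" for z
      by algebra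
    have "deriv (deriv u0) x * w x ^ 3 = w x ^ 3 * (c - w x) - k * W ^ 3"
      using w_pos[of x] by (simp add: profile_ode w_def left_diff_distrib)
    also have "\<dots> = (w x - W) * (k * (w x)\<^sup>2 + k * W * w x + k * W\<^sup>2 - w x ^ 3)"
      using fac[of "w x"] by simp
    finally have "\<bar>deriv (deriv u0) x\<bar> * w x ^ 3 = \<bar>w x - W\<bar> * \<bar>k * (w x)\<^sup>2 + k * W * w x + k * W\<^sup>2 - w x ^ 3\<bar>"
      using w_pos[of x] by (metis abs_mult abs_of_pos zero_less_power)
    also have "\<dots> \<le> \<bar>w x - W\<bar> * (4 * c ^ 3)"
    proof (rule mult_left_mono)
      have kc: "0 \<le> k" "k \<le> c" and Wc: "0 \<le> W" "W \<le> c" and wc: "0 \<le> w x" "w x \<le> c"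
        using k_pos k_less c_pos w_pos[of x] w_less[of x] by auto
      have "k * (w x)\<^sup>2 \<le> c * c\<^sup>2" "k * W * w x \<le> c * c * c" "k * W\<^sup>2 \<le> c * c\<^sup>2" "w x ^ 3 \<le> c ^ 3"
        by (intro mult_mono power_mono kc Wc wc mult_nonneg_nonneg zero_le_power; use c_pos in simp)+
      moreover have "0 \<le> k * (w x)\<^sup>2" "0 \<le> k * W * w x" "0 \<le> k * W\<^sup>2" "0 \<le> w x ^ 3"
        by (intro mult_nonneg_nonneg zero_le_power kc Wc wc)+
      ultimately show "\<bar>k * (w x)\<^sup>2 + k * W * w x + k * W\<^sup>2 - w x ^ 3\<bar> \<le> 4 * c ^ 3"
        by (simp add: power2_eq_square power3_eq_cube abs_le_iff)
    qed simp
    finally have 1: "\<bar>deriv (deriv u0) x\<bar> * w x ^ 3 \<le> \<bar>w x - W\<bar> * (4 * c ^ 3)" .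
    have "m ^ 3 \<le> w x ^ 3" using m by (intro power_mono) (auto intro: less_imp_le)
    then have "\<bar>deriv (deriv u0) x\<bar> * m ^ 3 \<le> \<bar>deriv (deriv u0) x\<bar> * w x ^ 3" by (rule mult_left_mono) simp
    with 1 have "\<bar>deriv (deriv u0) x\<bar> * m ^ 3 \<le> \<bar>w x - W\<bar> * (4 * c ^ 3)" by linarith
    moreover have "m ^ 3 > 0" using m by simp
    ultimately show ?thesis by (simp add: field_simps)
  qed
  then show ?thesis
    by (intro L2_bound[OF w_minus_W_L2 csmooth_measurable[OF csmooth_u0'(2)], of "4 * c ^ 3 / m ^ 3"])
       (simp only: norm_of_real)
qed

lemma u0'_H1: "(\<lambda>x. complex_of_real (deriv u0 x)) \<in> H1"
proof -
  have "dist_deriv (dist_of (\<lambda>x. complex_of_real (deriv u0 x))) f = dist_of (\<lambda>x. complex_of_real (deriv (deriv u0) x)) f"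
    if f: "f \<in> test_functions" for f
  proof -
    have t: "ctest (\<lambda>x. complex_of_real (f x))" by (rule ctest_of_real[OF f])
    have s: "csmooth (\<lambda>x. complex_of_real (f x))" using t by (simp add: ctest_def)
    have t1: "ctest (\<lambda>x. complex_of_real (deriv f x))"
      using ctest_vderiv[OF t] unfolding csmooth_of_real_deriv(2)[OF s] .
    have "0 = (LINT x|lborel. vderiv (\<lambda>x. complex_of_real (deriv u0 x) * of_real (f x)) x)"
      by (rule integral_vderiv_ctest[OF ctest_mult'[OF t csmooth_u0'(1)], symmetric])
    also have "vderiv (\<lambda>x. complex_of_real (deriv u0 x) * of_real (f x))
        = (\<lambda>x. of_real (deriv u0 x) * of_real (deriv f x) + of_real (deriv (deriv u0) x) * of_real (f x))"
      by (simp only: vderiv_mult[OF csmooth_u0'(1) s] csmooth_of_real_deriv(2)[OF s] csmooth_of_real_deriv(2)[OF csmooth_u0'(1)])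
    also have "(LINT x|lborel. complex_of_real (deriv u0 x) * of_real (deriv f x) + of_real (deriv (deriv u0) x) * of_real (f x))
       = (LINT x|lborel. complex_of_real (deriv u0 x) * of_real (deriv f x)) + (LINT x|lborel. complex_of_real (deriv (deriv u0) x) * of_real (f x))"
      by (intro Bochner_Integration.integral_add L2_mult_integrable u0'_L2 u0''_L2 ctest_L2 t t1)
    finally have "- (LINT x|lborel. complex_of_real (deriv u0 x) * of_real (deriv f x))
        = (LINT x|lborel. complex_of_real (deriv (deriv u0) x) * of_real (f x))"
      by (intro minus_unique) (rule sym)
    then show ?thesis
      unfolding dist_deriv_def dist_of_def scaleR_conv_of_real by (simp only: mult.commute)
  qed
  then have "dist_eq (dist_deriv (dist_of (\<lambda>x. complex_of_real (deriv u0 x)))) (dist_of (\<lambda>x. complex_of_real (deriv (deriv u0) x)))"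
    by (simp add: dist_eq_def)
  then show ?thesis unfolding H1_def using u0'_L2 u0''_L2 by blast
qed

text \<open>\<open>u\<^sub>0'\<close> times the dual operator applied to \<open>\<phi>\<close> is a total derivative because
  \<open>(w\<^sup>2)''/2 = 2 w\<^sup>2 - 3 c w + const\<close> by the profile equation.\<close>

lemma weak_sol_u0': "weak_sol 0 (\<lambda>x. complex_of_real (deriv u0 x))"
  unfolding weak_sol_def
proof (intro conjI u0'_L2 allI impI)
  fix \<phi> assume \<phi>: "ctest \<phi>"
  have s: "csmooth \<phi>" using \<phi> by (simp add: ctest_def)
  let ?d = "\<lambda>x. complex_of_real (deriv u0 x)"
  \<comment> \<open>\<open>p\<close> is the derivative of \<open>w w'\<close>; its constant term
    comes from the first integral.\<close>
  define p where "p x = 2 * (w x)\<^sup>2 - 3 * c * w x + (c\<^sup>2 - k\<^sup>2 + k * W)" for x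
  \<comment> \<open>In the derivative of \<open>F\<close> the two terms with the second derivative
    of \<phi> cancel, and the others make up the integrand.\<close>
  define F where "F = (\<lambda>x. (\<omega> x * - ?d x) * vderiv (vderiv \<phi>) x + - of_real (p x) * vderiv \<phi> x)"
  have dg: "((\<lambda>x. \<omega> x * - ?d x) has_vector_derivative of_real (p x)) (at x)" for x
  proof -
    have "((\<lambda>x. w x * - deriv u0 x) has_real_derivative (deriv u0 x)\<^sup>2 - w x * deriv (deriv u0) x) (at x)"
      by (auto intro!: derivative_eq_intros w_deriv u0_deriv simp: power2_eq_square)
    moreover have "(deriv u0 x)\<^sup>2 - w x * deriv (deriv u0) x = p x"
    proof -
      have u: "u0 x = c - w x" by (simp add: w_def)
      have "(w x)\<^sup>2 * ((deriv u0 x)\<^sup>2 - w x * deriv (deriv u0) x)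
          = (w x)\<^sup>2 * (deriv u0 x)\<^sup>2 - w x ^ 3 * deriv (deriv u0) x"
        by (simp add: power2_eq_square power3_eq_cube algebra_simps)
      also have "w x ^ 3 * deriv (deriv u0) x = w x ^ 3 * (c - w x) - k * W ^ 3"
        using w_pos[of x] by (simp add: profile_ode u right_diff_distrib)
      also have "(w x)\<^sup>2 * (deriv u0 x)\<^sup>2 - (w x ^ 3 * (c - w x) - k * W ^ 3) = (w x)\<^sup>2 * p x"
        unfolding u0_first_integral p_def
        by (simp add: power2_eq_square power3_eq_cube algebra_simps)
      finally show ?thesis using w_pos[of x] by (simp only: mult_cancel_left) simp
    qed
    ultimately have "((\<lambda>x. w x * - deriv u0 x) has_real_derivative p x) (at x)" by simp
    from has_vector_derivative_of_real[OF this, where 'a = complex] show ?thesis by simp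
  qed
  have dp: "((\<lambda>x. - complex_of_real (p x)) has_vector_derivative of_real ((4 * w x - 3 * c) * deriv u0 x)) (at x)" for x
  proof -
    have "((\<lambda>x. - p x) has_real_derivative (4 * w x - 3 * c) * deriv u0 x) (at x)"
      unfolding p_def by (auto intro!: derivative_eq_intros w_deriv simp: algebra_simps)
    from has_vector_derivative_of_real[OF this, where 'a = complex] show ?thesis by simp
  qed
  have "csmooth (\<lambda>x. - complex_of_real (p x))"
    unfolding p_def of_real_add of_real_diff of_real_mult of_real_power
    by (intro csmooth_intros)
  then have Ft: "ctest F"
  proof -
    have "ctest (\<lambda>x. (\<omega> x * - ?d x) * vderiv (vderiv \<phi>) x)"
      by (intro ctest_mult' ctest_vderiv \<phi> csmooth_intros csmooth_u0')
    moreover have "ctest (\<lambda>x. complex_of_real (p x) * vderiv \<phi> x)"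
      using \<open>csmooth (\<lambda>x. - complex_of_real (p x))\<close>[THEN csmooth_uminus]
      by (intro ctest_mult' ctest_vderiv \<phi>) simp
    ultimately show ?thesis unfolding F_def using ctest_diff by fastforce
  qed
  have "vderiv F x = ?d x * dual_op 0 \<phi> x" for x
  proof -
    have "(F has_vector_derivative (\<omega> x * - ?d x) * vderiv (vderiv (vderiv \<phi>)) x + of_real (p x) * vderiv (vderiv \<phi>) x
      + (- of_real (p x) * vderiv (vderiv \<phi>) x + of_real ((4 * w x - 3 * c) * deriv u0 x) * vderiv \<phi> x)) (at x)"
      unfolding F_def
      by (intro has_vector_derivative_add has_vector_derivative_mult dg dp csmooth_deriv s)
    then have "vderiv F x = (\<omega> x * - ?d x) * vderiv (vderiv (vderiv \<phi>)) x + of_real (p x) * vderiv (vderiv \<phi>) x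
      + (- of_real (p x) * vderiv (vderiv \<phi>) x + of_real ((4 * w x - 3 * c) * deriv u0 x) * vderiv \<phi> x)"
      unfolding vderiv_def[of F] by (rule vector_derivative_at)
    then show ?thesis by (simp add: dual_op_def algebra_simps)
  qed
  then show "(LINT x|lborel. ?d x * dual_op 0 \<phi> x) = 0"
    using integral_vderiv_ctest[OF Ft] by simp
qed

text \<open>Near \<open>+\<infinity>\<close> the function \<open>r\<close> is negative and
  \<open>w\<close> differs from \<open>W\<close>, so the derivative of \<open>u0\<close> has no
  zeros on an interval of positive length.\<close>

lemma u0'_not_AE_0: "\<not> (AE x in lborel. complex_of_real (deriv u0 x) = 0)"
proof
  assume "AE x in lborel. complex_of_real (deriv u0 x) = 0"
  then have "AE x in lborel. r x = 0"
  proof eventually_elim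
    case (elim x)
    then have "(w x - W) * r x / w x = 0" by (simp add: u0_deriv_eq del: of_real_mult of_real_divide)
    then show ?case using w_neq_W[of x] w_pos[of x] by simp
  qed
  moreover have "eventually (\<lambda>x. r x < 0) at_top"
    by (rule order_tendstoD(2)[OF r_tendsto]) (use r0_pos in simp)
  then obtain X where X: "\<And>x. x \<ge> X \<Longrightarrow> r x < 0" by (auto simp: eventually_at_top_linorder)
  ultimately have "AE x in lborel. x \<notin> {X..X + 1}"
    by (auto elim!: eventually_mono dest: X)
  then have "emeasure lborel {X..X + 1} = 0"
    by (subst (asm) AE_iff_measurable[of "{X..X + 1}"]) auto
  then show False by simp
qed

lemma point_spectrum_L2_eq: "point_spectrum_L2 (linearized_DP c u0) = {0}"
proof (intro subset_antisym subsetI)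
  fix z assume "z \<in> point_spectrum_L2 (linearized_DP c u0)"
  then obtain v where v: "v \<in> L2" "\<not> (AE \<xi> in lborel. v \<xi> = 0)" "(v, \<lambda>\<xi>. z * v \<xi>) \<in> linearized_DP c u0"
    by (auto simp: point_spectrum_L2_def)
  then have "weak_sol z v" by (simp add: graph_linearized_DP_iff)
  then show "z \<in> {0}" using weak_sol_eq_0 v(2) by blast
next
  fix z :: complex assume "z \<in> {0}"
  moreover have "((\<lambda>x. complex_of_real (deriv u0 x)), \<lambda>x. 0 * complex_of_real (deriv u0 x)) \<in> linearized_DP c u0"
    using graph_linearized_DP_iff[OF u0'_L2] u0'_H1 weak_sol_u0' by blast
  ultimately show "z \<in> point_spectrum_L2 (linearized_DP c u0)"
    unfolding point_spectrum_L2_def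
    by (intro CollectI bexI[OF _ u0'_L2] conjI u0'_not_AE_0) simp
qed

end

theorem theorem4p10:
  fixes c k :: real and u0 :: "real \<Rightarrow> real"
  assumes "c > 0" and "k \<in> {0<..<c / 4}"
    and "solitary_wave_profile c k u0"
  shows "point_spectrum_L2 (linearized_DP c u0) = {0}"
proof -
  interpret solitary_wave c k u0
    by standard (use assms in auto)
  show ?thesis by (rule point_spectrum_L2_eq)
qed

end
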